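(* On $\pi$-processes, the $\pi$-bisimilarity $\simeq_{\pi}$ coincides with the absolute equality $=_{\pi}$; that is, for all $\pi$-processes $P,Q$, $P\simeq_{\pi}Q$ if and only if $P=_{\pi}Q$.
   Context: Fix disjoint countably infinite sets $\mathcal{N}$ of names (ranged over by $a,b,c,d,\dots$) and $\mathcal{N}_v$ of name variables (ranged over by $x,y,z,\dots$); $n,m,p,q$ range over $\mathcal{N}\cup\mathcal{N}_v$. The $\pi$-terms are given by $T ::= \mathbf{0} \mid \sum_{i\in I} n(x).T_i \mid \sum_{i\in I}\overline{n}m_i.T_i \mid S\,|\,T \mid (c)T \mid [p{=}q]T \mid [p{\neq}q]T \mid\ !\pi.T$, where $\pi ::= n(x)\mid \overline{n}m$ and $I$ is finite and nonempty. In $n(x).T$ the variable $x$ is bound; in $(c)T$ the name $c$ is local (bound); terms are identified up to $\alpha$-conversion. $gn(\cdot)$ denotes the global (non-local) names and $fv(\cdot)$ the free name variables. A $\pi$-process is a term with no free name variables. Labels are $ab$, $\overline{a}b$, $\overline{a}(c)$ with $a,b,c$ names; actions $\lambda$ are labels and $\tau$; $n(\lambda)$ is the set of names in $\lambda$. The transition relation is the least relation closed under: $\sum_{i\in I}a(x).T_i\xrightarrow{ac}T_i\{c/x\}$ for each $i\in I$ and each name $c$; $\sum_{i\in I}\overline{a}c_i.T_i\xrightarrow{\overline{a}c_i}T_i$ for each $i\in I$; if $T\xrightarrow{\lambda}T'$ then $S|T\xrightarrow{\lambda}S|T'$ and $T|S\xrightarrow{\lambda}T'|S$; if $S\xrightarrow{ab}S'$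 and $T\xrightarrow{\overline{a}b}T'$ then $S|T\xrightarrow{\tau}S'|T'$ and $T|S\xrightarrow{\tau}T'|S'$; if $S\xrightarrow{ac}S'$ and $T\xrightarrow{\overline{a}(c)}T'$ then $S|T\xrightarrow{\tau}(c)(S'|T')$ and $T|S\xrightarrow{\tau}(c)(T'|S')$; if $T\xrightarrow{\overline{a}c}T'$ then $(c)T\xrightarrow{\overline{a}(c)}T'$; if $T\xrightarrow{\lambda}T'$ and $c\notin n(\lambda)$ then $(c)T\xrightarrow{\lambda}(c)T'$; if $T\xrightarrow{\lambda}T'$ then $[a{=}a]T\xrightarrow{\lambda}T'$ and $[a{\neq}b]T\xrightarrow{\lambda}T'$ for distinct names $a,b$; $!\overline{a}b.T\xrightarrow{\overline{a}b}T\,|\,!\overline{a}b.T$ and $!a(x).T\xrightarrow{ab}T\{b/x\}\,|\,!a(x).T$ for every name $b$ (bound names are renamed to avoid capture). Write $\Longrightarrow$ for the reflexive transitive closure of $\xrightarrow{\tau}$, and $\stackrel{\tau}{\Longrightarrow}$ for $\Longrightarrow\xrightarrow{\tau}\Longrightarrow$. A process $P$ is observable, $P\Downarrow$, if $P\Longrightarrow\xrightarrow{\ell}P'$ for some label $\ell$ and some $P'$. A relation $\mathcal{R}$ on processes is: equipollent if $P\mathcal{R}Q$ implies ($P\Downarrow\iff Q\Downarrow$); extensional if $L\mathcal{R}M$ and $P\mathcal{R}Q$ imply $(L|P)\mathcal{R}(M|Q)$, and $P\mathcal{R}Q$ implies $(c)P\mathcal{R}(c)Q$ for every name $c$; codivergent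 if whenever $P\mathcal{R}Q$ and $Q\xrightarrow{\tau}Q_1\xrightarrow{\tau}Q_2\xrightarrow{\tau}\cdots$ is infinite, there are $k\ge1$ and $P'$ with $P\stackrel{\tau}{\Longrightarrow}P'\mathcal{R}Q_k$, and symmetrically for infinite $\tau$-sequences from $P$; a bisimulation if whenever $P\mathcal{R}Q\xrightarrow{\tau}Q'$ then either $P\Longrightarrow P'$ with $P'\mathcal{R}Q$ and $P'\mathcal{R}Q'$, or $P\Longrightarrow P''\xrightarrow{\tau}P'$ with $P''\mathcal{R}Q$ and $P'\mathcal{R}Q'$, and symmetrically whenever $Q\mathcal{R}^{-1}P\xrightarrow{\tau}P'$. The absolute equality $=_{\pi}$ is the largest reflexive relation on $\pi$-processes that is equipollent, extensional, codivergent and a bisimulation. A codivergent bisimulation $\mathcal{R}$ is a $\pi$-bisimulation if for every label $\ell$: whenever $P\mathcal{R}Q\xrightarrow{\ell}Q'$ there are $P'',P'$ with $P\Longrightarrow P''\xrightarrow{\ell}P'$, $P''\mathcal{R}Q$ and $P'\mathcal{R}Q'$; and symmetrically whenever $Q\mathcal{R}^{-1}P\xrightarrow{\ell}P'$ there are $Q'',Q'$ with $Q\Longrightarrow Q''\xrightarrow{\ell}Q'$, $P\mathcal{R}Q''$ and $P'\mathcal{R}Q'$. The $\pi$-bisimilarity $\simeq_{\pi}$ is the largest $\pi$-bisimulation.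
   Formalization: Bound names in labels follow the usual freshness convention: (c)T performs ā(c) only if a≠c, bound names are fresh for parallel components and tests, and the π-bisimulation clause for ā(c) is required only when c is not global in P or Q. *)

theory Defs
  imports Main
begin

section \<open>Syntax\<close>

datatype name = Name nat

datatype nvar = NVar nat

text \<open>
  Terms up to \<open>\<alpha>\<close>-conversion are represented locally nameless: global names and free
  name variables are written \<open>Nm a\<close> and \<open>Vr x\<close>, whereas an occurrence bound by an input
  prefix \<open>n(x)\<close> or by a localization \<open>(c)\<close> is written \<open>Bd k\<close>, where \<open>k\<close> is the number of
  binders lying between the occurrence and its own binder (input and localization
  binders are counted together).  Two \<open>\<alpha>\<close>-convertible terms have the same representation.
\<close>

datatype nm = Nm name | Vr nvar | Bd nat

text \<open>
  In \<open>InSum n Bs\<close> each member of \<open>Bs\<close> is the body of one binder, likewise the body in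
  \<open>Res B\<close> and in \<open>RepIn n B\<close>.  The type parameter only serves to obtain the set
  function \<open>nms\<close> of all occurring names, variables and indices; terms have type \<open>nm trm\<close>.
\<close>

datatype (nms: 'n) trm =
    Zero
  | InSum 'n "'n trm list"
  | OutSum 'n "('n \<times> 'n trm) list"
  | Par "'n trm" "'n trm"
  | Res "'n trm"
  | Match 'n 'n "'n trm"
  | Mismatch 'n 'n "'n trm"
  | RepIn 'n "'n trm"
  | RepOut 'n 'n "'n trm"

type_synonym pterm = "nm trm"

definition gn :: "pterm \<Rightarrow> name set" where
  "gn T = {a. Nm a \<in> nms T}"

definition fv :: "pterm \<Rightarrow> nvar set" where
  "fv T = {x. Vr x \<in> nms T}"

text \<open>\<open>map_at f k T\<close> applies \<open>f (k + d)\<close> to every occurrence under exactly \<open>d\<close> binders of \<open>T\<close>.\<close>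

fun map_at :: "(nat \<Rightarrow> nm \<Rightarrow> nm) \<Rightarrow> nat \<Rightarrow> pterm \<Rightarrow> pterm" where
  "map_at f k Zero = Zero"
| "map_at f k (InSum n Bs) = InSum (f k n) (map (map_at f (Suc k)) Bs)"
| "map_at f k (OutSum n ms) = OutSum (f k n) (map (\<lambda>(m, T). (f k m, map_at f k T)) ms)"
| "map_at f k (Par S T) = Par (map_at f k S) (map_at f k T)"
| "map_at f k (Res B) = Res (map_at f (Suc k) B)"
| "map_at f k (Match p q T) = Match (f k p) (f k q) (map_at f k T)"
| "map_at f k (Mismatch p q T) = Mismatch (f k p) (f k q) (map_at f k T)"
| "map_at f k (RepIn n B) = RepIn (f k n) (map_at f (Suc k) B)"
| "map_at f k (RepOut n m T) = RepOut (f k n) (f k m) (map_at f k T)"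

text \<open>
  \<open>inst B c\<close> is \<open>T{c/x}\<close> (capture is impossible) if \<open>B\<close> is the body of the binder of
  \<open>n(x).T\<close>; \<open>abst n T\<close> is conversely the body obtained from \<open>T\<close> by binding the name or
  name variable \<open>n\<close>.
\<close>

definition inst :: "pterm \<Rightarrow> name \<Rightarrow> pterm" where
  "inst B c = map_at (\<lambda>k n. if n = Bd k then Nm c else n) 0 B"

definition abst :: "nm \<Rightarrow> pterm \<Rightarrow> pterm" where
  "abst n T = map_at (\<lambda>k m. if m = n then Bd k else m) 0 T"

text \<open>The localization \<open>(c)T\<close>; if \<open>c \<notin> gn B\<close> then \<open>Res B\<close> is \<open>(c)(inst B c)\<close>.\<close>

definition loc :: "name \<Rightarrow> pterm \<Rightarrow> pterm" where
  "loc c T = Res (abst (Nm c) T)"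

lemma map_at_map_trm: "map_at f k (map_trm g T) = map_at (\<lambda>k n. f k (g n)) k T"
  by (induction f k T rule: map_at.induct) auto

lemma loc_alpha:
  assumes "d \<notin> gn T"
  shows "loc d (map_trm (\<lambda>n. if n = Nm c then Nm d else n) T) = loc c T"
proof -
  have "d \<notin> gn T \<Longrightarrow>
      map_at (\<lambda>k n. if (if n = Nm c then Nm d else n) = Nm d then Bd k
                    else (if n = Nm c then Nm d else n)) k T
      = map_at (\<lambda>k m. if m = Nm c then Bd k else m) k T" for k
    by (induction "\<lambda>k m. if m = Nm c then Bd k else m" k T rule: map_at.induct)
       (fastforce simp: gn_def)+
  from this[OF assms] show ?thesis
    by (simp add: loc_def abst_def map_at_map_trm)
qed

text \<open>The range of \<open>n, m, p, q\<close>: names and name variables.\<close>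

definition is_nm :: "nm \<Rightarrow> bool" where
  "is_nm n \<longleftrightarrow> (\<exists>a. n = Nm a) \<or> (\<exists>x. n = Vr x)"

text \<open>The grammar of \<open>\<pi>\<close>-terms; it excludes dangling indices and empty sums.\<close>

inductive pi_term :: "pterm \<Rightarrow> bool" where
  "pi_term Zero"
| "is_nm n \<Longrightarrow> Ts \<noteq> [] \<Longrightarrow> \<forall>T \<in> set Ts. pi_term T \<Longrightarrow> pi_term (InSum n (map (abst (Vr x)) Ts))"
| "is_nm n \<Longrightarrow> ms \<noteq> [] \<Longrightarrow> \<forall>p \<in> set ms. is_nm (fst p) \<and> pi_term (snd p) \<Longrightarrow> pi_term (OutSum n ms)"
| "pi_term S \<Longrightarrow> pi_term T \<Longrightarrow> pi_term (Par S T)"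
| "pi_term T \<Longrightarrow> pi_term (loc c T)"
| "is_nm p \<Longrightarrow> is_nm q \<Longrightarrow> pi_term T \<Longrightarrow> pi_term (Match p q T)"
| "is_nm p \<Longrightarrow> is_nm q \<Longrightarrow> pi_term T \<Longrightarrow> pi_term (Mismatch p q T)"
| "is_nm n \<Longrightarrow> pi_term T \<Longrightarrow> pi_term (RepIn n (abst (Vr x) T))"
| "is_nm n \<Longrightarrow> is_nm m \<Longrightarrow> pi_term T \<Longrightarrow> pi_term (RepOut n m T)"

definition pi_process :: "pterm \<Rightarrow> bool" where
  "pi_process P \<longleftrightarrow> pi_term P \<and> fv P = {}"


section \<open>Transitions\<close>

datatype label = In name name | Out name name | BOut name name

datatype action = Lab label | Tau

fun names_label :: "label \<Rightarrow> name set" where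
  "names_label (In a b) = {a, b}"
| "names_label (Out a b) = {a, b}"
| "names_label (BOut a c) = {a, c}"

fun bn_label :: "label \<Rightarrow> name set" where
  "bn_label (BOut a c) = {c}"
| "bn_label (In a b) = {}"
| "bn_label (Out a b) = {}"

fun names :: "action \<Rightarrow> name set" where
  "names (Lab l) = names_label l"
| "names Tau = {}"

fun bn :: "action \<Rightarrow> name set" where
  "bn (Lab l) = bn_label l"
| "bn Tau = {}"

text \<open>
  The side conditions on \<open>bn\<close>, the condition \<open>a \<noteq> c\<close> in \<open>extrude\<close> and the condition
  \<open>c \<notin> gn S\<close> in the \<open>close\<close> rules make explicit the convention that bound names, which
  include the name \<open>c\<close> of a label \<open>BOut a c\<close>, are chosen distinct from the global names
  they could be confused with.
\<close>

inductive step :: "pterm \<Rightarrow> action \<Rightarrow> pterm \<Rightarrow> bool"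
  ("_ \<midarrow>_\<rightarrow> _" [61, 0, 61] 60) where
  inp: "B \<in> set Bs \<Longrightarrow> InSum (Nm a) Bs \<midarrow>Lab (In a c)\<rightarrow> inst B c"
| out: "(Nm c, T) \<in> set ms \<Longrightarrow> OutSum (Nm a) ms \<midarrow>Lab (Out a c)\<rightarrow> T"
| par_r: "T \<midarrow>l\<rightarrow> T' \<Longrightarrow> bn l \<inter> gn S = {} \<Longrightarrow> Par S T \<midarrow>l\<rightarrow> Par S T'"
| par_l: "T \<midarrow>l\<rightarrow> T' \<Longrightarrow> bn l \<inter> gn S = {} \<Longrightarrow> Par T S \<midarrow>l\<rightarrow> Par T' S"
| com_r: "S \<midarrow>Lab (In a b)\<rightarrow> S' \<Longrightarrow> T \<midarrow>Lab (Out a b)\<rightarrow> T' \<Longrightarrow> Par S T \<midarrow>Tau\<rightarrow> Par S' T'"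
| com_l: "S \<midarrow>Lab (In a b)\<rightarrow> S' \<Longrightarrow> T \<midarrow>Lab (Out a b)\<rightarrow> T' \<Longrightarrow> Par T S \<midarrow>Tau\<rightarrow> Par T' S'"
| close_r: "S \<midarrow>Lab (In a c)\<rightarrow> S' \<Longrightarrow> T \<midarrow>Lab (BOut a c)\<rightarrow> T' \<Longrightarrow> c \<notin> gn S
    \<Longrightarrow> Par S T \<midarrow>Tau\<rightarrow> loc c (Par S' T')"
| close_l: "S \<midarrow>Lab (In a c)\<rightarrow> S' \<Longrightarrow> T \<midarrow>Lab (BOut a c)\<rightarrow> T' \<Longrightarrow> c \<notin> gn S
    \<Longrightarrow> Par T S \<midarrow>Tau\<rightarrow> loc c (Par T' S')"
| extrude: "inst B c \<midarrow>Lab (Out a c)\<rightarrow> T' \<Longrightarrow> c \<notin> gn B \<Longrightarrow> a \<noteq> c \<Longrightarrow> Res B \<midarrow>Lab (BOut a c)\<rightarrow> T'"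
| res: "inst B c \<midarrow>l\<rightarrow> T' \<Longrightarrow> c \<notin> gn B \<Longrightarrow> c \<notin> names l \<Longrightarrow> Res B \<midarrow>l\<rightarrow> loc c T'"
| match: "T \<midarrow>l\<rightarrow> T' \<Longrightarrow> bn l \<inter> {a} = {} \<Longrightarrow> Match (Nm a) (Nm a) T \<midarrow>l\<rightarrow> T'"
| mismatch: "T \<midarrow>l\<rightarrow> T' \<Longrightarrow> a \<noteq> b \<Longrightarrow> bn l \<inter> {a, b} = {} \<Longrightarrow> Mismatch (Nm a) (Nm b) T \<midarrow>l\<rightarrow> T'"
| rep_out: "RepOut (Nm a) (Nm b) T \<midarrow>Lab (Out a b)\<rightarrow> Par T (RepOut (Nm a) (Nm b) T)"
| rep_in: "RepIn (Nm a) B \<midarrow>Lab (In a b)\<rightarrow> Par (inst B b) (RepIn (Nm a) B)"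

definition tau :: "pterm \<Rightarrow> pterm \<Rightarrow> bool" where
  "tau P Q \<longleftrightarrow> P \<midarrow>Tau\<rightarrow> Q"

abbreviation taus :: "pterm \<Rightarrow> pterm \<Rightarrow> bool" where
  "taus \<equiv> tau\<^sup>*\<^sup>*"

definition tau_weak :: "pterm \<Rightarrow> pterm \<Rightarrow> bool" where
  "tau_weak = taus OO tau OO taus"

definition observable :: "pterm \<Rightarrow> bool" where
  "observable P \<longleftrightarrow> (\<exists>P'' l P'. taus P P'' \<and> P'' \<midarrow>Lab l\<rightarrow> P')"


section \<open>Absolute equality and \<open>\<pi>\<close>-bisimilarity\<close>

type_synonym prel = "pterm \<Rightarrow> pterm \<Rightarrow> bool"

definition on_processes :: "prel \<Rightarrow> bool" where
  "on_processes R \<longleftrightarrow> (\<forall>P Q. R P Q \<longrightarrow> pi_process P \<and> pi_process Q)"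

definition reflexive :: "prel \<Rightarrow> bool" where
  "reflexive R \<longleftrightarrow> (\<forall>P. pi_process P \<longrightarrow> R P P)"

definition equipollent :: "prel \<Rightarrow> bool" where
  "equipollent R \<longleftrightarrow> (\<forall>P Q. R P Q \<longrightarrow> (observable P \<longleftrightarrow> observable Q))"

definition extensional :: "prel \<Rightarrow> bool" where
  "extensional R \<longleftrightarrow>
     (\<forall>L M P Q. R L M \<longrightarrow> R P Q \<longrightarrow> R (Par L P) (Par M Q)) \<and>
     (\<forall>P Q c. R P Q \<longrightarrow> R (loc c P) (loc c Q))"

text \<open>
  In the next three pairs the first definition is the clause in which \<open>P\<close> answers \<open>Q\<close>;
  the clause in which \<open>Q\<close> answers \<open>P\<close> is the same one for the converse relation.
\<close>

definition codivergent_half :: "prel \<Rightarrow> bool" where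
  "codivergent_half R \<longleftrightarrow>
     (\<forall>P q. R P (q 0) \<and> (\<forall>i. tau (q i) (q (Suc i))) \<longrightarrow>
        (\<exists>k\<ge>1. \<exists>P'. tau_weak P P' \<and> R P' (q k)))"

definition codivergent :: "prel \<Rightarrow> bool" where
  "codivergent R \<longleftrightarrow> codivergent_half R \<and> codivergent_half R\<inverse>\<inverse>"

definition bisimulation_half :: "prel \<Rightarrow> bool" where
  "bisimulation_half R \<longleftrightarrow>
     (\<forall>P Q Q'. R P Q \<and> tau Q Q' \<longrightarrow>
        (\<exists>P'. taus P P' \<and> R P' Q \<and> R P' Q') \<or>
        (\<exists>P'' P'. taus P P'' \<and> tau P'' P' \<and> R P'' Q \<and> R P' Q'))"

definition bisimulation :: "prel \<Rightarrow> bool" where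
  "bisimulation R \<longleftrightarrow> bisimulation_half R \<and> bisimulation_half R\<inverse>\<inverse>"

text \<open>
  A bound output label is matched only if its bound name is global neither in \<open>P\<close> nor in
  \<open>Q\<close>.  Otherwise \<open>P\<close> could fail to answer merely because the bound name chosen by \<open>Q\<close>
  happens to be global in \<open>P\<close>.
\<close>

definition label_half :: "prel \<Rightarrow> bool" where
  "label_half R \<longleftrightarrow>
     (\<forall>P Q l Q'. R P Q \<and> Q \<midarrow>Lab l\<rightarrow> Q' \<and> bn_label l \<inter> (gn P \<union> gn Q) = {} \<longrightarrow>
        (\<exists>P'' P'. taus P P'' \<and> P'' \<midarrow>Lab l\<rightarrow> P' \<and> R P'' Q \<and> R P' Q'))"

definition pi_bisimulation :: "prel \<Rightarrow> bool" where
  "pi_bisimulation R \<longleftrightarrow> on_processes R \<and> codivergent R \<and> bisimulation R \<and>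
     label_half R \<and> label_half R\<inverse>\<inverse>"

definition absolute :: "prel \<Rightarrow> bool" where
  "absolute R \<longleftrightarrow> on_processes R \<and> reflexive R \<and> equipollent R \<and> extensional R \<and>
     codivergent R \<and> bisimulation R"

text \<open>
  The largest relation of each kind is taken to be the union of all relations of that
  kind.  For \<open>absolute\<close> the union is again of that kind because absolute relations
  are closed under composition, and the composition of two of them contains both.
\<close>

definition abs_eq :: prel (infix "=\<^sub>\<pi>" 50) where
  "P =\<^sub>\<pi> Q \<longleftrightarrow> (\<exists>R. absolute R \<and> R P Q)"

definition pi_bisimilar :: prel (infix "\<simeq>\<^sub>\<pi>" 50) where
  "P \<simeq>\<^sub>\<pi> Q \<longleftrightarrow> (\<exists>R. pi_bisimulation R \<and> R P Q)"

end

theory Submission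
  imports Defs "HOL-Combinatorics.Transposition" "HOL-Library.Infinite_Set"
begin

text \<open>
  Bisimilarity is extensional: a run of \<open>M | Q\<close> that is never answered properly consists of runs
  of \<open>M\<close> and \<open>Q\<close> alone, one of which is infinite.  Hence it is contained in absolute
  equality.

  For the converse, a transition of \<open>Q\<close> at a channel \<open>a\<close> is observed by running \<open>Q\<close> in parallel
  with a sender and a receiver on \<open>a\<close>, each of which chooses nondeterministically between
  continuations with distinct fresh barbs.  Weak barbs at a fixed name are preserved by absolute
  equality, since all other names can be localized, and they reveal whether and how the
  observers have been used.  The communication between the two observers, which does not involve
  the observed process, gets rid of both; together with the Bisimulation Lemma
  (\<open>P \<Longrightarrow> P' = Q\<close> and \<open>Q \<Longrightarrow> Q' = P\<close> imply \<open>P = Q\<close>) it allows one to cancel unused observers.  A bound name \<open>c\<close>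
  that has been received is forwarded on a fresh channel \<open>m\<close>, and \<open>(c)(P | m<c>) = (c)(Q | m<c>)\<close>
  implies \<open>P = Q\<close> because the left-hand side defines an absolute relation.
\<close>

section \<open>Renaming and closed terms\<close>

text \<open>Absolute equality mentions no labels, and its bisimulation clause lets a step be
  answered by standing still. A labelled transition can therefore be recovered only from the barbs
  of a context, and these must show whether the context has been used at all. Secondly, a label
  clause also demands equality just before the visible step, whereas a context only yields
  \<open>C P' =\<^sub>\<pi> C Q\<close>; so contexts must be cancelled before labels can be
  analysed. Thirdly, an extruded name ends up localized on both sides, and localization cannot be
  cancelled in general: \<open>loc m (send m c)\<close> equals \<open>Zero\<close>. An additional
  output of the localized name on a fresh channel repairs this, since the environment can then still
  obtain and use the name.\<close>

fun swap_nm :: "name \<Rightarrow> name \<Rightarrow> nm \<Rightarrow> nm" where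
  "swap_nm a b (Nm c) = Nm (transpose a b c)"
| "swap_nm a b (Vr x) = Vr x"
| "swap_nm a b (Bd k) = Bd k"

fun swap_label :: "name \<Rightarrow> name \<Rightarrow> label \<Rightarrow> label" where
  "swap_label a b (In c d) = In (transpose a b c) (transpose a b d)"
| "swap_label a b (Out c d) = Out (transpose a b c) (transpose a b d)"
| "swap_label a b (BOut c d) = BOut (transpose a b c) (transpose a b d)"

fun swap_action :: "name \<Rightarrow> name \<Rightarrow> action \<Rightarrow> action" where
  "swap_action a b (Lab l) = Lab (swap_label a b l)"
| "swap_action a b Tau = Tau"

text \<open>A transposition is a bijection on names, so transitions are invariant under it without
  any freshness condition; replacing one name by another could validate matches and falsify
  mismatches.\<close>

definition swap :: "name \<Rightarrow> name \<Rightarrow> pterm \<Rightarrow> pterm" where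
  "swap a b = map_trm (swap_nm a b)"

lemma swap_simps [simp]:
  "swap a b Zero = Zero"
  "swap a b (InSum n Bs) = InSum (swap_nm a b n) (map (swap a b) Bs)"
  "swap a b (OutSum n ms) = OutSum (swap_nm a b n) (map (\<lambda>(m, T). (swap_nm a b m, swap a b T)) ms)"
  "swap a b (Par S T) = Par (swap a b S) (swap a b T)"
  "swap a b (Res B) = Res (swap a b B)"
  "swap a b (Match p q T) = Match (swap_nm a b p) (swap_nm a b q) (swap a b T)"
  "swap a b (Mismatch p q T) = Mismatch (swap_nm a b p) (swap_nm a b q) (swap a b T)"
  "swap a b (RepIn n B) = RepIn (swap_nm a b n) (swap a b B)"
  "swap a b (RepOut n m T) = RepOut (swap_nm a b n) (swap_nm a b m) (swap a b T)"
  by (auto simp: swap_def map_prod_def)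

lemma swap_nm_involutive [simp]: "swap_nm a b (swap_nm a b n) = n"
  by (cases n) auto

lemma swap_involutive [simp]: "swap a b (swap a b T) = T"
  by (simp add: swap_def trm.map_comp comp_def trm.map_ident)

lemma swap_label_involutive [simp]: "swap_label a b (swap_label a b l) = l"
  by (cases l) auto

lemma swap_action_involutive [simp]: "swap_action a b (swap_action a b l) = l"
  by (cases l) auto

lemma swap_nm_eq_Nm [simp]: "swap_nm a b n = Nm c \<longleftrightarrow> n = Nm (transpose a b c)"
  by (cases n) (auto simp: transpose_def split: if_splits)

lemma Nm_eq_swap_nm [simp]: "Nm c = swap_nm a b n \<longleftrightarrow> n = Nm (transpose a b c)"
  by (metis swap_nm_eq_Nm)

lemma swap_nm_eq_Bd [simp]: "swap_nm a b n = Bd k \<longleftrightarrow> n = Bd k"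
  by (cases n) auto

lemma swap_commute: "swap a b = swap b a"
proof -
  have "swap_nm a b n = swap_nm b a n" for n
    by (cases n) (auto simp: transpose_commute)
  then have "swap_nm a b = swap_nm b a" by auto
  then show ?thesis by (simp add: swap_def)
qed

lemma swap_same [simp]: "swap a a T = T"
proof -
  have "swap_nm a a n = n" for n by (cases n) auto
  then have "swap_nm a a = id" by auto
  then show ?thesis by (simp add: swap_def trm.map_id)
qed

lemma nms_swap: "nms (swap a b T) = swap_nm a b ` nms T"
  by (simp add: swap_def trm.set_map)

lemma gn_swap: "gn (swap a b T) = transpose a b ` gn T"
proof (rule set_eqI)
  fix c
  have "c \<in> gn (swap a b T) \<longleftrightarrow> Nm (transpose a b c) \<in> nms T"
    unfolding gn_def nms_swap by (auto simp: image_iff)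
  then show "c \<in> gn (swap a b T) \<longleftrightarrow> c \<in> transpose a b ` gn T"
    by (auto simp: gn_def image_iff)
qed

lemma in_gn_swap [simp]: "c \<in> gn (swap a b T) \<longleftrightarrow> transpose a b c \<in> gn T"
  by (metis gn_swap image_eqI image_iff transpose_involutory)

lemma fv_swap [simp]: "fv (swap a b T) = fv T"
proof -
  have "Vr x = swap_nm a b n \<longleftrightarrow> n = Vr x" for n x by (cases n) auto
  then show ?thesis by (simp add: fv_def nms_swap image_iff)
qed

lemma gn_simps [simp]:
  "gn Zero = {}"
  "gn (InSum n Bs) = {a. n = Nm a} \<union> (\<Union>B\<in>set Bs. gn B)"
  "gn (OutSum n ms) = {a. n = Nm a} \<union> (\<Union>(m, T)\<in>set ms. {a. m = Nm a} \<union> gn T)"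
  "gn (Par S T) = gn S \<union> gn T"
  "gn (Res B) = gn B"
  "gn (Match p q T) = {a. p = Nm a} \<union> {a. q = Nm a} \<union> gn T"
  "gn (Mismatch p q T) = {a. p = Nm a} \<union> {a. q = Nm a} \<union> gn T"
  "gn (RepIn n B) = {a. n = Nm a} \<union> gn B"
  "gn (RepOut n m T) = {a. n = Nm a} \<union> {a. m = Nm a} \<union> gn T"
  by (force simp: gn_def)+

lemma fv_simps [simp]:
  "fv Zero = {}"
  "fv (InSum n Bs) = {a. n = Vr a} \<union> (\<Union>B\<in>set Bs. fv B)"
  "fv (OutSum n ms) = {a. n = Vr a} \<union> (\<Union>(m, T)\<in>set ms. {a. m = Vr a} \<union> fv T)"
  "fv (Par S T) = fv S \<union> fv T"
  "fv (Res B) = fv B"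
  "fv (Match p q T) = {a. p = Vr a} \<union> {a. q = Vr a} \<union> fv T"
  "fv (Mismatch p q T) = {a. p = Vr a} \<union> {a. q = Vr a} \<union> fv T"
  "fv (RepIn n B) = {a. n = Vr a} \<union> fv B"
  "fv (RepOut n m T) = {a. n = Vr a} \<union> {a. m = Vr a} \<union> fv T"
  by (force simp: fv_def)+

lemma finite_gn [simp]: "finite (gn T)"
proof -
  have "gn T = Nm -` nms T" by (auto simp: gn_def)
  then show ?thesis by (simp add: finite_vimageI inj_def)
qed

lemma finite_fv [simp]: "finite (fv T)"
proof -
  have "fv T = Vr -` nms T" by (auto simp: fv_def)
  then show ?thesis by (simp add: finite_vimageI inj_def)
qed

lemma infinite_names: "infinite (UNIV :: name set)"
proof -
  have "inj Name" by (auto simp: inj_def)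
  then show ?thesis using range_inj_infinite by (metis infinite_super subset_UNIV)
qed

lemma infinite_nvars: "infinite (UNIV :: nvar set)"
proof -
  have "inj NVar" by (auto simp: inj_def)
  then show ?thesis using range_inj_infinite by (metis infinite_super subset_UNIV)
qed

lemma fresh_name:
  assumes "\<And>c. c \<notin> F \<Longrightarrow> thesis" "finite (F :: name set)"
  shows thesis
  using assms infinite_names ex_new_if_finite by blast

lemma map_trm_map_at: "map_trm g (map_at f k T) = map_at (\<lambda>k n. g (f k n)) k T"
  by (induction f k T rule: map_at.induct) (auto simp: map_prod_def)

lemma map_at_map_at: "map_at f k (map_at g k T) = map_at (\<lambda>k n. f k (g k n)) k T"
  by (induction g k T rule: map_at.induct) auto

lemma map_at_cong_nms:
  assumes "\<And>j n. n \<in> nms T \<Longrightarrow> f j n = g j n"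
  shows "map_at f k T = map_at g k T"
proof -
  have "\<forall>j. \<forall>n\<in>nms T. f j n = g j n \<Longrightarrow> map_at f k T = map_at g k T"
    by (induction f k T rule: map_at.induct) (auto simp: ball_Un split: prod.splits)
  then show ?thesis using assms by blast
qed

lemma map_at_id [simp]: "map_at (\<lambda>k n. n) k T = T"
  by (induction "\<lambda>(k::nat) (n::nm). n" k T rule: map_at.induct) (auto intro!: map_idI)

lemma nms_map_at:
  assumes "n \<in> nms (map_at f k T)"
  shows "\<exists>j m. m \<in> nms T \<and> n = f j m"
proof -
  have "\<forall>j. \<forall>m\<in>nms T. f j m \<in> X \<Longrightarrow> \<forall>n\<in>nms (map_at f k T). n \<in> X" for X
    by (induction f k T rule: map_at.induct) (auto simp: ball_Un split: prod.splits)
  from this[of "{f j m |j m. m \<in> nms T}"] assms show ?thesis by blast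
qed

lemma swap_map_at:
  assumes "\<And>j n. swap_nm a b (f j n) = g j (swap_nm a b n)"
  shows "swap a b (map_at f k T) = map_at g k (swap a b T)"
  by (simp add: swap_def map_trm_map_at map_at_map_trm assms)

lemma swap_inst: "swap a b (inst B c) = inst (swap a b B) (transpose a b c)"
  unfolding inst_def by (rule swap_map_at) auto

lemma swap_abst: "swap a b (abst (Nm c) T) = abst (Nm (transpose a b c)) (swap a b T)"
  unfolding abst_def by (rule swap_map_at) (auto simp: transpose_def)

lemma swap_loc: "swap a b (loc c T) = loc (transpose a b c) (swap a b T)"
  by (simp add: loc_def swap_abst)

lemma swap_fresh: "a \<notin> gn T \<Longrightarrow> b \<notin> gn T \<Longrightarrow> swap a b T = T"
proof -
  assume *: "a \<notin> gn T" "b \<notin> gn T"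
  have "swap_nm a b n = n" if "n \<in> nms T" for n
    by (cases n) (use that * in \<open>auto simp: gn_def transpose_def\<close>)
  then have "map_trm (swap_nm a b) T = map_trm id T" by (intro trm.map_cong) auto
  then show ?thesis by (simp add: swap_def trm.map_id)
qed

section \<open>Well-scoped terms and the grammar\<close>

fun scoped :: "nat \<Rightarrow> nm \<Rightarrow> bool" where
  "scoped k (Bd i) \<longleftrightarrow> i < k"
| "scoped k (Nm a) \<longleftrightarrow> True"
| "scoped k (Vr x) \<longleftrightarrow> True"

text \<open>\<open>pi_term\<close> is generated through \<open>abst\<close> and \<open>loc\<close>,
  so inverting its rules involves a choice of bound names. \<open>wft k\<close> is the structural
  counterpart for terms with dangling indices below \<open>k\<close>; at \<open>k = 0\<close> it
  agrees with the grammar.\<close>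

fun wft :: "nat \<Rightarrow> pterm \<Rightarrow> bool" where
  "wft k Zero \<longleftrightarrow> True"
| "wft k (InSum n Bs) \<longleftrightarrow> scoped k n \<and> Bs \<noteq> [] \<and> (\<forall>B\<in>set Bs. wft (Suc k) B)"
| "wft k (OutSum n ms) \<longleftrightarrow> scoped k n \<and> ms \<noteq> [] \<and> (\<forall>(m, T)\<in>set ms. scoped k m \<and> wft k T)"
| "wft k (Par S T) \<longleftrightarrow> wft k S \<and> wft k T"
| "wft k (Res B) \<longleftrightarrow> wft (Suc k) B"
| "wft k (Match p q T) \<longleftrightarrow> scoped k p \<and> scoped k q \<and> wft k T"
| "wft k (Mismatch p q T) \<longleftrightarrow> scoped k p \<and> scoped k q \<and> wft k T"
| "wft k (RepIn n B) \<longleftrightarrow> scoped k n \<and> wft (Suc k) B"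
| "wft k (RepOut n m T) \<longleftrightarrow> scoped k n \<and> scoped k m \<and> wft k T"

lemma map_at_cong_wft:
  assumes "wft k T" "\<And>j n. scoped j n \<Longrightarrow> f j n = g j n"
  shows "map_at f k T = map_at g k T"
proof -
  have "wft k T \<Longrightarrow> \<forall>j n. scoped j n \<longrightarrow> f j n = g j n \<Longrightarrow> map_at f k T = map_at g k T"
    by (induction f k T rule: map_at.induct) (auto split: prod.splits)
  then show ?thesis using assms by blast
qed

text \<open>The scope before, the scope after and the counter passed to \<open>f\<close> all grow by
  one under a binder, so the hypothesis is stated for a common offset \<open>j\<close>.\<close>

lemma wft_map_at:
  "wft i T \<Longrightarrow> (\<And>j n. scoped (i + j) n \<Longrightarrow> scoped (i' + j) (f (k + j) n)) \<Longrightarrow> wft i' (map_at f k T)"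
proof (induction f k T arbitrary: i i' rule: map_at.induct)
  case (2 f k n Bs)
  have "wft (Suc i') (map_at f (Suc k) B)" if "B \<in> set Bs" for B
  proof (rule "2.IH"[OF that, of "Suc i"])
    show "wft (Suc i) B" using 2(2) that by auto
    show "scoped (Suc i' + j) (f (Suc k + j) n)" if "scoped (Suc i + j) n" for j n
      using 2(3)[of "Suc j" n] that by simp
  qed
  then show ?case using 2(2) 2(3)[of 0] by auto
next
  case (3 f k n ms)
  have "wft i' (map_at f k T)" if "(m, T) \<in> set ms" for m T
    by (rule "3.IH"[OF that refl, of i]) (use 3(2,3) that in auto)
  then show ?case using 3(2) 3(3)[of 0] by fastforce
next
  case (5 f k B)
  show ?case
    using 5(2) 5(3)[of "Suc _"] by (auto intro!: "5.IH"[of "Suc i"])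
next
  case (8 f k n B)
  show ?case
    using 8(2) 8(3)[of "Suc _"] 8(3)[of 0] by (auto intro!: "8.IH"[of "Suc i"])
next
  case (4 f k S T)
  show ?case using 4(3) "4.IH"(1)[of i i'] "4.IH"(2)[of i i'] 4(4) by simp
next
  case (6 f k p q T)
  show ?case using 6(2) 6(3)[of 0] "6.IH"[of i i'] 6(3) by simp
next
  case (7 f k p q T)
  show ?case using 7(2) 7(3)[of 0] "7.IH"[of i i'] 7(3) by simp
next
  case (9 f k n m T)
  show ?case using 9(2) 9(3)[of 0] "9.IH"[of i i'] 9(3) by simp
qed simp

lemma wft_inst: "wft 1 B \<Longrightarrow> wft 0 (inst B c)"
proof -
  assume "wft 1 B"
  moreover have "scoped j (if n = Bd j then Nm c else n)" if "scoped (Suc j) n" for j n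
    using that by (cases n) auto
  ultimately show ?thesis unfolding inst_def by (intro wft_map_at[of 1]) auto
qed

lemma wft_abst: "wft 0 T \<Longrightarrow> wft 1 (abst n T)"
proof -
  assume "wft 0 T"
  moreover have "scoped (Suc j) m" if "scoped j m" for j m
    using that by (cases m) auto
  ultimately show ?thesis unfolding abst_def by (intro wft_map_at[of 0]) auto
qed

lemma wft_swap [simp]: "wft k (swap a b T) = wft k T"
proof -
  have "wft k (swap a b T)" if "wft k T" for T
  proof -
    have "swap a b T = map_at (\<lambda>k. swap_nm a b) k T"
      unfolding swap_def using map_trm_map_at[of "swap_nm a b" "\<lambda>k n. n" k T] by simp
    moreover have "scoped k (swap_nm a b n)" if "scoped k n" for k n using that by (cases n) auto
    ultimately show ?thesis by (simp add: wft_map_at[OF that])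
  qed
  from this[of T] this[of "swap a b T"] show ?thesis by auto
qed

lemma wft_loc: "wft 0 T \<Longrightarrow> wft 0 (loc c T)"
  using wft_abst by (simp add: loc_def)

lemma inst_abst: "wft 0 T \<Longrightarrow> inst (abst (Nm c) T) c = T"
proof -
  assume "wft 0 T"
  then have "inst (abst (Nm c) T) c = map_at (\<lambda>k n. n) 0 T"
    unfolding inst_def abst_def map_at_map_at by (rule map_at_cong_wft) auto
  then show ?thesis by simp
qed

lemma abst_inst: "c \<notin> gn B \<Longrightarrow> abst (Nm c) (inst B c) = B"
proof -
  assume "c \<notin> gn B"
  then have "abst (Nm c) (inst B c) = map_at (\<lambda>k n. n) 0 B"
    unfolding inst_def abst_def map_at_map_at by (intro map_at_cong_nms) (auto simp: gn_def)
  then show ?thesis by simp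
qed

lemma loc_inst: "c \<notin> gn B \<Longrightarrow> loc c (inst B c) = Res B"
  by (simp add: loc_def abst_inst)

lemma inst_Par [simp]: "inst (Par S T) c = Par (inst S c) (inst T c)"
  by (simp add: inst_def)

lemma nms_map_atI: "n \<in> nms T \<Longrightarrow> (\<And>j. f j n = n) \<Longrightarrow> n \<in> nms (map_at f k T)"
  by (induction f k T rule: map_at.induct) fastforce+

lemma gn_abst [simp]: "gn (abst (Nm c) T) = gn T - {c}"
  unfolding gn_def abst_def
  by (auto dest!: nms_map_at intro: nms_map_atI split: if_splits)

lemma gn_loc [simp]: "gn (loc c T) = gn T - {c}"
  by (simp add: loc_def)

lemma gn_inst_subset: "gn (inst B c) \<subseteq> insert c (gn B)"
  unfolding gn_def inst_def by (auto dest!: nms_map_at split: if_splits)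

lemma gn_inst_superset: "gn B \<subseteq> gn (inst B c)"
  unfolding gn_def inst_def by (auto intro: nms_map_atI)

lemma fv_inst [simp]: "fv (inst B c) = fv B"
  unfolding fv_def inst_def
  by (auto dest!: nms_map_at intro: nms_map_atI split: if_splits)

lemma fv_abst_Nm [simp]: "fv (abst (Nm c) T) = fv T"
  unfolding fv_def abst_def
  by (auto dest!: nms_map_at intro: nms_map_atI split: if_splits)

lemma fv_loc [simp]: "fv (loc c T) = fv T"
  by (simp add: loc_def)

text \<open>Alpha-conversion: the left-hand side is the image of \<open>loc c T\<close> under the
  transposition, which moves no global name of \<open>loc c T\<close>. The case
  \<open>c' = c\<close> is included.\<close>

lemma loc_swap:
  assumes "c' \<notin> gn T - {c}"
  shows "loc c' (swap c c' T) = loc c T"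
proof -
  have "swap c c' (loc c T) = loc c T"
    using assms by (intro swap_fresh) auto
  then show ?thesis by (simp add: swap_loc)
qed

lemma is_nm_scoped: "is_nm n \<longleftrightarrow> scoped 0 n"
  by (cases n) (auto simp: is_nm_def)

lemma pi_term_wft: "pi_term T \<Longrightarrow> wft 0 T"
  by (induction T rule: pi_term.induct)
     (auto simp: is_nm_scoped wft_abst[simplified] wft_loc split: prod.splits)

lemma size_map_at: "size (map_at f k T) = size T"
  by (induction f k T rule: map_at.induct)
     (auto simp: size_list_conv_sum_list comp_def case_prod_beta intro!: arg_cong[where f = sum_list] map_cong)

text \<open>The opened body is not a subterm, so the converse of \<open>pi_term_wft\<close> recurses
  on the size; hence the size is recorded here.\<close>

lemma exists_abst_Vr:
  assumes "wft 1 B" "x \<notin> fv B"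
  obtains T where "wft 0 T" "abst (Vr x) T = B" "size T = size B"
proof
  define T where "T = map_at (\<lambda>k n. if n = Bd k then Vr x else n) 0 B"
  have "scoped j (if n = Bd j then Vr x else n)" if "scoped (Suc j) n" for j n
    using that by (cases n) auto
  then show "wft 0 T" unfolding T_def using assms(1) by (intro wft_map_at[of 1]) auto
  have "abst (Vr x) T = map_at (\<lambda>k n. n) 0 B"
    unfolding T_def abst_def map_at_map_at using assms(2) by (intro map_at_cong_nms) (auto simp: fv_def)
  then show "abst (Vr x) T = B" by simp
  show "size T = size B"
    by (simp add: T_def size_map_at)
qed

lemma wft_pi_term: "wft 0 T \<Longrightarrow> pi_term T"
proof (induction T rule: measure_induct_rule[of size])
  case (less T)
  have body: "\<exists>T'. pi_term T' \<and> abst (Vr x) T' = B"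
    if "wft 1 B" "x \<notin> fv B" "size B < size T" for x B
    using exists_abst_Vr[OF that(1,2)] less.IH that(3) by metis
  show ?case
  proof (cases T)
    case Zero
    then show ?thesis by (simp add: pi_term.intros)
  next
    case (InSum n Bs)
    \<comment> \<open>One variable must serve all summands, since the grammar rule for input sums
      binds the same \<open>x\<close> in each of them.\<close>
    obtain x where x: "x \<notin> (\<Union>B\<in>set Bs. fv B)"
      using infinite_nvars ex_new_if_finite[of "\<Union>B\<in>set Bs. fv B"] by auto
    have "\<exists>T'. pi_term T' \<and> abst (Vr x) T' = B" if "B \<in> set Bs" for B
    proof (rule body)
      show "wft 1 B" "x \<notin> fv B" using less.prems InSum x that by auto
      show "size B < size T" using InSum size_list_estimation'[OF that, of "size B" size] by simp
    qed
    then obtain g where g: "\<And>B. B \<in> set Bs \<Longrightarrow> pi_term (g B) \<and> abst (Vr x) (g B) = B" by metis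
    then have "map (abst (Vr x)) (map g Bs) = Bs" by (simp add: map_idI)
    moreover have "pi_term (InSum n (map (abst (Vr x)) (map g Bs)))"
      using less.prems InSum g by (intro pi_term.intros) (auto simp: is_nm_scoped)
    ultimately show ?thesis using InSum by simp
  next
    case (OutSum n ms)
    have "is_nm (fst p) \<and> pi_term (snd p)" if "p \<in> set ms" for p
    proof
      show "is_nm (fst p)" using less.prems OutSum that by (auto simp: is_nm_scoped)
      obtain m U where p: "p = (m, U)" by (cases p)
      have "size_prod (\<lambda>_. 0) size p \<le> size_list (size_prod (\<lambda>_. 0) size) ms"
        using size_list_estimation'[OF that order_refl, of "size_prod (\<lambda>_. 0) size"] .
      then have "size U < size T" using OutSum p by simp
      then show "pi_term (snd p)" using less OutSum that p by auto
    qed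
    then show ?thesis
      using less.prems OutSum by (auto intro!: pi_term.intros simp: is_nm_scoped)
  next
    case (Res B)
    obtain c where "c \<notin> gn B" by (erule fresh_name) simp
    moreover have "size (inst B c) < size T" using Res by (simp add: inst_def size_map_at)
    then have "pi_term (inst B c)" using less Res by (intro less.IH) (auto intro: wft_inst)
    ultimately show ?thesis using Res pi_term.intros(5) loc_inst by metis
  next
    case (RepIn n B)
    obtain x where x: "x \<notin> fv B"
      using infinite_nvars ex_new_if_finite[of "fv B"] by auto
    then have "\<exists>T'. pi_term T' \<and> abst (Vr x) T' = B"
      using less.prems RepIn by (intro body) auto
    then show ?thesis using less.prems RepIn pi_term.intros(8) by (auto simp: is_nm_scoped)
  qed (use less in \<open>auto intro!: pi_term.intros simp: is_nm_scoped\<close>)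
qed

lemma pi_process_iff: "pi_process P \<longleftrightarrow> wft 0 P \<and> fv P = {}"
  using pi_term_wft wft_pi_term by (auto simp: pi_process_def)

lemma pi_process_simps [simp]:
  "pi_process Zero"
  "pi_process (Par P Q) \<longleftrightarrow> pi_process P \<and> pi_process Q"
  "pi_process (swap a b P) \<longleftrightarrow> pi_process P"
  by (auto simp: pi_process_iff)

lemma pi_process_loc: "pi_process P \<Longrightarrow> pi_process (loc c P)"
  by (simp add: pi_process_iff wft_loc)

section \<open>Transitions\<close>

lemma names_swap: "names (swap_action a b l) = transpose a b ` names l"
proof (cases l)
  case (Lab x) then show ?thesis by (cases x) auto
qed simp

lemma bn_swap: "bn (swap_action a b l) = transpose a b ` bn l"
proof (cases l)
  case (Lab x) then show ?thesis by (cases x) auto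
qed simp

lemma bn_names: "bn l \<subseteq> names l"
proof (cases l)
  case (Lab x) then show ?thesis by (cases x) auto
qed simp

lemma finite_names_label [simp]: "finite (names_label l)"
  by (cases l) auto

lemma finite_names_action [simp]: "finite (names l)"
  by (cases l) auto

lemma swap_action_fresh: "a \<notin> names l \<Longrightarrow> b \<notin> names l \<Longrightarrow> swap_action a b l = l"
proof (cases l)
  case (Lab x) then show "a \<notin> names l \<Longrightarrow> b \<notin> names l \<Longrightarrow> swap_action a b l = l"
    by (cases x) (auto simp: transpose_def)
qed simp

lemma transpose_cancel [simp]: "transpose a b c = transpose a b d \<longleftrightarrow> c = d"
  by (metis transpose_involutory)

lemma transpose_image_disjoint: "transpose a b ` A \<inter> transpose a b ` B = {} \<longleftrightarrow> A \<inter> B = {}"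
  by auto

lemma step_swap: "P \<midarrow>l\<rightarrow> Q \<Longrightarrow> swap a b P \<midarrow>swap_action a b l\<rightarrow> swap a b Q"
proof (induction rule: step.induct)
  case (inp B Bs d c)
  then show ?case by (auto simp: swap_inst intro!: step.inp)
next
  case (out c T ms d)
  then show ?case by (auto intro!: step.out bexI[of _ "(Nm c, T)"] simp: image_iff)
next
  case (par_r T l T' S)
  then show ?case by (simp add: bn_swap gn_swap transpose_image_disjoint step.par_r)
next
  case (par_l T l T' S)
  then show ?case by (simp add: bn_swap gn_swap transpose_image_disjoint step.par_l)
next
  case (com_r S d e S' T T')
  then show ?case by (auto intro: step.com_r)
next
  case (com_l S d e S' T T')
  then show ?case by (auto intro: step.com_l)
next
  case (close_r S d c S' T T')
  then show ?case by (auto simp: swap_loc intro!: step.close_r)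
next
  case (close_l S d c S' T T')
  then show ?case by (auto simp: swap_loc intro!: step.close_l)
next
  case (extrude B c d T')
  then show ?case by (auto simp: swap_inst intro!: step.extrude)
next
  case (res B c l T')
  then show ?case by (auto simp: swap_inst swap_loc names_swap intro!: step.res)
next
  case (match T l T' d)
  then show ?case by (auto simp: bn_swap image_iff intro!: step.match)
next
  case (mismatch T l T' d e)
  then show ?case by (auto simp: bn_swap image_iff intro!: step.mismatch)
next
  case (rep_out d e T)
  show ?case using step.rep_out by simp
next
  case (rep_in d B e)
  show ?case using step.rep_in by (simp add: swap_inst)
qed

section \<open>Subjects, objects and global names of transitions\<close>

fun subj :: "label \<Rightarrow> name" where
  "subj (In a b) = a"
| "subj (Out a b) = a"
| "subj (BOut a b) = a"

lemma subj_names: "subj l \<in> names_label l"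
  by (cases l) auto

lemma step_subj: "P \<midarrow>Lab l\<rightarrow> P' \<Longrightarrow> subj l \<in> gn P"
proof (induction P "Lab l" P' arbitrary: l rule: step.induct)
  case (extrude B c d T')
  then show ?case using gn_inst_subset[of B c] by auto
next
  case (res B c T' l)
  then show ?case using gn_inst_subset[of B c] subj_names[of l] by fastforce
qed auto

lemma step_Out_gn: "P \<midarrow>Lab (Out a b)\<rightarrow> P' \<Longrightarrow> b \<in> gn P"
proof (induction P "Lab (Out a b)" P' rule: step.induct)
  case (out T ms)
  then show ?case by force
next
  case (res B c T')
  then show ?case using gn_inst_subset[of B c] by fastforce
qed auto

lemma step_gn: "P \<midarrow>l\<rightarrow> P' \<Longrightarrow> gn P' \<subseteq> gn P \<union> names l"
proof (induction rule: step.induct)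
  case (inp B Bs d c)
  then show ?case using gn_inst_subset[of B c] by auto
next
  case (com_r S a b S' T T')
  then show ?case using step_subj[OF com_r(1)] step_Out_gn[OF com_r(2)] by auto
next
  case (com_l S a b S' T T')
  then show ?case using step_subj[OF com_l(1)] step_Out_gn[OF com_l(2)] by auto
next
  case (close_r S a c S' T T')
  then show ?case using step_subj[OF close_r(1)] by auto
next
  case (close_l S a c S' T T')
  then show ?case using step_subj[OF close_l(1)] by auto
next
  case (res B c l T')
  then show ?case using gn_inst_subset[of B c] by auto
next
  case (rep_in d B e)
  then show ?case using gn_inst_subset[of B e] by auto
next
  case (extrude B c d T')
  then show ?case using gn_inst_subset[of B c] by auto
qed auto

text \<open>Rule \<open>extrude\<close> announces a fresh name, and every rule that lets a bound
  output pass checks the name against the global names it adds.\<close>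

lemma step_BOut_gn: "P \<midarrow>Lab (BOut a c)\<rightarrow> P' \<Longrightarrow> c \<notin> gn P"
proof (induction P "Lab (BOut a c)" P' rule: step.induct)
  case (res B d T')
  then show ?case using gn_inst_superset[of B d] by auto
qed auto

lemma step_BOut_neq: "P \<midarrow>Lab (BOut a c)\<rightarrow> P' \<Longrightarrow> a \<noteq> c"
  using step_subj[of P "BOut a c" P'] step_BOut_gn[of P a c P'] by auto

lemma step_wft: "P \<midarrow>l\<rightarrow> P' \<Longrightarrow> wft 0 P \<Longrightarrow> wft 0 P'"
  by (induction rule: step.induct) (auto intro: wft_loc wft_inst[simplified])

lemma step_fv: "P \<midarrow>l\<rightarrow> P' \<Longrightarrow> fv P' \<subseteq> fv P"
  by (induction rule: step.induct) fastforce+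

lemma step_pi_process: "P \<midarrow>l\<rightarrow> P' \<Longrightarrow> pi_process P \<Longrightarrow> pi_process P'"
  using step_wft step_fv by (fastforce simp: pi_process_iff)

lemma step_Zero [simp]: "\<not> Zero \<midarrow>l\<rightarrow> X"
  by (auto elim: step.cases)

lemma step_InSum [simp]:
  "InSum n Bs \<midarrow>l\<rightarrow> X \<longleftrightarrow> (\<exists>a B c. n = Nm a \<and> B \<in> set Bs \<and> l = Lab (In a c) \<and> X = inst B c)"
  by (rule iffI, erule step.cases) (auto intro: step.inp)

lemma step_OutSum [simp]:
  "OutSum n ms \<midarrow>l\<rightarrow> X \<longleftrightarrow> (\<exists>a c. n = Nm a \<and> (Nm c, X) \<in> set ms \<and> l = Lab (Out a c))"
  by (rule iffI, erule step.cases) (auto intro: step.out)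

lemma step_Match:
  "Match p q T \<midarrow>l\<rightarrow> X \<longleftrightarrow> (\<exists>a. p = Nm a \<and> q = Nm a \<and> a \<notin> bn l \<and> T \<midarrow>l\<rightarrow> X)"
  by (rule iffI, erule step.cases) (auto intro: step.match)

lemma step_Mismatch:
  "Mismatch p q T \<midarrow>l\<rightarrow> X \<longleftrightarrow>
   (\<exists>a b. p = Nm a \<and> q = Nm b \<and> a \<noteq> b \<and> a \<notin> bn l \<and> b \<notin> bn l \<and> T \<midarrow>l\<rightarrow> X)"
  by (rule iffI, erule step.cases) (auto intro: step.mismatch)

lemma step_Par_labE:
  assumes "Par S T \<midarrow>Lab l\<rightarrow> X"
  obtains (left) S' where "S \<midarrow>Lab l\<rightarrow> S'" "X = Par S' T" "bn_label l \<inter> gn T = {}"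
  | (right) T' where "T \<midarrow>Lab l\<rightarrow> T'" "X = Par S T'" "bn_label l \<inter> gn S = {}"
  using assms by (auto elim: step.cases)

text \<open>Both transitions are transposed by \<open>c'\<close> and \<open>c\<close>. Their sources
  do not change, since neither name is global in them, and the localized results are
  alpha-variants.\<close>

lemma close_rename:
  assumes "S \<midarrow>Lab (In a c')\<rightarrow> S'" "T \<midarrow>Lab (BOut a c')\<rightarrow> T'" "c' \<notin> gn S" "c \<notin> gn S" "c \<notin> gn T"
  shows "S \<midarrow>Lab (In a c)\<rightarrow> swap c' c S'" "T \<midarrow>Lab (BOut a c)\<rightarrow> swap c' c T'"
    "loc c' (Par S' T') = loc c (Par (swap c' c S') (swap c' c T'))"
    "loc c' (Par T' S') = loc c (Par (swap c' c T') (swap c' c S'))"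
proof -
  have a: "a \<in> gn S" using step_subj[OF assms(1)] by simp
  then have na: "a \<noteq> c" "a \<noteq> c'" using assms by auto
  have "c' \<notin> gn T" using assms(2) by (rule step_BOut_gn)
  then show "S \<midarrow>Lab (In a c)\<rightarrow> swap c' c S'" "T \<midarrow>Lab (BOut a c)\<rightarrow> swap c' c T'"
    using step_swap[OF assms(1), of c' c] step_swap[OF assms(2), of c' c] na assms(3-)
    by (simp_all add: swap_fresh)
  have "c \<notin> gn S' - {c'}" "c \<notin> gn T' - {c'}"
    using step_gn[OF assms(1)] step_gn[OF assms(2)] na assms(4,5) by auto
  then show "loc c' (Par S' T') = loc c (Par (swap c' c S') (swap c' c T'))"
    "loc c' (Par T' S') = loc c (Par (swap c' c T') (swap c' c S'))"
    using loc_swap[of c "Par S' T'" c'] loc_swap[of c "Par T' S'" c'] by auto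
qed

text \<open>The name that is localized by a \<open>close\<close> step can be chosen in advance.\<close>

lemma step_Par_tauE:
  assumes "Par S T \<midarrow>Tau\<rightarrow> X" "c \<notin> gn S" "c \<notin> gn T"
  obtains (left) S' where "S \<midarrow>Tau\<rightarrow> S'" "X = Par S' T"
  | (right) T' where "T \<midarrow>Tau\<rightarrow> T'" "X = Par S T'"
  | (in_out) a b S' T' where "S \<midarrow>Lab (In a b)\<rightarrow> S'" "T \<midarrow>Lab (Out a b)\<rightarrow> T'" "X = Par S' T'"
  | (out_in) a b S' T' where "S \<midarrow>Lab (Out a b)\<rightarrow> S'" "T \<midarrow>Lab (In a b)\<rightarrow> T'" "X = Par S' T'"
  | (in_bout) a S' T' where "S \<midarrow>Lab (In a c)\<rightarrow> S'" "T \<midarrow>Lab (BOut a c)\<rightarrow> T'" "X = loc c (Par S' T')"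
  | (bout_in) a S' T' where "S \<midarrow>Lab (BOut a c)\<rightarrow> S'" "T \<midarrow>Lab (In a c)\<rightarrow> T'" "X = loc c (Par S' T')"
  using assms(1)
proof cases
  case (close_r a c' S' T')
  then show ?thesis using close_rename[OF close_r(2-4) assms(2,3)] in_bout by metis
next
  case (close_l a c' S' T')
  then show ?thesis using close_rename[OF close_l(2-4) assms(3,2)] bout_in by metis
qed (use left right in_out out_in in auto)

text \<open>The cases of \<open>step_Par_tauE\<close> in which both components move, taken together\<close>

inductive sync :: "name \<Rightarrow> label \<Rightarrow> label \<Rightarrow> (pterm \<Rightarrow> pterm) \<Rightarrow> bool" for c where
  com_r: "sync c (In a b) (Out a b) (\<lambda>T. T)"
| com_l: "sync c (Out a b) (In a b) (\<lambda>T. T)"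
| close_r: "sync c (In a c) (BOut a c) (loc c)"
| close_l: "sync c (BOut a c) (In a c) (loc c)"

lemma sync_sym: "sync c l l' f \<Longrightarrow> sync c l' l f"
  by (auto elim: sync.cases intro: sync.intros)

lemma sync_names: "sync c l l' f \<Longrightarrow> names_label l' = names_label l"
  by (auto elim: sync.cases)

lemma sync_bn: "sync c l l' f \<Longrightarrow> bn_label l \<subseteq> {c} \<and> bn_label l' \<subseteq> {c}"
  by (auto elim: sync.cases)

lemma sync_context: "sync c l l' f \<Longrightarrow> f = (\<lambda>T. T) \<or> f = loc c"
  by (auto elim: sync.cases)

lemma step_Par_sync:
  "sync c l l' f \<Longrightarrow> S \<midarrow>Lab l\<rightarrow> S' \<Longrightarrow> T \<midarrow>Lab l'\<rightarrow> T' \<Longrightarrow> c \<notin> gn S \<Longrightarrow> c \<notin> gn T \<Longrightarrow>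
   Par S T \<midarrow>Tau\<rightarrow> f (Par S' T')"
  by (erule sync.cases) (auto intro: step.com_r step.com_l step.close_r step.close_l)

lemma step_Par_tau_syncE:
  assumes "Par S T \<midarrow>Tau\<rightarrow> X" "c \<notin> gn S" "c \<notin> gn T"
  obtains (left) S' where "S \<midarrow>Tau\<rightarrow> S'" "X = Par S' T"
  | (right) T' where "T \<midarrow>Tau\<rightarrow> T'" "X = Par S T'"
  | (sync) l l' f S' T' where "sync c l l' f" "S \<midarrow>Lab l\<rightarrow> S'" "T \<midarrow>Lab l'\<rightarrow> T'" "X = f (Par S' T')"
  using assms by (cases rule: step_Par_tauE) (blast intro: sync.intros)+

lemma inst_abst_rename:
  assumes "wft 0 T" "c' \<notin> gn T - {c}"
  shows "inst (abst (Nm c) T) c' = swap c c' T"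
proof -
  have "swap c c' (abst (Nm c) T) = abst (Nm c) T" using assms by (intro swap_fresh) auto
  then show ?thesis using swap_inst[of c c' "abst (Nm c) T" c] inst_abst[OF assms(1)] by simp
qed

lemma loc_step_res: "wft 0 T \<Longrightarrow> T \<midarrow>l\<rightarrow> T' \<Longrightarrow> c \<notin> names l \<Longrightarrow> loc c T \<midarrow>l\<rightarrow> loc c T'"
  unfolding loc_def[of c T] by (rule step.res) (auto simp: inst_abst)

lemma loc_step_extrude:
  "wft 0 T \<Longrightarrow> T \<midarrow>Lab (Out a c)\<rightarrow> T' \<Longrightarrow> a \<noteq> c \<Longrightarrow> loc c T \<midarrow>Lab (BOut a c)\<rightarrow> T'"
  unfolding loc_def[of c T] by (rule step.extrude) (auto simp: inst_abst)

lemma loc_step_extrude_rename: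
  assumes "wft 0 T" "swap c c' T \<midarrow>Lab (Out a c')\<rightarrow> T'" "c' \<notin> gn T - {c}" "a \<noteq> c'"
  shows "loc c T \<midarrow>Lab (BOut a c')\<rightarrow> T'"
  using loc_step_extrude[of "swap c c' T" a c' T'] assms loc_swap[OF assms(3)] by simp

text \<open>The rules open the body with a name of their own choice. In the first case it can be
  transposed back to \<open>c\<close>, because \<open>c\<close> does not occur in the action. In the
  second case the label dictates the name \<open>c'\<close> under which the localized name leaves
  its scope.\<close>

lemma loc_stepE:
  assumes "loc c T \<midarrow>l\<rightarrow> X" "wft 0 T" "c \<notin> names l"
  obtains (res) T' where "T \<midarrow>l\<rightarrow> T'" "X = loc c T'"
  | (extrude) a c' where "l = Lab (BOut a c')" "c' \<notin> gn T" "c' \<noteq> c" "a \<noteq> c" "a \<noteq> c'"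
      "swap c c' T \<midarrow>Lab (Out a c')\<rightarrow> X"
  using assms(1) unfolding loc_def
proof cases
  case (extrude c' a)
  then show ?thesis
    using that(2)[of a c'] assms(2,3) inst_abst_rename[of T c' c] by auto
next
  case (res c' T')
  have eq: "inst (abst (Nm c) T) c' = swap c c' T"
    using assms(2) res by (intro inst_abst_rename) auto
  have "T \<midarrow>l\<rightarrow> swap c c' T'"
    using step_swap[OF res(2)[unfolded eq], of c c'] swap_action_fresh[of c l c'] assms(3) res(4) by simp
  moreover have "c \<notin> gn T' - {c'}"
    using step_gn[OF res(2)[unfolded eq]] assms(3) res(3) by (cases "c = c'") auto
  then have "X = loc c (swap c c' T')"
    using loc_swap[of c T' c'] res(1) by (simp add: swap_commute)
  ultimately show ?thesis by (rule that(1))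
qed

text \<open>Complements \<open>loc_stepE\<close> for a bound output that announces \<open>c\<close>
  itself: either this is the localized name, or the localized name is renamed to \<open>c'\<close>
  and the body announces a different name of its own as \<open>c\<close>.\<close>

lemma loc_BOutE:
  assumes "loc c T \<midarrow>Lab (BOut a c)\<rightarrow> X" "wft 0 T"
  obtains (extrude) "T \<midarrow>Lab (Out a c)\<rightarrow> X"
  | (res) c' T' where "c' \<notin> gn T" "c' \<noteq> a" "c' \<noteq> c" "a \<noteq> c" "swap c c' T \<midarrow>Lab (BOut a c)\<rightarrow> T'"
  using assms(1) unfolding loc_def
proof cases
  case extrude
  then show ?thesis using that(1) inst_abst[OF assms(2)] by simp
next
  case (res c' T')
  have "a \<noteq> c" using assms(1) by (rule step_BOut_neq)
  then show ?thesis
    using that(2)[of c' T'] res assms(2) inst_abst_rename[of T c' c] by auto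
qed

text \<open>Input is early, so the object is arbitrary. Only \<open>res\<close> restricts it: if the
  new object is the name that opened the body, the body is reopened with another one.\<close>

lemma step_input_any: "P \<midarrow>Lab (In a b)\<rightarrow> P' \<Longrightarrow> \<exists>P''. P \<midarrow>Lab (In a b')\<rightarrow> P''"
proof (induction P "Lab (In a b)" P' arbitrary: b' rule: step.induct)
  case (res B c T')
  show ?case
  proof (cases "b' = c")
    case False
    then show ?thesis using res step.res[of B c "Lab (In a b')"] by fastforce
  next
    case True
    obtain c' where c': "c' \<notin> insert a (insert c (gn B))" by (erule fresh_name) simp
    obtain T2 where "inst B c \<midarrow>Lab (In a c')\<rightarrow> T2" using res by blast
    moreover have "transpose c c' a = a" using c' res by (auto simp: transpose_def)
    ultimately have "inst B c' \<midarrow>Lab (In a c)\<rightarrow> swap c c' T2"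
      using step_swap[of "inst B c" "Lab (In a c')" T2 c c'] c' res by (simp add: swap_inst swap_fresh)
    then show ?thesis using step.res[of B c' "Lab (In a c)"] c' True by fastforce
  qed
qed (fastforce intro: step.intros)+

section \<open>Weak transitions\<close>

lemma tau_pi_process: "tau P Q \<Longrightarrow> pi_process P \<Longrightarrow> pi_process Q"
  by (auto simp: tau_def intro: step_pi_process)

lemma taus_pi_process: "taus P Q \<Longrightarrow> pi_process P \<Longrightarrow> pi_process Q"
  by (induction rule: rtranclp_induct) (auto intro: tau_pi_process)

lemma tau_gn: "tau P Q \<Longrightarrow> gn Q \<subseteq> gn P"
  using step_gn[of P Tau Q] by (auto simp: tau_def)

lemma taus_gn: "taus P Q \<Longrightarrow> gn Q \<subseteq> gn P"
  by (induction rule: rtranclp_induct) (use tau_gn in blast)+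

lemma tau_swap: "tau P Q \<Longrightarrow> tau (swap a b P) (swap a b Q)"
  using step_swap[of P Tau Q] by (simp add: tau_def)

lemma taus_swap: "taus P Q \<Longrightarrow> taus (swap a b P) (swap a b Q)"
  by (induction rule: rtranclp_induct) (auto intro: tau_swap rtranclp.rtrancl_into_rtrancl)

lemma tau_weak_eq: "tau_weak P Q \<longleftrightarrow> (\<exists>P1. tau P P1 \<and> taus P1 Q)"
proof
  assume "tau_weak P Q"
  then have "tau\<^sup>+\<^sup>+ P Q"
    by (auto simp: tau_weak_def intro: rtranclp_into_tranclp2 rtranclp_tranclp_tranclp tranclp_rtranclp_tranclp)
  then show "\<exists>P1. tau P P1 \<and> taus P1 Q" by (meson tranclpD)
qed (auto simp: tau_weak_def)

lemma tau_weak_trans1: "taus P Q \<Longrightarrow> tau_weak Q R \<Longrightarrow> tau_weak P R"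
  unfolding tau_weak_def relcompp_apply by (meson rtranclp_trans)

lemma tau_weak_trans2: "tau_weak P Q \<Longrightarrow> taus Q R \<Longrightarrow> tau_weak P R"
  unfolding tau_weak_def relcompp_apply by (meson rtranclp_trans)

lemma tau_weakI: "taus P Q \<Longrightarrow> tau Q R \<Longrightarrow> tau_weak P R"
  by (auto simp: tau_weak_def)

lemma tau_weak_taus: "tau_weak P Q \<Longrightarrow> taus P Q"
  by (auto simp: tau_weak_eq)

lemma taus_cases: "taus P Q \<Longrightarrow> P = Q \<or> tau_weak P Q"
  by (metis converse_rtranclpE tau_weak_eq)

lemma tau_weak_swap: "tau_weak P Q \<Longrightarrow> tau_weak (swap a b P) (swap a b Q)"
  using tau_swap taus_swap by (fastforce simp: tau_weak_eq)

lemma tau_Par1: "tau P P' \<Longrightarrow> tau (Par P Q) (Par P' Q)"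
  and tau_Par2: "tau P P' \<Longrightarrow> tau (Par Q P) (Par Q P')"
  by (auto simp: tau_def intro: step.intros)

lemma taus_Par1: "taus P P' \<Longrightarrow> taus (Par P Q) (Par P' Q)"
  by (induction rule: rtranclp_induct) (auto intro: tau_Par1 rtranclp.rtrancl_into_rtrancl)

lemma taus_Par2: "taus P P' \<Longrightarrow> taus (Par Q P) (Par Q P')"
  by (induction rule: rtranclp_induct) (auto intro: tau_Par2 rtranclp.rtrancl_into_rtrancl)

lemma taus_Par: "taus P P' \<Longrightarrow> taus Q Q' \<Longrightarrow> taus (Par P Q) (Par P' Q')"
  using taus_Par1 taus_Par2 by (metis rtranclp_trans)

lemma tau_weak_Par1: "tau_weak P P' \<Longrightarrow> tau_weak (Par P Q) (Par P' Q)"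
  unfolding tau_weak_eq using tau_Par1 taus_Par1 by blast

lemma tau_weak_Par2: "tau_weak P P' \<Longrightarrow> tau_weak (Par Q P) (Par Q P')"
  unfolding tau_weak_eq using tau_Par2 taus_Par2 by blast

lemma tau_loc: "pi_process P \<Longrightarrow> tau P P' \<Longrightarrow> tau (loc c P) (loc c P')"
  by (auto simp: tau_def pi_process_iff intro: loc_step_res)

lemma taus_loc: "taus P P' \<Longrightarrow> pi_process P \<Longrightarrow> taus (loc c P) (loc c P')"
  by (induction rule: rtranclp_induct)
     (auto intro: tau_loc rtranclp.rtrancl_into_rtrancl taus_pi_process)

lemma tau_weak_loc: "tau_weak P P' \<Longrightarrow> pi_process P \<Longrightarrow> tau_weak (loc c P) (loc c P')"
  unfolding tau_weak_eq using tau_loc taus_loc tau_pi_process by blast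

lemma tau_locE:
  assumes "tau (loc c P) X" "pi_process P"
  obtains P' where "tau P P'" "X = loc c P'"
  using assms loc_stepE[of c P Tau X] by (auto simp: tau_def pi_process_iff)

lemma taus_locE:
  assumes "taus (loc c P) X" "pi_process P"
  obtains P' where "taus P P'" "X = loc c P'"
proof -
  have "\<exists>P'. taus P P' \<and> X = loc c P'" using assms(1)
  proof (induction rule: rtranclp_induct)
    case (step Y Z)
    then show ?case using tau_locE taus_pi_process[OF _ assms(2)]
      by (metis rtranclp.rtrancl_into_rtrancl)
  qed auto
  then show ?thesis using that by blast
qed

section \<open>Bisimilarity\<close>

definition swap_rel :: "name \<Rightarrow> name \<Rightarrow> prel \<Rightarrow> prel" where
  "swap_rel a b R = (\<lambda>P Q. R (swap a b P) (swap a b Q))"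

lemma swap_rel_conversep: "swap_rel a b R\<inverse>\<inverse> = (swap_rel a b R)\<inverse>\<inverse>"
  by (auto simp: swap_rel_def)

lemma on_processes_swap: "on_processes R \<Longrightarrow> on_processes (swap_rel a b R)"
  by (fastforce simp: on_processes_def swap_rel_def)

lemma codivergent_half_swap:
  assumes "codivergent_half R" shows "codivergent_half (swap_rel a b R)"
  unfolding codivergent_half_def swap_rel_def
proof (intro allI impI, elim conjE)
  fix P q assume *: "R (swap a b P) (swap a b (q 0))" "\<forall>i. tau (q i) (q (Suc i))"
  then have "\<forall>i. tau (swap a b (q i)) (swap a b (q (Suc i)))" by (auto intro: tau_swap)
  then obtain k P' where "k \<ge> 1" "tau_weak (swap a b P) P'" "R P' (swap a b (q k))"
    using assms[unfolded codivergent_half_def, rule_format, of "swap a b P" "\<lambda>i. swap a b (q i)"] * by blast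
  then show "\<exists>k\<ge>1. \<exists>P'. tau_weak P P' \<and> R (swap a b P') (swap a b (q k))"
    by (metis swap_involutive tau_weak_swap)
qed

lemma bisimulation_half_swap:
  assumes "bisimulation_half R" shows "bisimulation_half (swap_rel a b R)"
  unfolding bisimulation_half_def swap_rel_def
proof (intro allI impI, elim conjE)
  fix P Q Q' assume *: "R (swap a b P) (swap a b Q)" "tau Q Q'"
  from *(2) have "tau (swap a b Q) (swap a b Q')" by (rule tau_swap)
  with *(1) assms consider
      P' where "taus (swap a b P) P'" "R P' (swap a b Q)" "R P' (swap a b Q')"
    | P'' P' where "taus (swap a b P) P''" "tau P'' P'" "R P'' (swap a b Q)" "R P' (swap a b Q')"
    unfolding bisimulation_half_def by blast
  then show "(\<exists>P'. taus P P' \<and> R (swap a b P') (swap a b Q) \<and> R (swap a b P') (swap a b Q')) \<or>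
      (\<exists>P'' P'. taus P P'' \<and> tau P'' P' \<and> R (swap a b P'') (swap a b Q) \<and> R (swap a b P') (swap a b Q'))"
    by cases (metis swap_involutive tau_swap taus_swap)+
qed

lemma bn_label_swap: "bn_label (swap_label a b l) = transpose a b ` bn_label l"
  using bn_swap[of a b "Lab l"] by simp

lemma label_half_swap:
  assumes "label_half R" shows "label_half (swap_rel a b R)"
  unfolding label_half_def swap_rel_def
proof (intro allI impI, elim conjE)
  fix P Q l Q'
  assume *: "R (swap a b P) (swap a b Q)" "Q \<midarrow>Lab l\<rightarrow> Q'" "bn_label l \<inter> (gn P \<union> gn Q) = {}"
  from step_swap[OF *(2), of a b] have "swap a b Q \<midarrow>Lab (swap_label a b l)\<rightarrow> swap a b Q'" by simp
  moreover have "bn_label (swap_label a b l) \<inter> (gn (swap a b P) \<union> gn (swap a b Q)) = {}"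
    using *(3) by (auto simp: bn_label_swap)
  ultimately obtain P'' P' where "taus (swap a b P) P''" "P'' \<midarrow>Lab (swap_label a b l)\<rightarrow> P'"
      "R P'' (swap a b Q)" "R P' (swap a b Q')"
    using assms *(1) unfolding label_half_def by blast
  moreover from this(2) have "swap a b P'' \<midarrow>Lab l\<rightarrow> swap a b P'"
    using step_swap[of P'' "Lab (swap_label a b l)" P' a b] by simp
  ultimately show "\<exists>P'' P'. taus P P'' \<and> P'' \<midarrow>Lab l\<rightarrow> P' \<and> R (swap a b P'') (swap a b Q) \<and> R (swap a b P') (swap a b Q')"
    by (metis swap_involutive taus_swap)
qed

lemma pi_bisimulation_swap: "pi_bisimulation R \<Longrightarrow> pi_bisimulation (swap_rel a b R)"
  using on_processes_swap codivergent_half_swap bisimulation_half_swap label_half_swap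
  by (auto simp: pi_bisimulation_def codivergent_def bisimulation_def simp flip: swap_rel_conversep)

lemma pi_bisimulation_conversep: "pi_bisimulation R \<Longrightarrow> pi_bisimulation R\<inverse>\<inverse>"
  by (auto simp: pi_bisimulation_def codivergent_def bisimulation_def on_processes_def)

lemma symp_conversep_eq: "symp R \<Longrightarrow> R\<inverse>\<inverse> = R"
  by (auto simp: fun_eq_iff dest: sympD)

lemma pi_bisimulation_le: "pi_bisimulation R \<Longrightarrow> R P Q \<Longrightarrow> P \<simeq>\<^sub>\<pi> Q"
  by (auto simp: pi_bisimilar_def)

lemma pi_bisimilar_sym: "P \<simeq>\<^sub>\<pi> Q \<Longrightarrow> Q \<simeq>\<^sub>\<pi> P"
  unfolding pi_bisimilar_def using pi_bisimulation_conversep by blast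

lemma pi_bisimilar_swap: "P \<simeq>\<^sub>\<pi> Q \<Longrightarrow> swap a b P \<simeq>\<^sub>\<pi> swap a b Q"
  unfolding pi_bisimilar_def using pi_bisimulation_swap
  by (metis swap_rel_def swap_involutive)

lemma symmetric_pi_bisimulation:
  assumes "symp R" "on_processes R" "codivergent_half R" "bisimulation_half R" "label_half R"
  shows "pi_bisimulation R"
  using assms by (simp add: pi_bisimulation_def codivergent_def bisimulation_def symp_conversep_eq)

definition tau_answer :: "prel \<Rightarrow> pterm \<Rightarrow> pterm \<Rightarrow> pterm \<Rightarrow> bool" where
  "tau_answer R P Q Q' \<longleftrightarrow>
     (\<exists>P'. taus P P' \<and> R P' Q \<and> R P' Q') \<or> (\<exists>P'' P'. taus P P'' \<and> tau P'' P' \<and> R P'' Q \<and> R P' Q')"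

definition label_answer :: "prel \<Rightarrow> pterm \<Rightarrow> pterm \<Rightarrow> label \<Rightarrow> pterm \<Rightarrow> bool" where
  "label_answer R P Q l Q' \<longleftrightarrow>
     (\<exists>P'' P'. taus P P'' \<and> P'' \<midarrow>Lab l\<rightarrow> P' \<and> R P'' Q \<and> R P' Q')"

lemma bisimulation_half_alt: "bisimulation_half R \<longleftrightarrow> (\<forall>P Q Q'. R P Q \<longrightarrow> tau Q Q' \<longrightarrow> tau_answer R P Q Q')"
  unfolding bisimulation_half_def tau_answer_def by blast

lemma label_half_alt: "label_half R \<longleftrightarrow> (\<forall>P Q l Q'. R P Q \<longrightarrow> Q \<midarrow>Lab l\<rightarrow> Q' \<longrightarrow>
    bn_label l \<inter> (gn P \<union> gn Q) = {} \<longrightarrow> label_answer R P Q l Q')"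
  unfolding label_half_def label_answer_def by blast

lemma tau_answer_mono: "R \<le> S \<Longrightarrow> tau_answer R P Q Q' \<Longrightarrow> tau_answer S P Q Q'"
  unfolding tau_answer_def by blast

lemma label_answer_mono: "R \<le> S \<Longrightarrow> label_answer R P Q l Q' \<Longrightarrow> label_answer S P Q l Q'"
  unfolding label_answer_def by blast

text \<open>Stated for any relation covered by subrelations of the kind in question, so that this
  lemma and its companions for bisimulations apply to the defining unions of both
  \<open>\<simeq>\<^sub>\<pi>\<close> and \<open>=\<^sub>\<pi>\<close>.\<close>

lemma codivergent_half_union:
  assumes "\<And>P Q. S P Q \<Longrightarrow> \<exists>R. R P Q \<and> R \<le> S \<and> codivergent_half R"
  shows "codivergent_half S"
  unfolding codivergent_half_def
proof (intro allI impI, elim conjE)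
  fix P q assume "S P (q 0)" and q: "\<forall>i. tau (q i) (q (Suc i))"
  from assms[OF this(1)] obtain R where R: "R P (q 0)" "R \<le> S" "codivergent_half R" by (elim exE conjE)
  then have "\<exists>k\<ge>1. \<exists>P'. tau_weak P P' \<and> R P' (q k)" using q by (auto simp: codivergent_half_def)
  then show "\<exists>k\<ge>1. \<exists>P'. tau_weak P P' \<and> S P' (q k)" using R(2) by blast
qed

lemma bisimulation_half_union:
  assumes "\<And>P Q. S P Q \<Longrightarrow> \<exists>R. R P Q \<and> R \<le> S \<and> bisimulation_half R"
  shows "bisimulation_half S"
  unfolding bisimulation_half_alt
proof (intro allI impI)
  fix P Q Q' assume "S P Q" and Q': "tau Q Q'"
  from assms[OF this(1)] obtain R where R: "R P Q" "R \<le> S" "bisimulation_half R" by (elim exE conjE)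
  then have "tau_answer R P Q Q'" using Q' by (simp add: bisimulation_half_alt)
  with R(2) show "tau_answer S P Q Q'" by (rule tau_answer_mono)
qed

lemma label_half_union:
  assumes "\<And>P Q. S P Q \<Longrightarrow> \<exists>R. R P Q \<and> R \<le> S \<and> label_half R"
  shows "label_half S"
  unfolding label_half_alt
proof (intro allI impI)
  fix P Q l Q' assume "S P Q" and Q': "Q \<midarrow>Lab l\<rightarrow> Q'" "bn_label l \<inter> (gn P \<union> gn Q) = {}"
  from assms[OF this(1)] obtain R where R: "R P Q" "R \<le> S" "label_half R" by (elim exE conjE)
  then have "label_answer R P Q l Q'" using Q' by (simp add: label_half_alt)
  with R(2) show "label_answer S P Q l Q'" by (rule label_answer_mono)
qed

lemma pi_bisimulation_pi_bisimilar: "pi_bisimulation (\<simeq>\<^sub>\<pi>)"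
proof (rule symmetric_pi_bisimulation)
  have union: "\<exists>R. R P Q \<and> R \<le> (\<simeq>\<^sub>\<pi>) \<and> pi_bisimulation R" if "P \<simeq>\<^sub>\<pi> Q" for P Q
  proof -
    from that obtain R where R: "pi_bisimulation R" "R P Q" by (auto simp: pi_bisimilar_def)
    have "R \<le> (\<simeq>\<^sub>\<pi>)" using pi_bisimulation_le[OF R(1)] by auto
    with R show ?thesis by (intro exI[of _ R] conjI)
  qed
  show "symp (\<simeq>\<^sub>\<pi>)" by (auto intro: sympI pi_bisimilar_sym)
  show "on_processes (\<simeq>\<^sub>\<pi>)"
    unfolding on_processes_def pi_bisimilar_def pi_bisimulation_def by blast
  note union' = union[unfolded pi_bisimulation_def codivergent_def bisimulation_def]
  show "codivergent_half (\<simeq>\<^sub>\<pi>)" by (rule codivergent_half_union) (meson union')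
  show "bisimulation_half (\<simeq>\<^sub>\<pi>)" by (rule bisimulation_half_union) (meson union')
  show "label_half (\<simeq>\<^sub>\<pi>)" by (rule label_half_union) (meson union')
qed

lemma pi_bisimilar_processes: "P \<simeq>\<^sub>\<pi> Q \<Longrightarrow> pi_process P \<and> pi_process Q"
  using pi_bisimulation_pi_bisimilar unfolding pi_bisimulation_def on_processes_def by blast

section \<open>Strong bisimulations\<close>

definition strong_simulation :: "prel \<Rightarrow> bool" where
  "strong_simulation R \<longleftrightarrow>
     (\<forall>P Q l Q'. R P Q \<and> Q \<midarrow>l\<rightarrow> Q' \<and> bn l \<inter> (gn P \<union> gn Q) = {} \<longrightarrow> (\<exists>P'. P \<midarrow>l\<rightarrow> P' \<and> R P' Q'))"

lemma strong_simulation_pi_bisimulation: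
  assumes "symp R" "on_processes R" "strong_simulation R"
  shows "pi_bisimulation R"
proof (rule symmetric_pi_bisimulation[OF assms(1,2)])
  have tau: "\<exists>P'. tau P P' \<and> R P' Q'" if "R P Q" "tau Q Q'" for P Q Q'
    using assms(3) that unfolding strong_simulation_def tau_def by fastforce
  show "codivergent_half R"
    unfolding codivergent_half_def
  proof (intro allI impI, elim conjE)
    fix P q assume "R P (q 0)" "\<forall>i. tau (q i) (q (Suc i))"
    then obtain P' where "tau P P'" "R P' (q 1)" using tau[of P "q 0" "q 1"] by auto
    then show "\<exists>k\<ge>1. \<exists>P'. tau_weak P P' \<and> R P' (q k)" by (auto simp: tau_weak_eq)
  qed
  show "bisimulation_half R"
    using tau unfolding bisimulation_half_def by blast
  show "label_half R"
    using assms(3) unfolding label_half_def strong_simulation_def by fastforce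
qed

lemma pi_bisimilar_refl: "pi_process P \<Longrightarrow> P \<simeq>\<^sub>\<pi> P"
proof -
  assume P: "pi_process P"
  let ?R = "\<lambda>P Q. P = Q \<and> pi_process P"
  have "pi_bisimulation ?R"
    by (rule strong_simulation_pi_bisimulation)
       (auto simp: symp_def on_processes_def strong_simulation_def intro: step_pi_process)
  then show ?thesis using P unfolding pi_bisimilar_def by blast
qed

text \<open>The targets must coincide, not merely be bisimilar. This suffices for permuted summands
  and for conditionals between given names, where only the source differs.\<close>

lemma same_transitions_pi_bisimilar:
  assumes "pi_process P" "pi_process Q" "\<And>l X. P \<midarrow>l\<rightarrow> X \<longleftrightarrow> Q \<midarrow>l\<rightarrow> X"
  shows "P \<simeq>\<^sub>\<pi> Q"
proof -
  let ?R = "\<lambda>S T. pi_process S \<and> pi_process T \<and> (S = T \<or> (S = P \<and> T = Q) \<or> (S = Q \<and> T = P))"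
  have "strong_simulation ?R"
    unfolding strong_simulation_def using assms(3) step_pi_process by blast
  then have "pi_bisimulation ?R"
    by (intro strong_simulation_pi_bisimulation) (auto simp: symp_def on_processes_def)
  then show ?thesis using assms unfolding pi_bisimilar_def by blast
qed

text \<open>Composition and localization are closed off together, because a \<open>close\<close>
  step turns a composition into a localized one. The closure is shown to be a \<pi>-bisimulation,
  hence equal to \<open>\<simeq>\<^sub>\<pi>\<close>, which is therefore extensional.\<close>

inductive ext_closure :: prel where
  base: "P \<simeq>\<^sub>\<pi> Q \<Longrightarrow> ext_closure P Q"
| par: "ext_closure L M \<Longrightarrow> ext_closure P Q \<Longrightarrow> ext_closure (Par L P) (Par M Q)"
| loc: "ext_closure P Q \<Longrightarrow> ext_closure (loc c P) (loc c Q)"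

lemma ext_closure_processes: "ext_closure P Q \<Longrightarrow> pi_process P \<and> pi_process Q"
  by (induction rule: ext_closure.induct) (auto simp: pi_bisimilar_processes pi_process_loc)

lemma ext_closure_sym: "ext_closure P Q \<Longrightarrow> ext_closure Q P"
  by (induction rule: ext_closure.induct) (auto intro: ext_closure.intros pi_bisimilar_sym)

lemma ext_closure_swap: "ext_closure P Q \<Longrightarrow> ext_closure (swap a b P) (swap a b Q)"
  by (induction rule: ext_closure.induct)
     (auto simp: swap_loc intro: ext_closure.intros pi_bisimilar_swap)

section \<open>Answers to single transitions in the extensional closure\<close>

definition label_answers :: "prel \<Rightarrow> pterm \<Rightarrow> pterm \<Rightarrow> bool" where
  "label_answers R P Q \<longleftrightarrow>
     (\<forall>l Q'. Q \<midarrow>Lab l\<rightarrow> Q' \<longrightarrow> bn_label l \<inter> (gn P \<union> gn Q) = {} \<longrightarrow> label_answer R P Q l Q')"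

definition answers :: "prel \<Rightarrow> pterm \<Rightarrow> pterm \<Rightarrow> bool" where
  "answers R P Q \<longleftrightarrow> (\<forall>Q'. tau Q Q' \<longrightarrow> tau_answer R P Q Q') \<and> label_answers R P Q"

lemma answers_iff: "(\<forall>P Q. R P Q \<longrightarrow> answers R P Q) \<longleftrightarrow> bisimulation_half R \<and> label_half R"
  unfolding answers_def label_answers_def bisimulation_half_alt label_half_alt by blast

lemma label_answer_swap:
  assumes "\<And>P Q. R P Q \<Longrightarrow> R (swap a b P) (swap a b Q)"
    and "label_answer R (swap a b P) (swap a b Q) (swap_label a b l) (swap a b Q')"
  shows "label_answer R P Q l Q'"
proof -
  obtain P'' P' where *: "taus (swap a b P) P''" "P'' \<midarrow>Lab (swap_label a b l)\<rightarrow> P'"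
    "R P'' (swap a b Q)" "R P' (swap a b Q')"
    using assms(2) unfolding label_answer_def by blast
  have "taus P (swap a b P'')" using taus_swap[OF *(1), of a b] by simp
  moreover have "swap a b P'' \<midarrow>Lab l\<rightarrow> swap a b P'" using step_swap[OF *(2), of a b] by simp
  moreover have "R (swap a b P'') Q" "R (swap a b P') Q'"
    using assms(1)[OF *(3)] assms(1)[OF *(4)] by simp_all
  ultimately show ?thesis unfolding label_answer_def by blast
qed

lemma label_answers_swap:
  assumes "\<And>P Q a b. R P Q \<Longrightarrow> R (swap a b P) (swap a b Q)" and "label_answers R P Q"
  shows "label_answers R (swap a b P) (swap a b Q)"
  unfolding label_answers_def
proof (intro allI impI)
  fix l Q' assume *: "swap a b Q \<midarrow>Lab l\<rightarrow> Q'" "bn_label l \<inter> (gn (swap a b P) \<union> gn (swap a b Q)) = {}"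
  show "label_answer R (swap a b P) (swap a b Q) l Q'"
  proof (rule label_answer_swap[where R = R, OF assms(1)])
    have "Q \<midarrow>Lab (swap_label a b l)\<rightarrow> swap a b Q'" using step_swap[OF *(1), of a b] by simp
    moreover have "bn_label (swap_label a b l) \<inter> (gn P \<union> gn Q) = {}"
      using *(2) by (auto simp: bn_label_swap)
    ultimately show "label_answer R (swap a b (swap a b P)) (swap a b (swap a b Q)) (swap_label a b l) (swap a b Q')"
      using assms(2) unfolding label_answers_def by simp
  qed
qed

text \<open>A synchronization is answered by running the weak parts of both label answers and then
  synchronizing. This alternative is kept apart from the moves of a single component because its
  answer contains a genuine step, on which the divergence argument relies.\<close>

lemma tau_Par_communication:
  assumes E: "ext_closure L M" "ext_closure P Q"
    and ans: "label_answers ext_closure L M" "label_answers ext_closure P Q"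
    and X: "tau (Par M Q) X"
  shows "(\<exists>M'. tau M M' \<and> X = Par M' Q) \<or> (\<exists>Q'. tau Q Q' \<and> X = Par M Q') \<or>
    (\<exists>Y Z. taus (Par L P) Y \<and> tau Y Z \<and> ext_closure Y (Par M Q) \<and> ext_closure Z X)"
proof -
  obtain c where "c \<notin> gn L \<union> gn M \<union> gn P \<union> gn Q" by (erule fresh_name) simp
  then have c: "c \<notin> gn L" "c \<notin> gn M" "c \<notin> gn P" "c \<notin> gn Q" by auto
  have "Par M Q \<midarrow>Tau\<rightarrow> X" using X by (simp add: tau_def)
  then show ?thesis using c(2,4)
  proof (cases rule: step_Par_tau_syncE)
    case (sync l l' f M' Q')
    \<comment> \<open>The name localized by a \<open>close\<close> step was chosen fresh for all
      four processes, which is the proviso of the label clause on both sides.\<close>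
    have "bn_label l \<inter> (gn L \<union> gn M) = {}" "bn_label l' \<inter> (gn P \<union> gn Q) = {}"
      using sync_bn[OF sync(1)] c by auto
    with ans sync(2,3) have answers: "label_answer ext_closure L M l M'" "label_answer ext_closure P Q l' Q'"
      unfolding label_answers_def by simp_all
    obtain L'' L' where L: "taus L L''" "L'' \<midarrow>Lab l\<rightarrow> L'" "ext_closure L'' M" "ext_closure L' M'"
      using answers(1) unfolding label_answer_def by blast
    obtain P'' P' where P: "taus P P''" "P'' \<midarrow>Lab l'\<rightarrow> P'" "ext_closure P'' Q" "ext_closure P' Q'"
      using answers(2) unfolding label_answer_def by blast
    have "c \<notin> gn L''" "c \<notin> gn P''" using taus_gn[OF L(1)] taus_gn[OF P(1)] c by auto
    with sync(1) L(2) P(2) have "tau (Par L'' P'') (f (Par L' P'))"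
      unfolding tau_def by (rule step_Par_sync)
    moreover have "ext_closure (f (Par L' P')) X"
      unfolding sync(4) using sync_context[OF sync(1)] ext_closure.par[OF L(4) P(4)] ext_closure.loc by metis
    ultimately show ?thesis
      using taus_Par[OF L(1) P(1)] ext_closure.par[OF L(3) P(3)] by blast
  qed (auto simp: tau_def)
qed

lemma answers_par:
  assumes E: "ext_closure L M" "ext_closure P Q" "answers ext_closure L M" "answers ext_closure P Q"
  shows "answers ext_closure (Par L P) (Par M Q)"
  unfolding answers_def label_answers_def
proof (intro conjI allI impI)
  have ans: "label_answers ext_closure L M" "label_answers ext_closure P Q"
    using E by (auto simp: answers_def)
  {
    fix l X assume st: "Par M Q \<midarrow>Lab l\<rightarrow> X" and bn: "bn_label l \<inter> (gn (Par L P) \<union> gn (Par M Q)) = {}"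
    then have bn': "bn_label l \<inter> (gn L \<union> gn M) = {}" "bn_label l \<inter> (gn P \<union> gn Q) = {}"
        "bn (Lab l) \<inter> gn L = {}" "bn (Lab l) \<inter> gn P = {}" by auto
    from st show "label_answer ext_closure (Par L P) (Par M Q) l X"
    proof (cases rule: step_Par_labE)
      case (left M')
      then have "label_answer ext_closure L M l M'" using ans(1) bn'(1) by (simp add: label_answers_def)
      then obtain L'' L' where *: "taus L L''" "L'' \<midarrow>Lab l\<rightarrow> L'" "ext_closure L'' M" "ext_closure L' M'"
        unfolding label_answer_def by blast
      have "Par L'' P \<midarrow>Lab l\<rightarrow> Par L' P" using *(2) bn'(4) by (rule step.par_l)
      then show ?thesis unfolding label_answer_def left(2)
        using * E(2) taus_Par1 ext_closure.par by blast
    next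
      case (right Q')
      then have "label_answer ext_closure P Q l Q'" using ans(2) bn'(2) by (simp add: label_answers_def)
      then obtain P'' P' where *: "taus P P''" "P'' \<midarrow>Lab l\<rightarrow> P'" "ext_closure P'' Q" "ext_closure P' Q'"
        unfolding label_answer_def by blast
      have "Par L P'' \<midarrow>Lab l\<rightarrow> Par L P'" using *(2) bn'(3) by (rule step.par_r)
      then show ?thesis unfolding label_answer_def right(2)
        using * E(1) taus_Par2 ext_closure.par by blast
    qed
  }
  fix X assume "tau (Par M Q) X"
  from tau_Par_communication[OF E(1,2) ans this]
  consider (left) M' where "tau M M'" "X = Par M' Q" | (right) Q' where "tau Q Q'" "X = Par M Q'"
    | (com) Y Z where "taus (Par L P) Y" "tau Y Z" "ext_closure Y (Par M Q)" "ext_closure Z X" by blast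
  then show "tau_answer ext_closure (Par L P) (Par M Q) X"
  proof cases
    case left
    then have "tau_answer ext_closure L M M'" using E(3) by (simp add: answers_def)
    then show ?thesis unfolding tau_answer_def left(2)
      using E(2) taus_Par1[of L _ P] tau_Par1[of _ _ P] ext_closure.par[of _ _ P Q] by metis
  next
    case right
    then have "tau_answer ext_closure P Q Q'" using E(4) by (simp add: answers_def)
    then show ?thesis unfolding tau_answer_def right(2)
      using E(1) taus_Par2[of P _ L] tau_Par2[of _ _ L] ext_closure.par[of L M] by metis
  next
    case com
    then show ?thesis unfolding tau_answer_def by blast
  qed
qed

text \<open>The localized name is first moved away from the label. If the label then extrudes it as
  \<open>c'\<close>, both sides are converted to localize \<open>c'\<close> itself, the free output
  of the bodies is answered, and \<open>extrude\<close> is applied again. Otherwise the answer of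
  the body is localized.\<close>

lemma answers_loc:
  assumes E: "ext_closure P Q" "answers ext_closure P Q"
  shows "answers ext_closure (loc c P) (loc c Q)"
  unfolding answers_def label_answers_def
proof (intro conjI allI impI)
  have proc: "pi_process P" "pi_process Q" using ext_closure_processes[OF E(1)] by auto
  fix X assume "tau (loc c Q) X"
  then obtain Q' where Q': "tau Q Q'" "X = loc c Q'" using proc(2) by (elim tau_locE)
  then have "tau_answer ext_closure P Q Q'" using E(2) by (simp add: answers_def)
  then show "tau_answer ext_closure (loc c P) (loc c Q) X"
    unfolding tau_answer_def Q'(2)
    using taus_loc proc(1) tau_loc taus_pi_process ext_closure.loc by meson
next
  have proc: "pi_process P" "pi_process Q" using ext_closure_processes[OF E(1)] by auto
  then have wf: "wft 0 P" "wft 0 Q" by (auto simp: pi_process_iff)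
  fix l X assume st: "loc c Q \<midarrow>Lab l\<rightarrow> X" and bn: "bn_label l \<inter> (gn (loc c P) \<union> gn (loc c Q)) = {}"
  obtain d where d: "d \<notin> insert c (names_label l \<union> gn P \<union> gn Q)" by (erule fresh_name) simp
  define P1 Q1 where "P1 = swap c d P" and "Q1 = swap c d Q"
  have eqs: "loc c P = loc d P1" "loc c Q = loc d Q1"
    unfolding P1_def Q1_def using d by (auto simp: loc_swap)
  have wf1: "wft 0 P1" "wft 0 Q1" and proc1: "pi_process P1" unfolding P1_def Q1_def using wf proc by auto
  have E1: "ext_closure P1 Q1" unfolding P1_def Q1_def using E(1) by (rule ext_closure_swap)
  have ans: "label_answers ext_closure P1 Q1"
    unfolding P1_def Q1_def using E(2) by (auto simp: answers_def intro: label_answers_swap ext_closure_swap)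
  have "d \<notin> names (Lab l)" using d by simp
  with st[unfolded eqs] wf1(2) show "label_answer ext_closure (loc c P) (loc c Q) l X"
  proof (cases rule: loc_stepE)
    case (res Q')
    have "d \<notin> bn_label l" using d bn_names[of "Lab l"] by auto
    then have "bn_label l \<inter> (gn P1 \<union> gn Q1) = {}"
      using bn[unfolded eqs] by auto
    then obtain P'' P' where *: "taus P1 P''" "P'' \<midarrow>Lab l\<rightarrow> P'" "ext_closure P'' Q1" "ext_closure P' Q'"
      using ans res(1) unfolding label_answers_def label_answer_def by blast
    have "loc d P'' \<midarrow>Lab l\<rightarrow> loc d P'"
      using loc_step_res[OF _ *(2)] d taus_pi_process[OF *(1) proc1] by (auto simp: pi_process_iff)
    then show ?thesis
      unfolding label_answer_def eqs res(2) using taus_loc[OF *(1) proc1] * ext_closure.loc by blast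
  next
    case (extrude a c')
    have c': "c' \<notin> gn (loc d P1)" "c' \<notin> gn (loc d Q1)" using bn[unfolded eqs] extrude(1) by auto
    have eqs': "loc d P1 = loc c' (swap d c' P1)" "loc d Q1 = loc c' (swap d c' Q1)"
      using c' by (auto simp: loc_swap)
    have "label_answers ext_closure (swap d c' P1) (swap d c' Q1)"
      using ext_closure_swap ans by (rule label_answers_swap)
    then obtain P'' P' where *: "taus (swap d c' P1) P''" "P'' \<midarrow>Lab (Out a c')\<rightarrow> P'"
        "ext_closure P'' (swap d c' Q1)" "ext_closure P' X"
      using extrude unfolding label_answers_def label_answer_def by fastforce
    have proc': "pi_process (swap d c' P1)" using proc1 by simp
    then have "loc c' P'' \<midarrow>Lab (BOut a c')\<rightarrow> P'"
      using loc_step_extrude[OF _ *(2)] extrude(5) taus_pi_process[OF *(1)] by (auto simp: pi_process_iff)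
    then show ?thesis
      unfolding label_answer_def eqs eqs' extrude(1)
      using taus_loc[OF *(1) proc'] * ext_closure.loc by blast
  qed
qed

lemma ext_closure_answers: "ext_closure P Q \<Longrightarrow> answers ext_closure P Q"
proof (induction rule: ext_closure.induct)
  case (base P Q)
  have "answers (\<simeq>\<^sub>\<pi>) P Q"
    using base pi_bisimulation_pi_bisimilar answers_iff[of "(\<simeq>\<^sub>\<pi>)"]
    by (auto simp: pi_bisimulation_def bisimulation_def)
  moreover have le: "(\<simeq>\<^sub>\<pi>) \<le> ext_closure" by (auto intro: ext_closure.base)
  ultimately show ?case
    unfolding answers_def label_answers_def using tau_answer_mono[OF le] label_answer_mono[OF le] by simp
qed (auto intro: answers_par answers_loc)

section \<open>Codivergence of the extensional closure\<close>

definition diverges_answer :: "prel \<Rightarrow> pterm \<Rightarrow> (nat \<Rightarrow> pterm) \<Rightarrow> bool" where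
  "diverges_answer R P q \<longleftrightarrow> (\<exists>k\<ge>1. \<exists>P'. tau_weak P P' \<and> R P' (q k))"

text \<open>Either component of an infinite run of a composition may be idle from some point on.\<close>

lemma infinite_run_subsequence:
  assumes run: "\<And>i. (step_at i \<and> tau (q i) (q (Suc i))) \<or> (\<not> step_at i \<and> q (Suc i) = q i)"
    and inf: "infinite {i. step_at i}"
  obtains r where "strict_mono (r :: nat \<Rightarrow> nat)" "q (r 0) = q 0" "\<And>j. tau (q (r j)) (q (r (Suc j)))"
proof
  let ?S = "{i. step_at i}"
  define r where "r = enumerate ?S"
  show "strict_mono r" unfolding r_def using inf by (simp add: strict_mono_enumerate)
  have idle: "q j = q i" if "i \<le> j" "\<And>m. i \<le> m \<Longrightarrow> m < j \<Longrightarrow> \<not> step_at m" for i j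
    using that
  proof (induction j rule: dec_induct)
    case (step n)
    then have "\<not> step_at n" "q n = q i" by auto
    then show ?case using run[of n] by auto
  qed simp
  show "q (r 0) = q 0"
    unfolding r_def enumerate_0 by (rule idle) (use not_less_Least in auto)
  show "tau (q (r j)) (q (r (Suc j)))" for j
  proof -
    have "step_at (r j)" unfolding r_def using enumerate_in_set[OF inf, of j] by simp
    then have "tau (q (r j)) (q (Suc (r j)))" using run by blast
    moreover have "q (r (Suc j)) = q (Suc (r j))"
    proof (rule idle)
      show "Suc (r j) \<le> r (Suc j)" unfolding r_def using enumerate_step[OF inf, of j] by simp
      fix m assume "Suc (r j) \<le> m" "m < r (Suc j)"
      then show "\<not> step_at m"
        unfolding r_def enumerate_Suc''[OF inf] by (metis (mono_tags, lifting) Suc_le_eq mem_Collect_eq not_less_Least)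
    qed
    ultimately show ?thesis by simp
  qed
qed

lemma diverges_par:
  assumes E: "ext_closure L M" "ext_closure P Q"
    and IH: "\<And>m. m 0 = M \<Longrightarrow> (\<And>i. tau (m i) (m (Suc i))) \<Longrightarrow> diverges_answer ext_closure L m"
      "\<And>m. m 0 = Q \<Longrightarrow> (\<And>i. tau (m i) (m (Suc i))) \<Longrightarrow> diverges_answer ext_closure P m"
    and q: "q 0 = Par M Q" "\<And>i. tau (q i) (q (Suc i))"
  shows "diverges_answer ext_closure (Par L P) q"
proof (rule ccontr)
  assume no: "\<not> diverges_answer ext_closure (Par L P) q"
  have nope: False if "tau_weak (Par L P) X" "ext_closure X (q i)" "i \<ge> 1" for X i
    using no that unfolding diverges_answer_def by blast
  \<comment> \<open>\<open>L\<close> and \<open>P\<close> stay fixed along the whole run: without a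
    proper answer they can never move, so they remain related to the current components of
    \<open>q i\<close>.\<close>
  define good where "good = (\<lambda>i (s :: pterm \<times> pterm). q i = Par (fst s) (snd s) \<and> ext_closure L (fst s) \<and> ext_closure P (snd s))"
  define move where "move = (\<lambda>s s' :: pterm \<times> pterm.
    (tau (fst s) (fst s') \<and> snd s' = snd s) \<or> (tau (snd s) (snd s') \<and> fst s' = fst s))"
  have next_state: "\<exists>s'. good (Suc i) s' \<and> move s s'" if "good i s" for i s
  proof -
    obtain M' Q' where s: "s = (M', Q')" by (cases s)
    have eq: "q i = Par M' Q'" and EM: "ext_closure L M'" and EQ: "ext_closure P Q'"
      using that s by (auto simp: good_def)
    have ans: "answers ext_closure L M'" "answers ext_closure P Q'"
      using ext_closure_answers EM EQ by auto
    from tau_Par_communication[OF EM EQ _ _ q(2)[of i, unfolded eq]] ans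
    consider (left) M'' where "tau M' M''" "q (Suc i) = Par M'' Q'"
      | (right) Q'' where "tau Q' Q''" "q (Suc i) = Par M' Q''"
      | (com) Y Z where "taus (Par L P) Y" "tau Y Z" "ext_closure Z (q (Suc i))"
      unfolding answers_def by blast
    then show ?thesis
    proof cases
      case left
      then have "tau_answer ext_closure L M' M''" using ans by (simp add: answers_def)
      \<comment> \<open>Either form of answer ends in some \<open>L'\<close> related to
        \<open>M''\<close>. Were it reached by at least one step, \<open>Par L' P\<close> would be a
        proper answer.\<close>
      then obtain L' where L': "taus L L'" "ext_closure L' M''" "L = L' \<or> tau_weak L L'"
        unfolding tau_answer_def using taus_cases tau_weakI tau_weak_taus by metis
      then have "L = L'"
        using nope[of "Par L' P" "Suc i"] tau_weak_Par1 left(2) ext_closure.par[OF L'(2) EQ] by auto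
      then have "good (Suc i) (M'', Q')" using left(2) L' EQ by (simp add: good_def)
      then show ?thesis using left(1) s by (auto simp: move_def)
    next
      case right
      then have "tau_answer ext_closure P Q' Q''" using ans by (simp add: answers_def)
      then obtain P' where P': "taus P P'" "ext_closure P' Q''" "P = P' \<or> tau_weak P P'"
        unfolding tau_answer_def using taus_cases tau_weakI tau_weak_taus by metis
      then have "P = P'"
        using nope[of "Par L P'" "Suc i"] tau_weak_Par2 right(2) ext_closure.par[OF EM P'(2)] by auto
      then have "good (Suc i) (M', Q'')" using right(2) P' EM by (simp add: good_def)
      then show ?thesis using right(1) s by (auto simp: move_def)
    next
      case com
      \<comment> \<open>The answer to a synchronization contains a genuine step, so no
        synchronization occurs in this run.\<close>
      then show ?thesis using nope[of Z "Suc i"] tau_weakI by auto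
    qed
  qed
  have "good 0 (M, Q)" using E q(1) by (simp add: good_def)
  \<comment> \<open>The clause for \<open>i = 0\<close> makes the chosen sequence start in
    \<open>(M, Q)\<close>.\<close>
  then obtain s where s: "s 0 = (M, Q)" "\<And>i. good i (s i)" "\<And>i. move (s i) (s (Suc i))"
    using dependent_nat_choice[of "\<lambda>i s. good i s \<and> (i = 0 \<longrightarrow> s = (M, Q))" "\<lambda>i s s'. move s s'"] next_state
    by (metis nat.distinct(1))
  define left where "left i \<longleftrightarrow> tau (fst (s i)) (fst (s (Suc i))) \<and> snd (s (Suc i)) = snd (s i)" for i
  show False
  proof (cases "infinite {i. left i}")
    case True
    have "(left i \<and> tau (fst (s i)) (fst (s (Suc i)))) \<or> (\<not> left i \<and> fst (s (Suc i)) = fst (s i))" for i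
      using s(3)[of i] by (auto simp: left_def move_def)
    from infinite_run_subsequence[of left "\<lambda>i. fst (s i)", OF this True] obtain r
      where r: "strict_mono r" "fst (s (r 0)) = M" "\<And>j. tau (fst (s (r j))) (fst (s (r (Suc j))))"
      using s(1) by auto
    obtain k L' where k: "k \<ge> 1" "tau_weak L L'" "ext_closure L' (fst (s (r k)))"
      using IH(1)[of "\<lambda>j. fst (s (r j))"] r(2,3) unfolding diverges_answer_def by blast
    \<comment> \<open>The index \<open>k\<close> counts steps of one component only;
      \<open>r\<close> being strictly increasing, the position \<open>r k\<close> in the whole run
      is positive as well.\<close>
    have "r k \<ge> 1" using k(1) strict_mono_imp_increasing[OF r(1), of k] by simp
    moreover have "ext_closure (Par L' P) (q (r k))"
      using s(2)[of "r k"] k(3) ext_closure.par by (simp add: good_def)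
    ultimately show False using nope tau_weak_Par1[OF k(2)] by blast
  next
    case False
    have "infinite {i. \<not> left i}"
    proof
      assume "finite {i. \<not> left i}"
      with False have "finite ({i. left i} \<union> {i. \<not> left i})" by simp
      moreover have "{i. left i} \<union> {i. \<not> left i} = UNIV" by auto
      ultimately show False by simp
    qed
    moreover have "(\<not> left i \<and> tau (snd (s i)) (snd (s (Suc i)))) \<or> (\<not> \<not> left i \<and> snd (s (Suc i)) = snd (s i))" for i
      using s(3)[of i] by (auto simp: left_def move_def)
    ultimately obtain r
      where r: "strict_mono r" "snd (s (r 0)) = Q" "\<And>j. tau (snd (s (r j))) (snd (s (r (Suc j))))"
      using infinite_run_subsequence[of "\<lambda>i. \<not> left i" "\<lambda>i. snd (s i)"] s(1) by auto
    obtain k P' where k: "k \<ge> 1" "tau_weak P P'" "ext_closure P' (snd (s (r k)))"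
      using IH(2)[of "\<lambda>j. snd (s (r j))"] r(2,3) unfolding diverges_answer_def by blast
    have "r k \<ge> 1" using k(1) strict_mono_imp_increasing[OF r(1), of k] by simp
    moreover have "ext_closure (Par L P') (q (r k))"
      using s(2)[of "r k"] k(3) ext_closure.par by (simp add: good_def)
    ultimately show False using nope tau_weak_Par2[OF k(2)] by blast
  qed
qed

text \<open>A run of a localized process is the localization of a run of its body, so the answer of
  the body can be localized.\<close>

lemma diverges_loc:
  assumes "ext_closure P Q"
    and IH: "\<And>m. m 0 = Q \<Longrightarrow> (\<And>i. tau (m i) (m (Suc i))) \<Longrightarrow> diverges_answer ext_closure P m"
    and q: "q 0 = loc c Q" "\<And>i. tau (q i) (q (Suc i))"
  shows "diverges_answer ext_closure (loc c P) q"
proof -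
  have proc: "pi_process P" "pi_process Q" using ext_closure_processes[OF assms(1)] by auto
  have "\<exists>T'. (pi_process T' \<and> q (Suc i) = loc c T') \<and> tau T T'" if "pi_process T \<and> q i = loc c T" for i T
    using that q(2)[of i] tau_locE[of c T "q (Suc i)"] tau_pi_process by metis
  then obtain m where m: "m 0 = Q" "\<And>i. q i = loc c (m i)" "\<And>i. tau (m i) (m (Suc i))"
    using dependent_nat_choice[of "\<lambda>i T. (pi_process T \<and> q i = loc c T) \<and> (i = 0 \<longrightarrow> T = Q)" "\<lambda>i T T'. tau T T'"] proc(2) q(1)
    by (metis nat.distinct(1))
  from IH[of m] m obtain k P' where "k \<ge> 1" "tau_weak P P'" "ext_closure P' (m k)"
    unfolding diverges_answer_def by blast
  then show ?thesis
    unfolding diverges_answer_def m(2) using tau_weak_loc[OF _ proc(1)] ext_closure.loc by blast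
qed

lemma ext_closure_diverges:
  "ext_closure P Q \<Longrightarrow> q 0 = Q \<Longrightarrow> (\<And>i. tau (q i) (q (Suc i))) \<Longrightarrow> diverges_answer ext_closure P q"
proof (induction arbitrary: q rule: ext_closure.induct)
  case (base P Q)
  then have "\<exists>k\<ge>1. \<exists>P'. tau_weak P P' \<and> P' \<simeq>\<^sub>\<pi> q k"
    using pi_bisimulation_pi_bisimilar
    unfolding pi_bisimulation_def codivergent_def codivergent_half_def by blast
  then show ?case unfolding diverges_answer_def using ext_closure.base by blast
next
  case (par L M P Q)
  then show ?case by (intro diverges_par) auto
next
  case (loc P Q c)
  then show ?case by (intro diverges_loc) auto
qed

lemma pi_bisimulation_ext_closure: "pi_bisimulation ext_closure"
proof (rule symmetric_pi_bisimulation)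
  show "symp ext_closure" by (auto intro: sympI ext_closure_sym)
  show "on_processes ext_closure" using ext_closure_processes by (auto simp: on_processes_def)
  show "codivergent_half ext_closure"
    using ext_closure_diverges unfolding codivergent_half_def diverges_answer_def by blast
  show "bisimulation_half ext_closure" "label_half ext_closure"
    using answers_iff[of ext_closure] ext_closure_answers by auto
qed

lemma extensional_pi_bisimilar: "extensional (\<simeq>\<^sub>\<pi>)"
proof -
  have "ext_closure P Q \<longleftrightarrow> P \<simeq>\<^sub>\<pi> Q" for P Q
    using ext_closure.base pi_bisimulation_ext_closure by (auto simp: pi_bisimilar_def)
  then show ?thesis using ext_closure.intros by (auto simp: extensional_def)
qed

lemma bisimulation_half_taus:
  assumes "bisimulation_half R" "R P Q" "taus Q Q'"
  obtains P' where "taus P P'" "R P' Q'"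
proof -
  have "\<exists>P'. taus P P' \<and> R P' Q'" using assms(3)
  proof (induction rule: rtranclp_induct)
    case base
    then show ?case using assms(2) by blast
  next
    case (step S S')
    then obtain P' where P': "taus P P'" "R P' S" by blast
    with step(2) assms(1) have "\<exists>P''. taus P' P'' \<and> R P'' S'"
      unfolding bisimulation_half_def by (metis rtranclp.rtrancl_into_rtrancl)
    then show ?case using P'(1) by (meson rtranclp_trans)
  qed
  then show ?thesis using that by blast
qed

text \<open>Label clauses and compositions ask that a bound name avoid global names. Where only the
  subject matters, as for observability and barbs, the bound name can be moved out of the
  way.\<close>

lemma step_fresh_bn:
  assumes "P \<midarrow>Lab l\<rightarrow> P'" "finite F"
  obtains l' P'' where "P \<midarrow>Lab l'\<rightarrow> P''" "subj l' = subj l" "bn_label l' \<inter> F = {}"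
proof (cases l)
  case (BOut a c)
  obtain d where d: "d \<notin> insert a (F \<union> gn P)" by (erule fresh_name) (simp add: assms(2))
  have *: "a \<noteq> c" "c \<notin> gn P" using assms(1) BOut step_BOut_neq step_BOut_gn by auto
  have "P \<midarrow>Lab (BOut a d)\<rightarrow> swap c d P'"
    using step_swap[OF assms(1), of c d] BOut d * swap_fresh[of c P d] by (auto simp: transpose_def)
  then show ?thesis using that[of "BOut a d"] d BOut by auto
qed (use assms that in auto)

lemma absolute_pi_bisimilar: "absolute (\<simeq>\<^sub>\<pi>)"
proof -
  note pb = pi_bisimulation_pi_bisimilar[unfolded pi_bisimulation_def bisimulation_def]
  have "observable P" if PQ: "P \<simeq>\<^sub>\<pi> Q" and obs: "observable Q" for P Q
  proof -
    from obs obtain Q'' l Q' where Q: "taus Q Q''" "Q'' \<midarrow>Lab l\<rightarrow> Q'" by (auto simp: observable_def)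
    obtain P'' where P: "taus P P''" "P'' \<simeq>\<^sub>\<pi> Q''"
      using bisimulation_half_taus[of "(\<simeq>\<^sub>\<pi>)", OF _ PQ Q(1)] pb by blast
    obtain l' X where "Q'' \<midarrow>Lab l'\<rightarrow> X" "bn_label l' \<inter> (gn P'' \<union> gn Q'') = {}"
      using step_fresh_bn[OF Q(2), of "gn P'' \<union> gn Q''"] by (metis finite_UnI finite_gn)
    then obtain P3 P4 where "taus P'' P3" "P3 \<midarrow>Lab l'\<rightarrow> P4"
      using pb P(2) unfolding label_half_def by blast
    then show ?thesis using P(1) unfolding observable_def by (meson rtranclp_trans)
  qed
  then have "equipollent (\<simeq>\<^sub>\<pi>)" using pi_bisimilar_sym by (auto simp: equipollent_def)
  then show ?thesis
    using pb extensional_pi_bisimilar pi_bisimilar_refl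
    by (auto simp: absolute_def reflexive_def bisimulation_def)
qed

lemma pi_bisimilar_abs_eq: "P \<simeq>\<^sub>\<pi> Q \<Longrightarrow> P =\<^sub>\<pi> Q"
  using absolute_pi_bisimilar by (auto simp: abs_eq_def)

section \<open>Structural congruence\<close>

text \<open>Symmetry is derived; instead of a symmetry rule the reverses \<open>zero'\<close> and
  \<open>ext'\<close> are listed. Each rule then has to be simulated in one direction only, whereas
  a symmetry rule would force both directions into one induction.\<close>

inductive scong :: prel where
  refl: "pi_process P \<Longrightarrow> scong P P"
| trans: "scong P Q \<Longrightarrow> scong Q R \<Longrightarrow> scong P R"
| par: "scong L M \<Longrightarrow> scong P Q \<Longrightarrow> scong (Par L P) (Par M Q)"
| loc: "scong P Q \<Longrightarrow> scong (loc c P) (loc c Q)"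
| comm: "pi_process P \<Longrightarrow> pi_process Q \<Longrightarrow> scong (Par P Q) (Par Q P)"
| assoc: "pi_process P \<Longrightarrow> pi_process Q \<Longrightarrow> pi_process R \<Longrightarrow>
    scong (Par (Par P Q) R) (Par P (Par Q R))"
| zero: "pi_process P \<Longrightarrow> scong (Par P Zero) P"
| zero': "pi_process P \<Longrightarrow> scong P (Par P Zero)"
| ext: "pi_process P \<Longrightarrow> pi_process Q \<Longrightarrow> c \<notin> gn P \<Longrightarrow> scong (loc c (Par P Q)) (Par P (loc c Q))"
| ext': "pi_process P \<Longrightarrow> pi_process Q \<Longrightarrow> c \<notin> gn P \<Longrightarrow> scong (Par P (loc c Q)) (loc c (Par P Q))"
| exchange: "pi_process P \<Longrightarrow> scong (loc c (loc d P)) (loc d (loc c P))"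

declare scong.trans [trans]

lemma step_Par_labI1: "P \<midarrow>Lab l\<rightarrow> P' \<Longrightarrow> bn_label l \<inter> gn Q = {} \<Longrightarrow> Par P Q \<midarrow>Lab l\<rightarrow> Par P' Q"
  and step_Par_labI2: "Q \<midarrow>Lab l\<rightarrow> Q' \<Longrightarrow> bn_label l \<inter> gn P = {} \<Longrightarrow> Par P Q \<midarrow>Lab l\<rightarrow> Par P Q'"
  and step_Par_tauI1: "P \<midarrow>Tau\<rightarrow> P' \<Longrightarrow> Par P Q \<midarrow>Tau\<rightarrow> Par P' Q"
  and step_Par_tauI2: "Q \<midarrow>Tau\<rightarrow> Q' \<Longrightarrow> Par P Q \<midarrow>Tau\<rightarrow> Par P Q'"
  by (simp_all add: step.par_l step.par_r)

lemma scong_processes: "scong P Q \<Longrightarrow> pi_process P \<and> pi_process Q"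
  by (induction rule: scong.induct) (auto simp: pi_process_loc)

lemma scong_gn: "scong P Q \<Longrightarrow> gn P = gn Q"
  by (induction rule: scong.induct) auto

lemma scong_assoc':
  assumes "pi_process P" "pi_process Q" "pi_process R"
  shows "scong (Par P (Par Q R)) (Par (Par P Q) R)"
proof -
  have "scong (Par P (Par Q R)) (Par (Par R Q) P)"
    using assms by (meson pi_process_simps(2) scong.comm scong.par scong.refl scong.trans)
  also have "scong (Par (Par R Q) P) (Par R (Par Q P))" using assms by (intro scong.assoc)
  also have "scong (Par R (Par Q P)) (Par (Par P Q) R)"
    using assms by (meson pi_process_simps(2) scong.comm scong.par scong.refl scong.trans)
  finally show ?thesis .
qed

lemma scong_sym: "scong P Q \<Longrightarrow> scong Q P"
  by (induction rule: scong.induct) (auto intro: scong.intros scong_assoc')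

lemma scong_swap: "scong P Q \<Longrightarrow> scong (swap a b P) (swap a b Q)"
proof (induction rule: scong.induct)
  case (trans P Q R)
  from trans(3,4) show ?case by (rule scong.trans)
qed (auto simp: swap_loc intro: scong.intros)

section \<open>Structural congruence is a strong bisimulation\<close>

definition scong_sim :: prel where
  "scong_sim P Q \<longleftrightarrow> (\<forall>l P'. P \<midarrow>l\<rightarrow> P' \<longrightarrow> (\<exists>Q'. Q \<midarrow>l\<rightarrow> Q' \<and> scong P' Q'))"

lemma scong_simI [intro?]:
  "(\<And>l P'. P \<midarrow>l\<rightarrow> P' \<Longrightarrow> \<exists>Q'. Q \<midarrow>l\<rightarrow> Q' \<and> scong P' Q') \<Longrightarrow> scong_sim P Q"
  by (simp add: scong_sim_def)

lemma scong_sim_actionI: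
  assumes "\<And>l X. P \<midarrow>Lab l\<rightarrow> X \<Longrightarrow> \<exists>Y. Q \<midarrow>Lab l\<rightarrow> Y \<and> scong X Y"
    and "\<And>X. P \<midarrow>Tau\<rightarrow> X \<Longrightarrow> \<exists>Y. Q \<midarrow>Tau\<rightarrow> Y \<and> scong X Y"
  shows "scong_sim P Q"
  using assms by (metis action.exhaust scong_simI)

lemma scong_simE:
  assumes "scong_sim P Q" "P \<midarrow>l\<rightarrow> P'"
  obtains Q' where "Q \<midarrow>l\<rightarrow> Q'" "scong P' Q'"
  using assms by (auto simp: scong_sim_def)

lemma scong_sim_swap: "scong_sim P Q \<Longrightarrow> scong_sim (swap a b P) (swap a b Q)"
proof
  fix l P' assume *: "scong_sim P Q" "swap a b P \<midarrow>l\<rightarrow> P'"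
  from step_swap[OF *(2), of a b] have "P \<midarrow>swap_action a b l\<rightarrow> swap a b P'" by simp
  with *(1) obtain Q' where "Q \<midarrow>swap_action a b l\<rightarrow> Q'" "scong (swap a b P') Q'" by (rule scong_simE)
  then show "\<exists>Q'. swap a b Q \<midarrow>l\<rightarrow> Q' \<and> scong P' Q'"
    using step_swap[of Q "swap_action a b l" Q' a b] scong_swap[of "swap a b P'" Q' a b] by auto
qed

lemma sync_scong: "sync c l l' f \<Longrightarrow> scong S T \<Longrightarrow> scong (f S) (f T)"
  using sync_context scong.loc by metis

text \<open>\<open>f\<close> is the identity or \<open>loc c\<close>. After a synchronization of two
  of three components, the third one stands inside or outside the new localization, depending on the
  bracketing; scope extension moves it across.\<close>

lemma sync_scong_Par:
  assumes "sync c l l' f" "pi_process S" "pi_process R" "c \<notin> gn R"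
  shows "scong (f (Par R S)) (Par R (f S))" "scong (Par (f S) R) (f (Par S R))"
proof -
  have "scong (Par (loc c S) R) (Par R (loc c S))" using assms by (intro scong.comm pi_process_loc)
  also have "scong \<dots> (loc c (Par R S))" using assms by (intro scong.ext')
  also have "scong \<dots> (loc c (Par S R))" using assms by (intro scong.loc scong.comm)
  finally have "scong (Par (loc c S) R) (loc c (Par S R))" .
  then show "scong (f (Par R S)) (Par R (f S))" "scong (Par (f S) R) (f (Par S R))"
    using assms scong.ext[of R S c] scong.refl by (auto elim!: sync.cases)
qed

lemma sync_scong_loc: "sync e l l' f \<Longrightarrow> pi_process S \<Longrightarrow> scong (loc c (f S)) (f (loc c S))"
  by (erule sync.cases) (auto intro: scong.refl scong.exchange pi_process_loc)

lemma scong_sim_par: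
  assumes LM: "scong L M" "scong_sim L M" and PQ: "scong P Q" "scong_sim P Q"
  shows "scong_sim (Par L P) (Par M Q)"
proof (rule scong_sim_actionI)
  have gn: "gn L = gn M" "gn P = gn Q" using scong_gn LM PQ by auto
  {
    fix l X assume "Par L P \<midarrow>Lab l\<rightarrow> X"
    then show "\<exists>Y. Par M Q \<midarrow>Lab l\<rightarrow> Y \<and> scong X Y"
    proof (cases rule: step_Par_labE)
      case (left L')
      from LM(2) left(1) obtain M' where "M \<midarrow>Lab l\<rightarrow> M'" "scong L' M'" by (rule scong_simE)
      then show ?thesis using left(2,3) PQ(1) gn step_Par_labI1 scong.par by metis
    next
      case (right P')
      from PQ(2) right(1) obtain Q' where "Q \<midarrow>Lab l\<rightarrow> Q'" "scong P' Q'" by (rule scong_simE)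
      then show ?thesis using right(2,3) LM(1) gn step_Par_labI2 scong.par by metis
    qed
  }
  fix X assume st: "Par L P \<midarrow>Tau\<rightarrow> X"
  obtain c where "c \<notin> gn L \<union> gn P" by (erule fresh_name) simp
  then have c: "c \<notin> gn L" "c \<notin> gn P" by auto
  from st c show "\<exists>Y. Par M Q \<midarrow>Tau\<rightarrow> Y \<and> scong X Y"
  proof (cases rule: step_Par_tau_syncE)
    case (left L')
    from LM(2) left(1) obtain M' where "M \<midarrow>Tau\<rightarrow> M'" "scong L' M'" by (rule scong_simE)
    then show ?thesis using left(2) PQ(1) step_Par_tauI1 scong.par by metis
  next
    case (right P')
    from PQ(2) right(1) obtain Q' where "Q \<midarrow>Tau\<rightarrow> Q'" "scong P' Q'" by (rule scong_simE)
    then show ?thesis using right(2) LM(1) step_Par_tauI2 scong.par by metis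
  next
    case (sync l l' f L' P')
    from LM(2) sync(2) obtain M' where M': "M \<midarrow>Lab l\<rightarrow> M'" "scong L' M'" by (rule scong_simE)
    from PQ(2) sync(3) obtain Q' where Q': "Q \<midarrow>Lab l'\<rightarrow> Q'" "scong P' Q'" by (rule scong_simE)
    have "Par M Q \<midarrow>Tau\<rightarrow> f (Par M' Q')" using sync(1) M'(1) Q'(1) by (rule step_Par_sync) (use c gn in auto)
    then show ?thesis unfolding sync(4) using sync_scong[OF sync(1)] scong.par M'(2) Q'(2) by blast
  qed
qed

lemma scong_sim_loc:
  assumes PQ: "scong P Q" "scong_sim P Q"
  shows "scong_sim (loc c P) (loc c Q)"
proof
  fix l X assume st: "loc c P \<midarrow>l\<rightarrow> X"
  have gn: "gn P = gn Q" using scong_gn PQ by auto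
  obtain d where d: "d \<notin> insert c (names l \<union> gn P)" by (erule fresh_name) simp
  define P1 Q1 where "P1 = swap c d P" and "Q1 = swap c d Q"
  have eqs: "loc c P = loc d P1" "loc c Q = loc d Q1"
    unfolding P1_def Q1_def using d gn by (auto simp: loc_swap)
  have gn1: "gn P1 = gn Q1" using gn by (simp add: P1_def Q1_def gn_swap)
  have wf: "wft 0 P1" "wft 0 Q1"
    unfolding P1_def Q1_def using scong_processes[OF PQ(1)] by (auto simp: pi_process_iff)
  have sim: "scong_sim P1 Q1" unfolding P1_def Q1_def using PQ(2) by (rule scong_sim_swap)
  have "d \<notin> names l" using d by simp
  with st[unfolded eqs] wf(1) show "\<exists>Y. loc c Q \<midarrow>l\<rightarrow> Y \<and> scong X Y"
    unfolding eqs
  proof (cases rule: loc_stepE)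
    case (res P')
    from sim res(1) obtain Q' where "Q1 \<midarrow>l\<rightarrow> Q'" "scong P' Q'" by (rule scong_simE)
    then show "\<exists>Y. loc d Q1 \<midarrow>l\<rightarrow> Y \<and> scong X Y"
      using loc_step_res[OF wf(2)] d res(2) scong.loc by blast
  next
    case (extrude a c')
    from scong_sim_swap[OF sim] extrude(6) obtain Q'
      where Q': "swap d c' Q1 \<midarrow>Lab (Out a c')\<rightarrow> Q'" "scong X Q'" by (rule scong_simE)
    have "loc d Q1 \<midarrow>Lab (BOut a c')\<rightarrow> Q'"
      using wf(2) Q'(1) by (rule loc_step_extrude_rename) (use extrude gn1 in auto)
    then show "\<exists>Y. loc d Q1 \<midarrow>l\<rightarrow> Y \<and> scong X Y" using Q'(2) extrude(1) by blast
  qed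
qed

lemma scong_sim_comm:
  assumes "pi_process P" "pi_process Q"
  shows "scong_sim (Par P Q) (Par Q P)"
proof (rule scong_sim_actionI)
  have cm: "scong (Par P' Q') (Par Q' P')" if "P \<midarrow>l1\<rightarrow> P' \<or> P = P'" "Q \<midarrow>l2\<rightarrow> Q' \<or> Q = Q'" for P' Q' l1 l2
    using assms that step_pi_process scong.comm by metis
  show "\<exists>Y. Par Q P \<midarrow>Lab l\<rightarrow> Y \<and> scong X Y" if "Par P Q \<midarrow>Lab l\<rightarrow> X" for l X
    using that by (cases rule: step_Par_labE) (use cm step_Par_labI1 step_Par_labI2 in metis)+
  fix X assume st: "Par P Q \<midarrow>Tau\<rightarrow> X"
  obtain c where "c \<notin> gn P \<union> gn Q" by (erule fresh_name) simp
  then have c: "c \<notin> gn P" "c \<notin> gn Q" by auto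
  from st c show "\<exists>Y. Par Q P \<midarrow>Tau\<rightarrow> Y \<and> scong X Y"
  proof (cases rule: step_Par_tau_syncE)
    case (sync l l' f P' Q')
    have "Par Q P \<midarrow>Tau\<rightarrow> f (Par Q' P')" using sync_sym[OF sync(1)] sync(3,2) c(2,1) by (rule step_Par_sync)
    then show ?thesis unfolding sync(4) using cm sync(2,3) sync_scong[OF sync(1)] by blast
  qed (use cm step_Par_tauI1 step_Par_tauI2 in metis)+
qed

lemma scong_sim_zero: "pi_process P \<Longrightarrow> scong_sim (Par P Zero) P"
proof
  fix l X assume P: "pi_process P" and st: "Par P Zero \<midarrow>l\<rightarrow> X"
  from st obtain P' where "P \<midarrow>l\<rightarrow> P'" "X = Par P' Zero" by (auto elim: step.cases)
  then show "\<exists>Y. P \<midarrow>l\<rightarrow> Y \<and> scong X Y" using P step_pi_process scong.zero by blast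
qed

lemma scong_sim_zero': "pi_process P \<Longrightarrow> scong_sim P (Par P Zero)"
proof
  fix l X assume P: "pi_process P" and st: "P \<midarrow>l\<rightarrow> X"
  then have "Par P Zero \<midarrow>l\<rightarrow> Par X Zero" by (auto intro: step.par_l)
  then show "\<exists>Y. Par P Zero \<midarrow>l\<rightarrow> Y \<and> scong X Y" using P st step_pi_process scong.zero' by blast
qed

lemma scong_sim_assoc:
  assumes "pi_process P" "pi_process Q" "pi_process R"
  shows "scong_sim (Par (Par P Q) R) (Par P (Par Q R))"
proof (rule scong_sim_actionI)
  have ac: "scong (Par (Par P' Q') R') (Par P' (Par Q' R'))"
    if "P \<midarrow>l1\<rightarrow> P' \<or> P = P'" "Q \<midarrow>l2\<rightarrow> Q' \<or> Q = Q'" "R \<midarrow>l3\<rightarrow> R' \<or> R = R'" for P' Q' R' l1 l2 l3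
    using assms that step_pi_process scong.assoc by metis
  {
    fix l X assume "Par (Par P Q) R \<midarrow>Lab l\<rightarrow> X"
    then show "\<exists>Y. Par P (Par Q R) \<midarrow>Lab l\<rightarrow> Y \<and> scong X Y"
    proof (cases rule: step_Par_labE)
      case (left PQ')
      from left(1) show ?thesis
      proof (cases rule: step_Par_labE)
        case left1: (left P')
        have "Par P (Par Q R) \<midarrow>Lab l\<rightarrow> Par P' (Par Q R)"
          using left1 left by (intro step_Par_labI1) auto
        then show ?thesis using left left1 ac by blast
      next
        case right1: (right Q')
        have "Par P (Par Q R) \<midarrow>Lab l\<rightarrow> Par P (Par Q' R)"
          using right1 left by (intro step_Par_labI1 step_Par_labI2) auto
        then show ?thesis using left right1 ac by blast
      qed
    next
      case (right R')
      have "Par P (Par Q R) \<midarrow>Lab l\<rightarrow> Par P (Par Q R')"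
        using right by (intro step_Par_labI2) auto
      then show ?thesis using right ac by blast
    qed
  }
  fix X assume st: "Par (Par P Q) R \<midarrow>Tau\<rightarrow> X"
  obtain c where "c \<notin> gn P \<union> gn Q \<union> gn R" by (erule fresh_name) simp
  then have c: "c \<notin> gn (Par P Q)" "c \<notin> gn R" "c \<notin> gn P" "c \<notin> gn Q" "c \<notin> gn (Par Q R)" by auto
  from st c(1,2) show "\<exists>Y. Par P (Par Q R) \<midarrow>Tau\<rightarrow> Y \<and> scong X Y"
  proof (cases rule: step_Par_tau_syncE)
    case (left PQ')
    from left(1) c(3,4) show ?thesis
    proof (cases rule: step_Par_tau_syncE)
      case left1: (left P')
      then show ?thesis using left ac step_Par_tauI1 by blast
    next
      case right1: (right Q')
      then show ?thesis using left ac step_Par_tauI1 step_Par_tauI2 by blast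
    next
      case (sync l l' f P' Q')
      have pr: "pi_process P'" "pi_process Q'" using sync assms step_pi_process by blast+
      have "Par P (Par Q R) \<midarrow>Tau\<rightarrow> f (Par P' (Par Q' R))"
        using sync_bn[OF sync(1)] c sync(3) by (intro step_Par_sync[OF sync(1,2)] step_Par_labI1) auto
      moreover have "scong X (f (Par (Par P' Q') R))"
        unfolding left(2) sync(4) using assms pr c by (intro sync_scong_Par(2)[OF sync(1)]) auto
      moreover have "scong (f (Par (Par P' Q') R)) (f (Par P' (Par Q' R)))"
        using assms pr by (intro sync_scong[OF sync(1)] scong.assoc)
      ultimately show ?thesis using scong.trans by blast
    qed
  next
    case (right R')
    then show ?thesis using ac step_Par_tauI2 by blast
  next
    case (sync l l' f PQ' R')
    note bn = sync_bn[OF sync(1)]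
    from sync(2) show ?thesis
    proof (cases rule: step_Par_labE)
      case (left P')
      have "Par P (Par Q R) \<midarrow>Tau\<rightarrow> f (Par P' (Par Q R'))"
        using bn c sync(3) left by (intro step_Par_sync[OF sync(1)] step_Par_labI2) auto
      then show ?thesis unfolding sync(4) left(2) using sync left ac sync_scong[OF sync(1)] by blast
    next
      case (right Q')
      have pr: "pi_process Q'" "pi_process R'" using right sync assms step_pi_process by blast+
      have "Par P (Par Q R) \<midarrow>Tau\<rightarrow> Par P (f (Par Q' R'))"
        using c sync(3) right by (intro step_Par_tauI2 step_Par_sync[OF sync(1)]) auto
      moreover have "scong X (f (Par P (Par Q' R')))"
        unfolding sync(4) right(2) using assms pr by (intro sync_scong[OF sync(1)] scong.assoc)
      moreover have "scong (f (Par P (Par Q' R'))) (Par P (f (Par Q' R')))"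
        using assms pr c by (intro sync_scong_Par(1)[OF sync(1)]) auto
      ultimately show ?thesis using scong.trans by blast
    qed
  qed
qed

text \<open>The delicate case is a communication between \<open>P\<close> and \<open>Q\<close> that
  involves \<open>c\<close>. As \<open>c\<close> is not global in \<open>P\<close>, it can only be
  received by \<open>P\<close> from a free output of \<open>Q\<close>. With the narrow scope,
  \<open>Q\<close> extrudes \<open>c\<close>, and the \<open>close\<close> rule localizes it again
  around both.\<close>

lemma step_ext:
  assumes pr: "pi_process P" "pi_process Q" and c: "c \<notin> gn P" "c \<notin> names l"
    and st: "loc c (Par P Q) \<midarrow>l\<rightarrow> X"
  shows "\<exists>Y. Par P (loc c Q) \<midarrow>l\<rightarrow> Y \<and> scong X Y"
proof -
  let ?A = "\<lambda>l X. \<exists>Y. Par P (loc c Q) \<midarrow>l\<rightarrow> Y \<and> scong X Y"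
  have wf: "wft 0 P" "wft 0 Q" "wft 0 (Par P Q)" using pr by (auto simp: pi_process_iff)
  have gnP': "c \<notin> gn P'" if "P \<midarrow>l'\<rightarrow> P'" "c \<notin> names l'" for P' l'
    using step_gn[OF that(1)] that(2) c(1) by auto
  have ext: "scong (loc c (Par P' Q')) (Par P' (loc c Q'))"
    if "P \<midarrow>l1\<rightarrow> P' \<or> P = P'" "Q \<midarrow>l2\<rightarrow> Q' \<or> Q = Q'" "c \<notin> gn P'" for P' Q' l1 l2
    using pr that step_pi_process scong.ext by metis
  from st wf(3) c(2) show ?thesis
  proof (cases rule: loc_stepE)
    case (extrude a c')
    have "Par P (swap c c' Q) \<midarrow>Lab (Out a c')\<rightarrow> X"
      using extrude(6) swap_fresh[of c P c'] extrude(2) c by simp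
    then show ?thesis
    proof (cases rule: step_Par_labE)
      case (left P')
      then show ?thesis using step_Out_gn[OF left(1)] extrude(2) by simp
    next
      case (right Q')
      have "loc c Q \<midarrow>Lab (BOut a c')\<rightarrow> Q'"
        using wf(2) right(1) by (rule loc_step_extrude_rename) (use extrude in auto)
      then have "Par P (loc c Q) \<midarrow>Lab (BOut a c')\<rightarrow> Par P Q'"
        using extrude(2) by (intro step_Par_labI2) auto
      moreover have "scong X X"
        using step_pi_process[OF st] pr pi_process_loc by (intro scong.refl) auto
      ultimately show ?thesis unfolding extrude(1) right(2) by blast
    qed
  next
    case (res T')
    show ?thesis
    proof (cases l)
      case (Lab lb)
      from res(1)[unfolded Lab] show ?thesis unfolding Lab res(2)
      proof (cases rule: step_Par_labE)
        case (left P')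
        then have "Par P (loc c Q) \<midarrow>Lab lb\<rightarrow> Par P' (loc c Q)" by (intro step_Par_labI1) auto
        then show "?A (Lab lb) (loc c T')" using left ext gnP' c Lab by blast
      next
        case (right Q')
        then have "Par P (loc c Q) \<midarrow>Lab lb\<rightarrow> Par P (loc c Q')"
          using c Lab wf by (intro step_Par_labI2 loc_step_res) auto
        then show "?A (Lab lb) (loc c T')" using right ext c by blast
      qed
    next
      case Tau
      obtain e where e: "e \<notin> insert c (gn P \<union> gn Q)" by (erule fresh_name) simp
      then have e': "e \<notin> gn P" "e \<notin> gn Q" "e \<noteq> c" by auto
      have subjP: "subj lb \<noteq> c" if "P \<midarrow>Lab lb\<rightarrow> P'" for lb P'
        using step_subj[OF that] c by auto
      from res(1)[unfolded Tau] e'(1,2) show ?thesis unfolding Tau res(2)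
      proof (cases rule: step_Par_tau_syncE)
        case (left P')
        then have "Par P (loc c Q) \<midarrow>Tau\<rightarrow> Par P' (loc c Q)" by (intro step_Par_tauI1)
        then show "?A Tau (loc c T')" using left ext[of Tau P' Tau Q] gnP'[of Tau] by auto
      next
        case (right Q')
        then have "Par P (loc c Q) \<midarrow>Tau\<rightarrow> Par P (loc c Q')"
          using wf by (intro step_Par_tauI2 loc_step_res) auto
        then show "?A Tau (loc c T')" using right ext c by blast
      next
        case (sync l1 l2 f P' Q')
        have pr': "pi_process P'" "pi_process Q'" using sync pr step_pi_process by blast+
        show "?A Tau (loc c T')"
        proof (cases "c \<in> names_label l1")
          case False
          have "loc c Q \<midarrow>Lab l2\<rightarrow> loc c Q'"
            using wf sync False sync_names[OF sync(1)] by (intro loc_step_res) auto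
          then have "Par P (loc c Q) \<midarrow>Tau\<rightarrow> f (Par P' (loc c Q'))"
            using e' by (intro step_Par_sync[OF sync(1,2)]) auto
          moreover have "scong (f (loc c (Par P' Q'))) (f (Par P' (loc c Q')))"
            using ext[of "Lab l1" P' "Lab l2" Q'] sync gnP'[OF sync(2)] False
            by (intro sync_scong[OF sync(1)]) auto
          moreover have "scong (loc c T') (f (loc c (Par P' Q')))"
            unfolding sync(4) using pr' by (intro sync_scong_loc[OF sync(1)]) auto
          ultimately show ?thesis using scong.trans by blast
        next
          case True
          \<comment> \<open>As a subject, or as an object sent by \<open>P\<close>, the name
            \<open>c\<close> would be global in \<open>P\<close>; the bound name of a
            synchronization is \<open>e\<close>, not \<open>c\<close>. Only the reception of
            \<open>c\<close> is left.\<close>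
          have "subj l1 \<noteq> c" using subjP[OF sync(2)] .
          moreover have "\<nexists>a. l1 = Out a c" using step_Out_gn[of P _ c P'] sync(2) c by auto
          ultimately obtain a where l: "l1 = In a c" "l2 = Out a c" "a \<noteq> c" "f = (\<lambda>T. T)"
            using sync(1) True e'(3) by (auto elim!: sync.cases)
          have "loc c Q \<midarrow>Lab (BOut a c)\<rightarrow> Q'" using wf sync l by (intro loc_step_extrude) auto
          then have "Par P (loc c Q) \<midarrow>Tau\<rightarrow> loc c (Par P' Q')"
            using sync l c by (intro step.close_r) auto
          moreover have "scong (loc c T') (loc c (Par P' Q'))"
            using sync(4) l pr' scong.refl[OF pi_process_loc, of "Par P' Q'" c] by simp
          ultimately show ?thesis by blast
        qed
      qed
    qed
  qed
qed

text \<open>The reverse analysis: if \<open>loc c Q\<close> extrudes \<open>c\<close> under a fresh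
  name \<open>e\<close> to a receiving \<open>P\<close>, then transposing \<open>c\<close> and
  \<open>e\<close> turns this into a free communication of \<open>c\<close> within the wide
  scope.\<close>

lemma step_ext':
  assumes pr: "pi_process P" "pi_process Q" and c: "c \<notin> gn P" "c \<notin> names l"
    and st: "Par P (loc c Q) \<midarrow>l\<rightarrow> X"
  shows "\<exists>Y. loc c (Par P Q) \<midarrow>l\<rightarrow> Y \<and> scong X Y"
proof -
  let ?A = "\<lambda>l X. \<exists>Y. loc c (Par P Q) \<midarrow>l\<rightarrow> Y \<and> scong X Y"
  have wf: "wft 0 P" "wft 0 Q" "wft 0 (Par P Q)" using pr by (auto simp: pi_process_iff)
  have gnP': "c \<notin> gn P'" if "P \<midarrow>l'\<rightarrow> P'" "c \<notin> names l'" for P' l'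
    using step_gn[OF that(1)] that(2) c(1) by auto
  have ext: "scong (Par P' (loc c Q')) (loc c (Par P' Q'))"
    if "P \<midarrow>l1\<rightarrow> P' \<or> P = P'" "Q \<midarrow>l2\<rightarrow> Q' \<or> Q = Q'" "c \<notin> gn P'" for P' Q' l1 l2
    using pr that step_pi_process scong.ext' by metis
  have prX: "pi_process X" using step_pi_process[OF st] pr pi_process_loc by auto
  have subjP: "subj lb \<noteq> c" if "P \<midarrow>Lab lb\<rightarrow> P'" for lb P'
    using step_subj[OF that] c by auto
  show ?thesis
  proof (cases l)
    case (Lab lb)
    from st[unfolded Lab] show ?thesis unfolding Lab
    proof (cases rule: step_Par_labE)
      case (left P')
      have "bn_label lb \<inter> gn Q = {}" using left(3) c(2) bn_names[of l] Lab by auto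
      then have "loc c (Par P Q) \<midarrow>Lab lb\<rightarrow> loc c (Par P' Q)"
        using left c Lab wf by (intro loc_step_res step_Par_labI1) auto
      then show "?A (Lab lb) X" using left ext gnP' c Lab by blast
    next
      case (right Z)
      from right(1) wf(2) c(2)[unfolded Lab] show "?A (Lab lb) X"
      proof (cases rule: loc_stepE)
        case (res Q')
        then have "loc c (Par P Q) \<midarrow>Lab lb\<rightarrow> loc c (Par P Q')"
          using c Lab wf right by (intro loc_step_res step_Par_labI2) auto
        then show ?thesis using right res ext c by blast
      next
        case (extrude a c')
        have c': "c' \<notin> gn P" using right(3) extrude(1) by auto
        have "swap c c' (Par P Q) \<midarrow>Lab (Out a c')\<rightarrow> Par P Z"
          using extrude(6) swap_fresh[of c P c'] c c' by (auto intro: step_Par_labI2)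
        with wf(3) have "loc c (Par P Q) \<midarrow>Lab (BOut a c')\<rightarrow> Par P Z"
          by (rule loc_step_extrude_rename) (use extrude c' in auto)
        then show ?thesis using right(2) extrude(1) scong.refl prX by auto
      qed
    qed
  next
    case Tau
    obtain e where e: "e \<notin> insert c (gn P \<union> gn Q)" by (erule fresh_name) simp
    then have e': "e \<notin> gn P" "e \<notin> gn (loc c Q)" "e \<noteq> c" "e \<notin> gn Q" by auto
    from st[unfolded Tau] e'(1,2) show ?thesis unfolding Tau
    proof (cases rule: step_Par_tau_syncE)
      case (left P')
      then have "loc c (Par P Q) \<midarrow>Tau\<rightarrow> loc c (Par P' Q)"
        using wf by (intro loc_step_res step_Par_tauI1) auto
      then show "?A Tau X" using left ext[of Tau P' Tau Q] gnP'[of Tau] by auto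
    next
      case (right Z)
      from right(1) wf(2) obtain Q' where "Q \<midarrow>Tau\<rightarrow> Q'" "Z = loc c Q'"
        by (rule loc_stepE) auto
      moreover from this have "loc c (Par P Q) \<midarrow>Tau\<rightarrow> loc c (Par P Q')"
        using wf by (intro loc_step_res step_Par_tauI2) auto
      ultimately show "?A Tau X" using right ext c by blast
    next
      case (sync l1 l2 f P' Z)
      have cl: "c \<notin> names_label l1" "c \<notin> names (Lab l2)"
      proof -
        have "subj l1 \<noteq> c" using subjP[OF sync(2)] .
        moreover have "\<nexists>a. l1 = Out a c" "\<nexists>a. l2 = Out a c"
          using step_Out_gn[of P _ c P'] step_Out_gn[of "loc c Q" _ c Z] sync(2,3) c by auto
        ultimately show "c \<notin> names_label l1" using sync(1) e'(3) by (auto elim!: sync.cases)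
        then show "c \<notin> names (Lab l2)" using sync_names[OF sync(1)] by simp
      qed
      from sync(3) wf(2) cl(2) show "?A Tau X"
      proof (cases rule: loc_stepE)
        case (res Q')
        have pr': "pi_process P'" "pi_process Q'" using sync(2) res(1) pr step_pi_process by blast+
        have "loc c (Par P Q) \<midarrow>Tau\<rightarrow> loc c (f (Par P' Q'))"
          using wf res(1) e' by (intro loc_step_res step_Par_sync[OF sync(1,2)]) auto
        moreover have "scong X (f (loc c (Par P' Q')))"
          unfolding sync(4) res(2) using ext[of "Lab l1" P' "Lab l2" Q'] sync res gnP'[OF sync(2)] cl
          by (intro sync_scong[OF sync(1)]) auto
        moreover have "scong (f (loc c (Par P' Q'))) (loc c (f (Par P' Q')))"
          using pr' by (intro scong_sym[OF sync_scong_loc[OF sync(1)]]) auto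
        ultimately show ?thesis using scong.trans by blast
      next
        case (extrude a c')
        have l: "l1 = In a e \<and> c' = e \<and> f = loc e" using sync(1) extrude(1) by (auto elim: sync.cases)
        have tr: "transpose c e a = a" using extrude l by (auto simp: transpose_def)
        have Q: "Q \<midarrow>Lab (Out a c)\<rightarrow> swap c e Z"
          using step_swap[OF extrude(6), of c e] tr by (simp add: l)
        have P: "P \<midarrow>Lab (In a c)\<rightarrow> swap c e P'"
          using step_swap[OF sync(2), of c e] tr swap_fresh[of c P e] c e' by (simp add: l)
        have "loc c (Par P Q) \<midarrow>Tau\<rightarrow> loc c (Par (swap c e P') (swap c e Z))"
          using wf P Q by (intro loc_step_res step.com_r) auto
        \<comment> \<open>The \<open>close\<close> step has localized \<open>e\<close>; converting
          it to \<open>c\<close> yields the localization of the wide scope.\<close>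
        moreover have "c \<notin> gn (Par P' Z) - {e}"
          using gnP'[OF sync(2)] cl step_gn[OF extrude(6)] extrude e' by (auto simp: l)
        then have "X = loc c (Par (swap c e P') (swap c e Z))"
          using loc_swap[of c "Par P' Z" e] sync(4) by (simp add: swap_commute l)
        ultimately show ?thesis using scong.refl prX by metis
      qed
    qed
  qed
qed

text \<open>\<open>step_ext\<close> and \<open>step_ext'\<close> keep \<open>c\<close> out of the
  action; alpha-conversion of the localized name lifts this restriction.\<close>

lemma scong_sim_ext:
  assumes "pi_process P" "pi_process Q" "c \<notin> gn P"
  shows "scong_sim (loc c (Par P Q)) (Par P (loc c Q))" "scong_sim (Par P (loc c Q)) (loc c (Par P Q))"
proof -
  have eqs: "\<exists>d. d \<notin> names l \<and> d \<notin> gn P \<and> loc c (Par P Q) = loc d (Par P (swap c d Q)) \<and>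
      loc c Q = loc d (swap c d Q)" for l
  proof -
    obtain d where d: "d \<notin> names l \<union> gn P \<union> gn Q" by (erule fresh_name) simp
    then have "loc c (Par P Q) = loc d (Par P (swap c d Q))" "loc c Q = loc d (swap c d Q)"
      using loc_swap[of d "Par P Q" c] loc_swap[of d Q c] swap_fresh[of c P d] assms by auto
    then show ?thesis using d by blast
  qed
  show "scong_sim (loc c (Par P Q)) (Par P (loc c Q))"
    using eqs step_ext[OF assms(1)] assms(2) by (intro scong_simI) (metis pi_process_simps(3))
  show "scong_sim (Par P (loc c Q)) (loc c (Par P Q))"
    using eqs step_ext'[OF assms(1)] assms(2) by (intro scong_simI) (metis pi_process_simps(3))
qed

text \<open>A label extrudes at most one of the two names. If one leaves, one layer is passed by
  \<open>extrude\<close> and the other by \<open>res\<close>; the same two rules are then used in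
  the opposite order.\<close>

lemma scong_sim_exchange_fresh:
  assumes pr: "pi_process P" and cd: "c \<noteq> d" "c \<notin> names l" "d \<notin> names l"
    and st: "loc c (loc d P) \<midarrow>l\<rightarrow> X"
  shows "\<exists>Y. loc d (loc c P) \<midarrow>l\<rightarrow> Y \<and> scong X Y"
proof -
  have wf: "wft 0 P" "wft 0 (loc d P)" "wft 0 (loc c P)" using pr by (auto simp: pi_process_iff wft_loc)
  have prX: "pi_process X" using step_pi_process[OF st] pr pi_process_loc by auto
  from st wf(2) cd(2) show ?thesis
  proof (cases rule: loc_stepE)
    case (res Z)
    from res(1) wf(1) cd(3) show ?thesis
    proof (cases rule: loc_stepE)
      case res1: (res P')
      then have "loc d (loc c P) \<midarrow>l\<rightarrow> loc d (loc c P')" using wf cd by (intro loc_step_res) auto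
      then show ?thesis using res res1 scong.exchange step_pi_process pr by blast
    next
      case (extrude a c')
      have "loc c (swap d c' P) \<midarrow>Lab (Out a c')\<rightarrow> X"
        unfolding res(2) using extrude cd wf by (intro loc_step_res) auto
      then have "swap d c' (loc c P) \<midarrow>Lab (Out a c')\<rightarrow> X"
        using extrude cd by (auto simp: swap_loc transpose_def)
      with wf(3) have "loc d (loc c P) \<midarrow>l\<rightarrow> X"
        unfolding extrude(1) by (rule loc_step_extrude_rename) (use extrude in auto)
      then show ?thesis using scong.refl prX by blast
    qed
  next
    case (extrude a c')
    have dc': "c' \<noteq> d" "a \<noteq> d" using cd(3) extrude(1) by auto
    have "loc d (swap c c' P) \<midarrow>Lab (Out a c')\<rightarrow> X"
      using extrude(6) dc' cd by (auto simp: swap_loc transpose_def)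
    then obtain P' where P': "swap c c' P \<midarrow>Lab (Out a c')\<rightarrow> P'" "X = loc d P'"
      by (rule loc_stepE) (use wf dc' in auto)
    have "loc c P \<midarrow>Lab (BOut a c')\<rightarrow> P'"
      using wf(1) P'(1) by (rule loc_step_extrude_rename) (use extrude dc' in auto)
    then have "loc d (loc c P) \<midarrow>Lab (BOut a c')\<rightarrow> X"
      unfolding P'(2) using wf dc' by (intro loc_step_res) auto
    then show ?thesis using extrude(1) scong.refl prX by blast
  qed
qed

lemma scong_sim_exchange:
  assumes "pi_process P"
  shows "scong_sim (loc c (loc d P)) (loc d (loc c P))"
proof
  fix l X assume st: "loc c (loc d P) \<midarrow>l\<rightarrow> X"
  show "\<exists>Y. loc d (loc c P) \<midarrow>l\<rightarrow> Y \<and> scong X Y"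
  proof (cases "c = d")
    case True
    then show ?thesis using st assms scong.refl step_pi_process pi_process_loc by blast
  next
    case False
    obtain c' where c': "c' \<notin> insert c (insert d (names l \<union> gn P))" by (erule fresh_name) simp
    obtain d' where d': "d' \<notin> insert c (insert d (insert c' (names l \<union> gn P)))" by (erule fresh_name) simp
    define P1 where "P1 = swap c c' (swap d d' P)"
    have tr: "transpose c c' d' = d'" "transpose c c' d = d" "transpose d d' c = c" "transpose d d' c' = c'"
      using c' d' False by (auto simp: transpose_def)
    have "loc c (loc d P) = loc c (loc d' (swap d d' P))"
      using loc_swap[of d' P d] d' by simp
    also have "\<dots> = loc c' (loc d' P1)"
      using loc_swap[of c' "loc d' (swap d d' P)" c] c' d' tr by (simp add: swap_loc P1_def)
    finally have eq1: "loc c (loc d P) = loc c' (loc d' P1)" .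
    have "loc d (loc c P) = loc d' (loc c (swap d d' P))"
      using loc_swap[of d' "loc c P" d] d' tr by (simp add: swap_loc)
    also have "loc c (swap d d' P) = loc c' P1"
      using loc_swap[of c' "swap d d' P" c] c' tr by (simp add: P1_def)
    finally have eq2: "loc d (loc c P) = loc d' (loc c' P1)" .
    have "pi_process P1" using assms by (simp add: P1_def)
    from scong_sim_exchange_fresh[OF this _ _ _ st[unfolded eq1]] show ?thesis
      unfolding eq2 using c' d' by auto
  qed
qed

lemma scong_simulation: "scong P Q \<Longrightarrow> scong_sim P Q"
proof (induction rule: scong.induct)
  case (refl P)
  then show ?case using scong.refl step_pi_process by (auto simp: scong_sim_def)
next
  case (trans P Q R)
  then show ?case unfolding scong_sim_def by (meson scong.trans)
qed (simp_all add: scong_sim_par scong_sim_loc scong_sim_comm scong_sim_assoc scong_sim_zero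
    scong_sim_zero' scong_sim_ext scong_sim_exchange)

lemma scong_pi_bisimilar: "scong P Q \<Longrightarrow> P \<simeq>\<^sub>\<pi> Q"
proof -
  have "strong_simulation scong"
    unfolding strong_simulation_def using scong_simulation scong_sym
    by (meson scong_simE)
  then have "pi_bisimulation scong"
    by (intro strong_simulation_pi_bisimulation)
       (auto simp: symp_def on_processes_def scong_sym scong_processes)
  then show "scong P Q \<Longrightarrow> P \<simeq>\<^sub>\<pi> Q" by (auto simp: pi_bisimilar_def)
qed

section \<open>Absolute equality\<close>

text \<open>\<open>P\<close> first follows the preparatory steps of the middle process and then
  answers its last step. The state of \<open>P\<close> just before that step is related to
  \<open>M''\<close>, and \<open>M''\<close> to \<open>Q\<close>, as the clause demands.\<close>

lemma bisimulation_half_OO: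
  assumes R: "bisimulation_half R" and S: "bisimulation_half S"
  shows "bisimulation_half (R OO S)"
  unfolding bisimulation_half_def
proof (intro allI impI, elim conjE)
  fix P Q Q' assume "(R OO S) P Q" and tau: "tau Q Q'"
  then obtain M where M: "R P M" "S M Q" by blast
  from S M(2) tau consider
      (idle) M' where "taus M M'" "S M' Q" "S M' Q'"
    | (move) M'' M' where "taus M M''" "tau M'' M'" "S M'' Q" "S M' Q'"
    unfolding bisimulation_half_def by blast
  then show "(\<exists>P'. taus P P' \<and> (R OO S) P' Q \<and> (R OO S) P' Q') \<or>
        (\<exists>P'' P'. taus P P'' \<and> tau P'' P' \<and> (R OO S) P'' Q \<and> (R OO S) P' Q')"
  proof cases
    case idle
    obtain P' where "taus P P'" "R P' M'" using bisimulation_half_taus[OF R M(1) idle(1)] .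
    then show ?thesis using idle by blast
  next
    case move
    obtain P1 where P1: "taus P P1" "R P1 M''" using bisimulation_half_taus[OF R M(1) move(1)] .
    from R P1(2) move(2) consider
        P' where "taus P1 P'" "R P' M''" "R P' M'"
      | P'' P' where "taus P1 P''" "tau P'' P'" "R P'' M''" "R P' M'"
      unfolding bisimulation_half_def by blast
    then show ?thesis
    proof cases
      case 1
      then show ?thesis using P1 move rtranclp_trans[OF P1(1) 1(1)] by blast
    next
      case 2
      then show ?thesis using P1 move rtranclp_trans[OF P1(1) 2(1)] by blast
    qed
  qed
qed

text \<open>A codivergence clause answers a single point of a run, so a divergence of the middle
  process has to be assembled first. Iterating the clause for \<open>S\<close> yields an infinite
  run of \<open>M\<close>, each state of which can still reach a partner of some \<open>q n\<close>.
  The clause for \<open>R\<close> answers this run, and its bisimulation property follows the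
  remaining steps to that partner.\<close>

lemma codivergent_half_OO:
  assumes R: "codivergent_half R" "bisimulation_half R" and S: "codivergent_half S"
  shows "codivergent_half (R OO S)"
  unfolding codivergent_half_def
proof (intro allI impI, elim conjE)
  fix P q assume "(R OO S) P (q 0)" and q: "\<forall>i. tau (q i) (q (Suc i))"
  then obtain M where M: "R P M" "S M (q 0)" by blast
  \<comment> \<open>The demand \<open>n \<ge> 1\<close> from the first step on ensures that the
    partner finally reached lies strictly after \<open>q 0\<close>.\<close>
  define good where "good = (\<lambda>(i::nat) T. \<exists>n T'. (i \<ge> 1 \<longrightarrow> n \<ge> 1) \<and> taus T T' \<and> S T' (q n))"
  have "\<exists>T'. good (Suc i) T' \<and> tau T T'" if "good i T" for i T
  proof -
    from that obtain n T' where T': "taus T T'" "S T' (q n)" by (auto simp: good_def)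
    have "S T' ((\<lambda>i. q (n + i)) 0) \<and> (\<forall>i. tau ((\<lambda>i. q (n + i)) i) ((\<lambda>i. q (n + i)) (Suc i)))"
      using T'(2) q by simp
    then obtain k T'' where T'': "k \<ge> 1" "tau_weak T' T''" "S T'' (q (n + k))"
      using S[unfolded codivergent_half_def, rule_format, of T' "\<lambda>i. q (n + i)"] by blast
    then obtain T1 where "tau T T1" "taus T1 T''"
      using tau_weak_trans1[OF T'(1) T''(2)] by (auto simp: tau_weak_eq)
    then show ?thesis using T''(1,3) unfolding good_def by (meson le_add2 order_trans)
  qed
  moreover have "good 0 M" using M(2) by (auto simp: good_def)
  ultimately obtain s where s: "s 0 = M" "\<And>i. good i (s i)" "\<And>i. tau (s i) (s (Suc i))"
    using dependent_nat_choice[of "\<lambda>i T. good i T \<and> (i = 0 \<longrightarrow> T = M)" "\<lambda>i T T'. tau T T'"]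
    by (metis nat.distinct(1))
  then obtain k P' where k: "k \<ge> 1" "tau_weak P P'" "R P' (s k)"
    using R(1) M(1) unfolding codivergent_half_def by blast
  obtain n T' where n: "n \<ge> 1" "taus (s k) T'" "S T' (q n)"
    using s(2)[of k] k(1) by (auto simp: good_def)
  obtain P'' where "taus P' P''" "R P'' T'" using bisimulation_half_taus[OF R(2) k(3) n(2)] .
  then show "\<exists>k\<ge>1. \<exists>P'. tau_weak P P' \<and> (R OO S) P' (q k)"
    using n tau_weak_trans2[OF k(2)] by blast
qed

lemma observable_swap: "observable P \<Longrightarrow> observable (swap a b P)"
  unfolding observable_def using taus_swap step_swap by (metis swap_action.simps(1))

lemma absolute_conversep: "absolute R \<Longrightarrow> absolute R\<inverse>\<inverse>"
  by (auto simp: absolute_def on_processes_def reflexive_def equipollent_def extensional_def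
      codivergent_def bisimulation_def)

lemma absolute_OO:
  assumes "absolute R" "absolute S" shows "absolute (R OO S)"
proof -
  have "codivergent (R OO S)" "bisimulation (R OO S)"
    using assms by (auto simp: absolute_def codivergent_def bisimulation_def converse_relcompp
        intro: codivergent_half_OO bisimulation_half_OO)
  moreover have "extensional (R OO S)"
    using assms unfolding absolute_def extensional_def by blast
  moreover have "on_processes (R OO S)" "reflexive (R OO S)" "equipollent (R OO S)"
    using assms unfolding absolute_def on_processes_def reflexive_def equipollent_def by blast+
  ultimately show ?thesis by (simp add: absolute_def)
qed

lemma absolute_swap:
  assumes "absolute R" shows "absolute (swap_rel a b R)"
proof -
  have "codivergent (swap_rel a b R)" "bisimulation (swap_rel a b R)"
    using assms by (auto simp: absolute_def codivergent_def bisimulation_def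
        intro: codivergent_half_swap bisimulation_half_swap simp flip: swap_rel_conversep)
  moreover have "extensional (swap_rel a b R)"
    using assms by (simp add: absolute_def extensional_def swap_rel_def swap_loc)
  moreover have "equipollent (swap_rel a b R)"
    using assms observable_swap unfolding absolute_def equipollent_def swap_rel_def
    by (metis swap_involutive)
  ultimately show ?thesis
    using assms on_processes_swap by (auto simp: absolute_def reflexive_def swap_rel_def)
qed

lemma absolute_le: "absolute R \<Longrightarrow> R P Q \<Longrightarrow> P =\<^sub>\<pi> Q"
  by (auto simp: abs_eq_def)

lemma abs_eq_processes: "P =\<^sub>\<pi> Q \<Longrightarrow> pi_process P \<and> pi_process Q"
  by (auto simp: abs_eq_def absolute_def on_processes_def)

lemma abs_eq_refl: "pi_process P \<Longrightarrow> P =\<^sub>\<pi> P"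
  using pi_bisimilar_refl pi_bisimilar_abs_eq by blast

lemma abs_eq_sym: "P =\<^sub>\<pi> Q \<Longrightarrow> Q =\<^sub>\<pi> P"
  unfolding abs_eq_def using absolute_conversep by blast

lemma abs_eq_trans [trans]: "P =\<^sub>\<pi> Q \<Longrightarrow> Q =\<^sub>\<pi> R \<Longrightarrow> P =\<^sub>\<pi> R"
  unfolding abs_eq_def using absolute_OO by blast

lemma abs_eq_swap: "P =\<^sub>\<pi> Q \<Longrightarrow> swap a b P =\<^sub>\<pi> swap a b Q"
  unfolding abs_eq_def using absolute_swap by (metis swap_rel_def swap_involutive)

lemma scong_abs_eq: "scong P Q \<Longrightarrow> P =\<^sub>\<pi> Q"
  by (intro pi_bisimilar_abs_eq scong_pi_bisimilar)

lemma abs_eq_loc: "P =\<^sub>\<pi> Q \<Longrightarrow> loc c P =\<^sub>\<pi> loc c Q"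
  unfolding abs_eq_def absolute_def extensional_def by blast

text \<open>The two pairs come from two absolute relations, while extensionality speaks of one.
  Their composition contains both pairs, because each relation is reflexive on processes.\<close>

lemma abs_eq_par:
  assumes "L =\<^sub>\<pi> M" "P =\<^sub>\<pi> Q" shows "Par L P =\<^sub>\<pi> Par M Q"
proof -
  obtain R S where RS: "absolute R" "absolute S" "R L M" "S P Q" using assms by (auto simp: abs_eq_def)
  then have "(R OO S) L M" "(R OO S) P Q"
    using abs_eq_processes[OF assms(1)] abs_eq_processes[OF assms(2)]
    unfolding absolute_def reflexive_def by blast+
  then have "(R OO S) (Par L P) (Par M Q)"
    using absolute_OO[OF RS(1,2)] by (simp add: absolute_def extensional_def)
  then show ?thesis using absolute_OO[OF RS(1,2)] by (auto simp: abs_eq_def)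
qed

lemma abs_eq_observable: "P =\<^sub>\<pi> Q \<Longrightarrow> observable P \<longleftrightarrow> observable Q"
  unfolding abs_eq_def absolute_def equipollent_def by blast

lemma codivergent_abs_eq: "codivergent_half (=\<^sub>\<pi>)"
  and bisimulation_abs_eq: "bisimulation_half (=\<^sub>\<pi>)"
proof -
  have union: "\<exists>R. R P Q \<and> R \<le> (=\<^sub>\<pi>) \<and> absolute R" if "P =\<^sub>\<pi> Q" for P Q
  proof -
    from that obtain R where R: "absolute R" "R P Q" by (auto simp: abs_eq_def)
    have "R \<le> (=\<^sub>\<pi>)" using absolute_le[OF R(1)] by auto
    with R show ?thesis by (intro exI[of _ R] conjI)
  qed
  note union' = union[unfolded absolute_def codivergent_def bisimulation_def]
  show "codivergent_half (=\<^sub>\<pi>)" by (rule codivergent_half_union) (meson union')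
  show "bisimulation_half (=\<^sub>\<pi>)" by (rule bisimulation_half_union) (meson union')
qed

lemma symmetric_absolute:
  assumes "symp R" "on_processes R" "reflexive R" "\<And>P Q. R P Q \<Longrightarrow> observable Q \<Longrightarrow> observable P"
    "extensional R" "codivergent_half R" "bisimulation_half R"
  shows "absolute R"
proof -
  have "equipollent R"
    unfolding equipollent_def by (meson assms(4) sympD[OF assms(1)])
  then show ?thesis
    unfolding absolute_def codivergent_def bisimulation_def symp_conversep_eq[OF assms(1)]
    using assms(2,3,5,6,7) by blast
qed

lemma observable_taus: "taus P P' \<Longrightarrow> observable P' \<Longrightarrow> observable P"
  unfolding observable_def by (meson rtranclp_trans)

text \<open>Mutual weak reachability up to \<open>=\<^sub>\<pi>\<close> is itself an absolute
  relation. A step or divergence of \<open>Q\<close> is answered by first running \<open>P\<close>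
  to a process equal to \<open>Q\<close>; from there the answer is found within
  \<open>=\<^sub>\<pi>\<close>, which the relation contains.\<close>

lemma abs_eq_two_way:
  assumes "taus P P'" "P' =\<^sub>\<pi> Q" "taus Q Q'" "Q' =\<^sub>\<pi> P"
  shows "P =\<^sub>\<pi> Q"
proof -
  define R :: prel where "R = (\<lambda>P Q. (\<exists>P'. taus P P' \<and> P' =\<^sub>\<pi> Q) \<and> (\<exists>Q'. taus Q Q' \<and> Q' =\<^sub>\<pi> P))"
  have sub: "R P Q" if "P =\<^sub>\<pi> Q" for P Q
    using that abs_eq_sym unfolding R_def by blast
  have "absolute R"
  proof (rule symmetric_absolute)
    show "symp R" by (auto simp: R_def symp_def)
    show "on_processes R" unfolding R_def on_processes_def using abs_eq_processes by blast
    show "reflexive R" unfolding reflexive_def using sub abs_eq_refl by blast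
    show "observable P" if "R P Q" "observable Q" for P Q
      using that abs_eq_observable observable_taus unfolding R_def by blast
    have "R (Par L P) (Par M Q)" if "R L M" "R P Q" for L M P Q
      using that abs_eq_par taus_Par unfolding R_def by blast
    moreover have "R (loc c P) (loc c Q)" if "R P Q" for c P Q
    proof -
      have "pi_process P" "pi_process Q" using that abs_eq_processes unfolding R_def by blast+
      then show ?thesis using that abs_eq_loc taus_loc unfolding R_def by blast
    qed
    ultimately show "extensional R" by (simp add: extensional_def)
    show "codivergent_half R"
      unfolding codivergent_half_def
    proof (intro allI impI, elim conjE)
      fix P q assume "R P (q 0)" and q: "\<forall>i. tau (q i) (q (Suc i))"
      then obtain P' where P': "taus P P'" "P' =\<^sub>\<pi> q 0" unfolding R_def by blast
      then obtain k P'' where "k \<ge> 1" "tau_weak P' P''" "P'' =\<^sub>\<pi> q k"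
        using codivergent_abs_eq q unfolding codivergent_half_def by blast
      then show "\<exists>k\<ge>1. \<exists>P'. tau_weak P P' \<and> R P' (q k)"
        using sub tau_weak_trans1[OF P'(1)] by blast
    qed
    show "bisimulation_half R"
      unfolding bisimulation_half_def
    proof (intro allI impI, elim conjE)
      fix P Q Q' assume "R P Q" and tau: "tau Q Q'"
      then obtain P1 where P1: "taus P P1" "P1 =\<^sub>\<pi> Q" unfolding R_def by blast
      then have "(\<exists>P'. taus P1 P' \<and> P' =\<^sub>\<pi> Q \<and> P' =\<^sub>\<pi> Q') \<or>
          (\<exists>P'' P'. taus P1 P'' \<and> tau P'' P' \<and> P'' =\<^sub>\<pi> Q \<and> P' =\<^sub>\<pi> Q')"
        using bisimulation_abs_eq tau unfolding bisimulation_half_def by blast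
      then show "(\<exists>P'. taus P P' \<and> R P' Q \<and> R P' Q') \<or>
          (\<exists>P'' P'. taus P P'' \<and> tau P'' P' \<and> R P'' Q \<and> R P' Q')"
        using sub rtranclp_trans[OF P1(1)] by blast
    qed
  qed
  moreover have "R P Q" using assms unfolding R_def by blast
  ultimately show ?thesis by (auto simp: abs_eq_def)
qed

section \<open>Barbs\<close>

text \<open>Polarity and object are ignored: localizing another name may change the object or turn a
  free output into a bound one, but the subject survives.\<close>

definition can :: "pterm \<Rightarrow> name \<Rightarrow> bool" where
  "can P d \<longleftrightarrow> (\<exists>l P'. P \<midarrow>Lab l\<rightarrow> P' \<and> subj l = d)"

definition barb :: "pterm \<Rightarrow> name \<Rightarrow> bool" where
  "barb P d \<longleftrightarrow> (\<exists>P'. taus P P' \<and> can P' d)"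

lemma subj_swap: "subj (swap_label a b l) = transpose a b (subj l)"
  by (cases l) auto

lemma can_swap: "can (swap a b P) d \<longleftrightarrow> can P (transpose a b d)"
proof -
  have "can (swap a b P) d" if "can P (transpose a b d)" for P d
  proof -
    from that obtain l P' where "P \<midarrow>Lab l\<rightarrow> P'" "subj l = transpose a b d" unfolding can_def by blast
    then have "swap a b P \<midarrow>Lab (swap_label a b l)\<rightarrow> swap a b P'" "subj (swap_label a b l) = d"
      using step_swap by (fastforce simp: subj_swap)+
    then show ?thesis unfolding can_def by blast
  qed
  from this[of P d] this[of "swap a b P" "transpose a b d"] show ?thesis by auto
qed

lemma barb_swap: "barb (swap a b P) d \<longleftrightarrow> barb P (transpose a b d)"
proof -
  have "barb (swap a b P) d" if "barb P (transpose a b d)" for P d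
    using that taus_swap can_swap unfolding barb_def by blast
  from this[of P d] this[of "swap a b P" "transpose a b d"] show ?thesis by auto
qed

lemma can_gn: "can P d \<Longrightarrow> d \<in> gn P"
  using step_subj by (auto simp: can_def)

lemma barb_gn: "barb P d \<Longrightarrow> d \<in> gn P"
  using can_gn taus_gn unfolding barb_def by blast

lemma barb_taus: "taus P P' \<Longrightarrow> barb P' d \<Longrightarrow> barb P d"
  unfolding barb_def by (meson rtranclp_trans)

lemma can_barb: "can P d \<Longrightarrow> barb P d"
  unfolding barb_def by blast

lemma observable_barb: "observable P \<longleftrightarrow> (\<exists>d. barb P d)"
  unfolding observable_def barb_def can_def by blast

text \<open>An action that mentions \<open>c\<close> other than as its subject has a counterpart
  under the localization: an input takes another object, a free output of \<open>c\<close> becomes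
  bound, and a bound output announces another name.\<close>

lemma can_loc:
  assumes "pi_process P"
  shows "can (loc c P) d \<longleftrightarrow> d \<noteq> c \<and> can P d"
proof
  have wf: "wft 0 P" using assms by (simp add: pi_process_iff)
  {
    assume can: "can (loc c P) d"
    then obtain l X where st: "loc c P \<midarrow>Lab l\<rightarrow> X" and d: "subj l = d" by (auto simp: can_def)
    have dc: "d \<noteq> c" using can_gn[OF can] by auto
    obtain e where e: "e \<notin> insert c (names (Lab l) \<union> gn P)" by (erule fresh_name) simp
    have eq: "loc c P = loc e (swap c e P)" using e by (simp add: loc_swap)
    have "wft 0 (swap c e P)" "e \<notin> names (Lab l)" using e wf by auto
    with st[unfolded eq] have "can (swap c e P) d"
    proof (cases rule: loc_stepE)
      case (res T')
      then show ?thesis using d by (auto simp: can_def)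
    next
      case (extrude a c')
      then have "can (swap e c' (swap c e P)) a" unfolding can_def by (metis subj.simps(2))
      then show ?thesis using can_swap[of e c' "swap c e P" a] extrude d by (auto simp: transpose_def)
    qed
    moreover have "d \<noteq> e" using e d subj_names by auto
    ultimately show "d \<noteq> c \<and> can P d" using dc can_swap[of c e P d] by (simp add: transpose_def)
  }
  {
    assume "d \<noteq> c \<and> can P d"
    then obtain l P' where st: "P \<midarrow>Lab l\<rightarrow> P'" and d: "subj l = d" "d \<noteq> c" by (auto simp: can_def)
    obtain l' P'' where st': "P \<midarrow>Lab l'\<rightarrow> P''" "subj l' = d" "bn_label l' \<inter> {c} = {}"
      using step_fresh_bn[OF st, of "{c}"] d by auto
    show "can (loc c P) d"
    proof (cases l')
      case (In a b)
      obtain e where "e \<notin> {c}" by (erule fresh_name) simp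
      moreover obtain P3 where "P \<midarrow>Lab (In a e)\<rightarrow> P3" using step_input_any st' In by blast
      ultimately have "loc c P \<midarrow>Lab (In a e)\<rightarrow> loc c P3" using wf d st' In by (intro loc_step_res) auto
      then show ?thesis using st' In unfolding can_def by (metis subj.simps(1))
    next
      case (Out a b)
      have "\<exists>l X. loc c P \<midarrow>Lab l\<rightarrow> X \<and> subj l = a"
      proof (cases "b = c")
        case True
        then have "loc c P \<midarrow>Lab (BOut a c)\<rightarrow> P''" using wf d st' Out by (intro loc_step_extrude) auto
        then show ?thesis by (metis subj.simps(3))
      next
        case False
        then have "loc c P \<midarrow>Lab (Out a b)\<rightarrow> loc c P''" using wf d st' Out by (intro loc_step_res) auto
        then show ?thesis by (metis subj.simps(2))
      qed
      then show ?thesis using st' Out by (simp add: can_def)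
    next
      case (BOut a b)
      then have "loc c P \<midarrow>Lab (BOut a b)\<rightarrow> loc c P''" using wf d st' by (intro loc_step_res) auto
      then show ?thesis using st' BOut unfolding can_def by (metis subj.simps(3))
    qed
  }
qed

lemma barb_loc:
  assumes "pi_process P" shows "barb (loc c P) d \<longleftrightarrow> d \<noteq> c \<and> barb P d"
proof
  assume "barb (loc c P) d"
  then obtain X where X: "taus (loc c P) X" "can X d" by (auto simp: barb_def)
  obtain P' where P': "taus P P'" "X = loc c P'" using X(1) assms by (rule taus_locE)
  then show "d \<noteq> c \<and> barb P d"
    using X(2) can_loc[OF taus_pi_process[OF P'(1) assms], of c d] unfolding barb_def by blast
next
  assume "d \<noteq> c \<and> barb P d"
  then obtain P' where P': "taus P P'" "can P' d" "d \<noteq> c" by (auto simp: barb_def)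
  then have "can (loc c P') d" using can_loc[OF taus_pi_process[OF P'(1) assms]] by simp
  then show "barb (loc c P) d" using taus_loc[OF P'(1) assms] unfolding barb_def by blast
qed

lemma abs_eq_barb:
  assumes "P =\<^sub>\<pi> Q" shows "barb P d \<longleftrightarrow> barb Q d"
proof -
  have locs: "foldr loc cs P =\<^sub>\<pi> foldr loc cs Q" for cs
    by (induction cs) (auto simp: assms intro: abs_eq_loc)
  have pr: "pi_process (foldr loc cs T)" if "pi_process T" for cs T
    by (induction cs) (auto simp: that pi_process_loc)
  have barbs: "barb (foldr loc cs T) x \<longleftrightarrow> x \<notin> set cs \<and> barb T x" if "pi_process T" for cs T x
    by (induction cs) (auto simp: barb_loc pr that)
  obtain cs where cs: "set cs = gn P \<union> gn Q - {d}"
    using finite_list[of "gn P \<union> gn Q - {d}"] by auto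
  have "observable (foldr loc cs T) \<longleftrightarrow> barb T d" if "pi_process T" "gn T \<subseteq> gn P \<union> gn Q" for T
    using barbs[OF that(1)] barb_gn that(2) cs unfolding observable_barb by blast
  then show ?thesis
    using abs_eq_observable[OF locs] abs_eq_processes[OF assms] by (metis Un_upper1 Un_upper2)
qed

section \<open>Extruded names\<close>

lemma abs_eq_Par_comm: "pi_process P \<Longrightarrow> pi_process Q \<Longrightarrow> Par P Q =\<^sub>\<pi> Par Q P"
  and abs_eq_Par_assoc: "pi_process P \<Longrightarrow> pi_process Q \<Longrightarrow> pi_process R \<Longrightarrow>
    Par (Par P Q) R =\<^sub>\<pi> Par P (Par Q R)"
  and abs_eq_Par_Zero: "pi_process P \<Longrightarrow> Par P Zero =\<^sub>\<pi> P"
  and abs_eq_loc_Par: "pi_process P \<Longrightarrow> pi_process Q \<Longrightarrow> c \<notin> gn P \<Longrightarrow> loc c (Par P Q) =\<^sub>\<pi> Par P (loc c Q)"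
  and abs_eq_exchange: "pi_process P \<Longrightarrow> loc c (loc d P) =\<^sub>\<pi> loc d (loc c P)"
  by (simp_all add: scong_abs_eq scong.comm scong.assoc scong.zero scong.ext scong.exchange)

lemma abs_eq_Par_right_comm:
  assumes "pi_process P" "pi_process Q" "pi_process R"
  shows "Par (Par P Q) R =\<^sub>\<pi> Par (Par P R) Q"
proof -
  have "Par (Par P Q) R =\<^sub>\<pi> Par P (Par Q R)" using assms by (rule abs_eq_Par_assoc)
  also have "\<dots> =\<^sub>\<pi> Par P (Par R Q)" using assms by (intro abs_eq_par abs_eq_refl abs_eq_Par_comm)
  also have "\<dots> =\<^sub>\<pi> Par (Par P R) Q" using assms by (intro abs_eq_sym[OF abs_eq_Par_assoc])
  finally show ?thesis .
qed

lemma abs_eq_loc_Par2: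
  assumes "pi_process P" "pi_process Q" "c \<notin> gn Q"
  shows "loc c (Par P Q) =\<^sub>\<pi> Par (loc c P) Q"
proof -
  have "loc c (Par P Q) =\<^sub>\<pi> loc c (Par Q P)" using assms by (intro abs_eq_loc abs_eq_Par_comm)
  also have "\<dots> =\<^sub>\<pi> Par Q (loc c P)" using assms by (intro abs_eq_loc_Par)
  also have "\<dots> =\<^sub>\<pi> Par (loc c P) Q" using assms by (intro abs_eq_Par_comm pi_process_loc)
  finally show ?thesis .
qed

section \<open>Outputs on a fresh channel\<close>

definition send :: "name \<Rightarrow> name \<Rightarrow> pterm" where
  "send m c = OutSum (Nm m) [(Nm c, Zero)]"

lemma pi_process_send [simp]: "pi_process (send m c)"
  by (auto simp: pi_process_iff send_def)

lemma gn_send [simp]: "gn (send m c) = {m, c}"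
  by (auto simp: send_def)

lemma swap_send [simp]: "swap a b (send m c) = send (transpose a b m) (transpose a b c)"
  by (simp add: send_def)

lemma inst_send [simp]: "inst (send m c) d = send m c"
  by (simp add: send_def inst_def)

lemma step_send [simp]: "send m c \<midarrow>l\<rightarrow> X \<longleftrightarrow> l = Lab (Out m c) \<and> X = Zero"
  by (auto simp: send_def)

lemma can_send [simp]: "can (send m c) d \<longleftrightarrow> d = m"
  unfolding can_def by auto

lemma loc_send_abs_eq: "loc m (send m c) =\<^sub>\<pi> Zero"
proof (intro pi_bisimilar_abs_eq same_transitions_pi_bisimilar)
  fix l X
  have "\<not> loc m (send m c) \<midarrow>l\<rightarrow> X"
  proof
    assume st: "loc m (send m c) \<midarrow>l\<rightarrow> X"
    show False
    proof (cases l)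
      case (Lab lb)
      then have "can (loc m (send m c)) (subj lb)" using st by (auto simp: can_def)
      then show False using can_loc[of "send m c" m "subj lb"] by simp
    next
      case Tau
      then have "tau (loc m (send m c)) X" using st by (simp add: tau_def)
      then show False by (rule tau_locE) (auto simp: tau_def)
    qed
  qed
  then show "loc m (send m c) \<midarrow>l\<rightarrow> X \<longleftrightarrow> Zero \<midarrow>l\<rightarrow> X" by simp
qed (auto intro: pi_process_loc)

lemma abs_eq_drop_send:
  assumes "pi_process P" "m \<notin> gn P"
  shows "loc m (Par P (send m c)) =\<^sub>\<pi> P"
proof -
  have "loc m (Par P (send m c)) =\<^sub>\<pi> Par P (loc m (send m c))" using assms by (intro abs_eq_loc_Par) auto
  also have "\<dots> =\<^sub>\<pi> Par P Zero" using assms by (intro abs_eq_par abs_eq_refl loc_send_abs_eq)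
  also have "\<dots> =\<^sub>\<pi> P" using assms by (intro abs_eq_Par_Zero)
  finally show ?thesis .
qed

text \<open>Localizing \<open>m\<close> makes the output inert, since neither \<open>P\<close> nor
  \<open>Q\<close> knows its channel. The object \<open>c\<close> may well occur in both.\<close>

lemma abs_eq_cancel_send:
  assumes "Par P (send m c) =\<^sub>\<pi> Par Q (send m c)" "m \<notin> gn P" "m \<notin> gn Q"
  shows "P =\<^sub>\<pi> Q"
proof -
  have pr: "pi_process P" "pi_process Q" using abs_eq_processes[OF assms(1)] by auto
  have "P =\<^sub>\<pi> loc m (Par P (send m c))" using pr assms by (intro abs_eq_sym[OF abs_eq_drop_send])
  also have "\<dots> =\<^sub>\<pi> loc m (Par Q (send m c))" using assms by (intro abs_eq_loc)
  also have "\<dots> =\<^sub>\<pi> Q" using pr assms by (intro abs_eq_drop_send)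
  finally show ?thesis .
qed

lemma tau_Par_sendE:
  assumes "tau (Par P (send m c)) X" "m \<notin> gn P"
  obtains P' where "tau P P'" "X = Par P' (send m c)"
proof -
  obtain e where e: "e \<notin> gn P \<union> gn (send m c)" by (erule fresh_name) simp
  have subjP: "subj l \<noteq> m" if "P \<midarrow>Lab l\<rightarrow> P'" for l P' using step_subj[OF that] assms(2) by auto
  have st: "Par P (send m c) \<midarrow>Tau\<rightarrow> X" using assms(1) by (simp add: tau_def)
  have e': "e \<notin> gn P" "e \<notin> gn (send m c)" using e by auto
  from st e' show thesis
  proof (cases rule: step_Par_tauE)
    case (left P')
    then show ?thesis using that by (simp add: tau_def)
  qed (use subjP in force)+
qed

definition export :: "name \<Rightarrow> name \<Rightarrow> pterm \<Rightarrow> pterm" where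
  "export m c P = loc c (Par P (send m c))"

lemma gn_export [simp]: "gn (export m c P) = insert m (gn P) - {c}"
  by (auto simp: export_def)

lemma export_cong: "P =\<^sub>\<pi> Q \<Longrightarrow> export m c P =\<^sub>\<pi> export m c Q"
  unfolding export_def by (intro abs_eq_loc abs_eq_par abs_eq_refl) auto

lemma swap_export:
  "swap a b (export m c P) = export (transpose a b m) (transpose a b c) (swap a b P)"
  by (simp add: export_def swap_loc)

lemma tau_export: "pi_process P \<Longrightarrow> tau P P' \<Longrightarrow> tau (export m c P) (export m c P')"
  unfolding export_def by (intro tau_loc tau_Par1) auto

lemma taus_export: "pi_process P \<Longrightarrow> taus P P' \<Longrightarrow> taus (export m c P) (export m c P')"
  unfolding export_def by (intro taus_loc taus_Par1) auto

text \<open>A process in which \<open>m\<close> is not global cannot consume the output on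
  \<open>m\<close>. Exporting thus neither adds nor removes internal steps, which carries divergence
  and bisimulation through it.\<close>

lemma tau_exportE:
  assumes "tau (export m c P) X" "pi_process P" "m \<notin> gn P"
  obtains P' where "tau P P'" "X = export m c P'"
  using assms unfolding export_def
  by (metis pi_process_send pi_process_simps(2) tau_Par_sendE tau_locE)

lemma taus_exportE:
  assumes "taus (export m c P) X" "pi_process P" "m \<notin> gn P"
  obtains P' where "taus P P'" "X = export m c P'"
proof -
  have "\<exists>P'. taus P P' \<and> X = export m c P'" using assms(1)
  proof (induction rule: rtranclp_induct)
    case (step Y Z)
    then obtain P' where P': "taus P P'" "Y = export m c P'" by blast
    have "pi_process P'" "m \<notin> gn P'"
      using taus_pi_process[OF P'(1) assms(2)] taus_gn[OF P'(1)] assms(3) by auto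
    with step(2)[unfolded P'(2)] obtain P'' where "tau P' P''" "Z = export m c P''"
      by (rule tau_exportE)
    then show ?case using rtranclp.rtrancl_into_rtrancl[OF P'(1)] by blast
  qed auto
  then show ?thesis using that by blast
qed

lemma loc_export:
  assumes "pi_process P" "m \<notin> gn P" "m \<noteq> c"
  shows "loc m (export m c P) =\<^sub>\<pi> loc c P"
proof -
  have "loc m (export m c P) =\<^sub>\<pi> loc c (loc m (Par P (send m c)))"
    unfolding export_def using assms by (intro abs_eq_exchange) auto
  also have "\<dots> =\<^sub>\<pi> loc c P" using assms by (intro abs_eq_loc abs_eq_drop_send)
  finally show ?thesis .
qed

lemma export_loc_abs_eq:
  assumes "pi_process P" "d \<noteq> m" "d \<noteq> c"
  shows "export m c (loc d P) =\<^sub>\<pi> loc d (export m c P)"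
proof -
  have "export m c (loc d P) =\<^sub>\<pi> loc c (loc d (Par P (send m c)))"
    unfolding export_def using assms by (intro abs_eq_loc abs_eq_sym[OF abs_eq_loc_Par2]) auto
  also have "\<dots> =\<^sub>\<pi> loc d (export m c P)"
    unfolding export_def using assms by (intro abs_eq_exchange) auto
  finally show ?thesis .
qed

text \<open>Transposing \<open>m\<close> and \<open>m'\<close> fixes \<open>P\<close>,
  \<open>Q\<close> and \<open>c\<close>, so any fresh channel is as good as another.\<close>

lemma export_rename:
  assumes "export m c P =\<^sub>\<pi> export m c Q"
    and "m \<notin> gn P \<union> gn Q" "m' \<notin> gn P \<union> gn Q" "m \<noteq> c" "m' \<noteq> c"
  shows "export m' c P =\<^sub>\<pi> export m' c Q"
  using abs_eq_swap[OF assms(1), of m m'] assms(2-)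
  by (simp add: swap_export swap_fresh transpose_def)

text \<open>
  A receiver on \<open>m\<close> obtains the local name \<open>c\<close>; it can then run an arbitrary process that shares
  \<open>c\<close> with \<open>P\<close> and forward \<open>c\<close> on \<open>m'\<close>.
\<close>

definition receiver :: "name \<Rightarrow> name \<Rightarrow> name \<Rightarrow> pterm \<Rightarrow> pterm" where
  "receiver m m' c L = InSum (Nm m) [abst (Nm c) (Par L (send m' c))]"

context
  fixes m m' c :: name and L :: pterm
  assumes L: "pi_process L" and m: "m \<notin> gn L" "m \<noteq> c" "m' \<noteq> c" "m \<noteq> m'"
begin

lemma pi_process_receiver: "pi_process (receiver m m' c L)"
proof -
  have "wft 0 (Par L (send m' c))" "fv (Par L (send m' c)) = {}"
    using L pi_process_send by (auto simp: pi_process_iff)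
  then show ?thesis using wft_abst by (auto simp: pi_process_iff receiver_def)
qed

lemma gn_receiver: "c \<notin> gn (receiver m m' c L)"
  using m by (simp add: receiver_def)

lemma step_receiver: "receiver m m' c L \<midarrow>l\<rightarrow> X \<Longrightarrow> \<exists>b. l = Lab (In m b)"
  by (auto simp: receiver_def)

lemma step_receiver_c: "receiver m m' c L \<midarrow>Lab (In m c)\<rightarrow> X \<longleftrightarrow> X = Par L (send m' c)"
  using L inst_abst[of "Par L (send m' c)" c] pi_process_send[of m' c]
  by (simp add: receiver_def pi_process_iff)

text \<open>\<open>P\<close> has no access to \<open>m\<close>, the receiver only inputs on
  \<open>m\<close>, and the localized \<open>c\<close> can leave its scope only by extrusion. Apart
  from steps of \<open>P\<close>, the handover of \<open>c\<close> is thus the only one.\<close>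

lemma tau_export_receiver:
  assumes P: "pi_process P" "m \<notin> gn P"
  shows "tau (Par (export m c P) (receiver m m' c L)) X \<longleftrightarrow>
    (\<exists>P'. tau P P' \<and> X = Par (export m c P') (receiver m m' c L)) \<or>
    X = loc c (Par (Par P Zero) (Par L (send m' c)))"
proof
  have wf: "wft 0 (Par P (send m c))" using P pi_process_send[of m c] by (simp add: pi_process_iff)
  {
    assume "tau (Par (export m c P) (receiver m m' c L)) X"
    then have st: "Par (export m c P) (receiver m m' c L) \<midarrow>Tau\<rightarrow> X" by (simp add: tau_def)
    have c: "c \<notin> gn (export m c P)" by simp
    from st c gn_receiver show "(\<exists>P'. tau P P' \<and> X = Par (export m c P') (receiver m m' c L)) \<or>
      X = loc c (Par (Par P Zero) (Par L (send m' c)))"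
    proof (cases rule: step_Par_tauE)
      case (left Y)
      then show ?thesis using tau_exportE[of m c P Y] P by (auto simp: tau_def)
    next
      case (out_in a b S' T')
      have a: "a = m" using step_receiver[OF out_in(2)] by simp
      \<comment> \<open>A free output cannot carry the localized \<open>c\<close>, so on channel
        \<open>m\<close> it would have to come from \<open>P\<close>.\<close>
      have b: "b \<noteq> c" using step_Out_gn[OF out_in(1)] by auto
      have "loc c (Par P (send m c)) \<midarrow>Lab (Out m b)\<rightarrow> S'" using out_in(1) a by (simp add: export_def)
      then obtain Y where "Par P (send m c) \<midarrow>Lab (Out m b)\<rightarrow> Y"
        by (rule loc_stepE) (use wf m b in auto)
      then show ?thesis
      proof (cases rule: step_Par_labE)
        case (left S'')
        then show ?thesis using step_subj[OF left(1)] P by simp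
      next
        case (right T'')
        then show ?thesis using b by simp
      qed
    next
      case (bout_in a S' T')
      have a: "a = m" using step_receiver[OF bout_in(2)] by simp
      have T': "T' = Par L (send m' c)" using bout_in(2) a step_receiver_c by simp
      have "loc c (Par P (send m c)) \<midarrow>Lab (BOut m c)\<rightarrow> S'" using bout_in(1) a by (simp add: export_def)
      then show ?thesis using wf
      proof (cases rule: loc_BOutE)
        case extrude
        then have "S' = Par P Zero"
        proof (cases rule: step_Par_labE)
          case (left S'')
          then show ?thesis using step_subj[OF left(1)] P by simp
        qed auto
        then show ?thesis using bout_in(3) T' by simp
      next
        case (res c' Y)
        \<comment> \<open>Since \<open>send\<close> outputs only freely, such an announcement on
          \<open>m\<close> would have to be made by the renamed \<open>P\<close>, in which
          \<open>m\<close> is still not global.\<close>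
        have "Par (swap c c' P) (send m c') \<midarrow>Lab (BOut m c)\<rightarrow> Y"
          using res m by (simp add: transpose_def split: if_splits)
        then show ?thesis
        proof (cases rule: step_Par_labE)
          case (left S'')
          then show ?thesis using step_subj[OF left(1)] P m res(2) by (auto simp: transpose_def)
        qed auto
      qed
    qed (auto dest: step_receiver)
  }
  {
    assume "(\<exists>P'. tau P P' \<and> X = Par (export m c P') (receiver m m' c L)) \<or>
      X = loc c (Par (Par P Zero) (Par L (send m' c)))"
    then show "tau (Par (export m c P) (receiver m m' c L)) X"
    proof
      assume "\<exists>P'. tau P P' \<and> X = Par (export m c P') (receiver m m' c L)"
      then show ?thesis using tau_export P tau_Par1 by blast
    next
      assume X: "X = loc c (Par (Par P Zero) (Par L (send m' c)))"
      have "export m c P \<midarrow>Lab (BOut m c)\<rightarrow> Par P Zero"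
        unfolding export_def using wf m by (intro loc_step_extrude step_Par_labI2) auto
      then show ?thesis
        unfolding X tau_def using step_receiver_c gn_receiver by (intro step.close_l) auto
    qed
  }
qed

lemma received_abs_eq:
  assumes "pi_process P"
  shows "loc c (Par (Par P Zero) (Par L (send m' c))) =\<^sub>\<pi> export m' c (Par L P)"
  unfolding export_def
proof (rule abs_eq_loc)
  have "Par (Par P Zero) (Par L (send m' c)) =\<^sub>\<pi> Par P (Par L (send m' c))"
    using assms L by (intro abs_eq_par abs_eq_refl abs_eq_Par_Zero) auto
  also have "\<dots> =\<^sub>\<pi> Par (Par P L) (send m' c)"
    using assms L by (intro abs_eq_sym[OF abs_eq_Par_assoc]) auto
  also have "\<dots> =\<^sub>\<pi> Par (Par L P) (send m' c)"
    using assms L by (intro abs_eq_par abs_eq_refl abs_eq_Par_comm) auto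
  finally show "Par (Par P Zero) (Par L (send m' c)) =\<^sub>\<pi> Par (Par L P) (send m' c)" .
qed

text \<open>The barb \<open>m\<close> tells whether the handover has taken place: every
  \<open>C T\<close> has it, and afterwards \<open>m\<close> is no longer global. So the handover in
  \<open>C P\<close> cannot be answered by standing still; the answer of \<open>C Q\<close> consists
  of internal steps of \<open>Q\<close> followed by the handover.\<close>

lemma export_Par_half:
  assumes P: "pi_process P" "m \<notin> gn P" and Q: "pi_process Q" "m \<notin> gn Q"
    and eq: "export m c P =\<^sub>\<pi> export m c Q"
  obtains Q' where "taus Q Q'" "export m' c (Par L Q') =\<^sub>\<pi> export m' c (Par L P)"
proof -
  define C where "C = (\<lambda>T. Par (export m c T) (receiver m m' c L))"
  define F where "F = (\<lambda>T. loc c (Par (Par T Zero) (Par L (send m' c))))"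
  have mF: "m \<notin> gn (F T)" if "m \<notin> gn T" for T using that m by (simp add: F_def)
  have barbC: "barb (C T) m" for T
  proof (rule can_barb)
    have "C T \<midarrow>Lab (In m c)\<rightarrow> Par (export m c T) (Par L (send m' c))"
      unfolding C_def using step_receiver_c by (intro step_Par_labI2) auto
    then show "can (C T) m" unfolding can_def by (metis subj.simps(1))
  qed
  have barbF: "\<not> barb X m" if "m \<notin> gn X" for X using barb_gn that by blast
  have reach: "(\<exists>Q'. taus Q Q' \<and> X = C Q') \<or> m \<notin> gn X" if "taus (C Q) X" for X
    using that
  proof (induction rule: rtranclp_induct)
    case (step Y Z)
    from step(3) show ?case
    proof
      assume "\<exists>Q'. taus Q Q' \<and> Y = C Q'"
      then obtain Q' where Q': "taus Q Q'" "Y = C Q'" by blast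
      have fr: "pi_process Q'" "m \<notin> gn Q'"
        using taus_pi_process[OF Q'(1) Q(1)] taus_gn[OF Q'(1)] Q(2) by auto
      from step(2) have "(\<exists>P'. tau Q' P' \<and> Z = C P') \<or> Z = F Q'"
        unfolding Q'(2) C_def F_def tau_export_receiver[OF fr] .
      then show ?thesis using mF[OF fr(2)] rtranclp.rtrancl_into_rtrancl[OF Q'(1)] by blast
    qed (use tau_gn[OF step(2)] in blast)
  qed auto
  have CF: "tau (C P) (F P)" unfolding C_def F_def using tau_export_receiver[OF P] by blast
  have CC: "C Q =\<^sub>\<pi> C P"
    unfolding C_def using pi_process_receiver by (intro abs_eq_par abs_eq_refl abs_eq_sym[OF eq])
  have notF: "\<not> X =\<^sub>\<pi> F P" if "barb X m" for X
    using abs_eq_barb[of X "F P" m] that barbF[OF mF[OF P(2)]] by metis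
  have isC: "barb X m" if "X =\<^sub>\<pi> C P" for X
    using abs_eq_barb[OF that] barbC by metis
  from bisimulation_abs_eq CC CF consider
      X where "X =\<^sub>\<pi> C P" "X =\<^sub>\<pi> F P"
    | Y X where "taus (C Q) Y" "tau Y X" "Y =\<^sub>\<pi> C P" "X =\<^sub>\<pi> F P"
    unfolding bisimulation_half_def by blast
  then show ?thesis
  proof cases
    case 1
    then show ?thesis using isC notF by blast
  next
    case 2
    have "m \<in> gn Y" using isC[OF 2(3)] barb_gn by blast
    then obtain Q' where Q': "taus Q Q'" "Y = C Q'" using reach[OF 2(1)] by blast
    have fr: "pi_process Q'" "m \<notin> gn Q'"
      using taus_pi_process[OF Q'(1) Q(1)] taus_gn[OF Q'(1)] Q(2) by auto
    from 2(2) have "(\<exists>P'. tau Q' P' \<and> X = C P') \<or> X = F Q'"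
      unfolding Q'(2) C_def F_def tau_export_receiver[OF fr] .
    then have "X = F Q'" using notF[OF barbC] 2(4) by blast
    then have "export m' c (Par L Q') =\<^sub>\<pi> F P"
      using 2(4) received_abs_eq[OF fr(1)] abs_eq_sym abs_eq_trans unfolding F_def by blast
    also have "F P =\<^sub>\<pi> export m' c (Par L P)" unfolding F_def by (rule received_abs_eq[OF P(1)])
    finally show ?thesis using Q'(1) that by blast
  qed
qed

text \<open>Each half reaches only a derivative of the other side; together they are the premises of
  \<open>abs_eq_two_way\<close>.\<close>

lemma export_Par_abs_eq:
  assumes P: "pi_process P" "m \<notin> gn P" and Q: "pi_process Q" "m \<notin> gn Q"
    and eq: "export m c P =\<^sub>\<pi> export m c Q"
  shows "export m' c (Par L P) =\<^sub>\<pi> export m' c (Par L Q)"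
proof -
  obtain Q' where Q': "taus Q Q'" "export m' c (Par L Q') =\<^sub>\<pi> export m' c (Par L P)"
    using P Q eq by (rule export_Par_half)
  obtain P' where P': "taus P P'" "export m' c (Par L P') =\<^sub>\<pi> export m' c (Par L Q)"
    using Q P abs_eq_sym[OF eq] by (rule export_Par_half)
  show ?thesis
  proof (rule abs_eq_two_way)
    show "taus (export m' c (Par L P)) (export m' c (Par L P'))"
      using L P P' by (intro taus_export taus_Par2) auto
    show "taus (export m' c (Par L Q)) (export m' c (Par L Q'))"
      using L Q Q' by (intro taus_export taus_Par2) auto
  qed (fact P'(2) Q'(2))+
qed

end

section \<open>The relation defined by exporting a name\<close>

definition export_eq :: "name \<Rightarrow> prel" where
  "export_eq c P Q \<longleftrightarrow> pi_process P \<and> pi_process Q \<and>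
     (\<forall>m. m \<notin> gn P \<union> gn Q \<longrightarrow> m \<noteq> c \<longrightarrow> export m c P =\<^sub>\<pi> export m c Q)"

text \<open>Equality on one channel gives it on all fresh ones. The quantifier in
  \<open>export_eq\<close> lets several pairs share a channel, as transitivity does.\<close>

lemma export_eqI:
  assumes "export m c P =\<^sub>\<pi> export m c Q" "pi_process P" "pi_process Q" "m \<notin> gn P \<union> gn Q" "m \<noteq> c"
  shows "export_eq c P Q"
  unfolding export_eq_def
proof (intro conjI allI impI)
  fix m' assume "m' \<notin> gn P \<union> gn Q" "m' \<noteq> c"
  then show "export m' c P =\<^sub>\<pi> export m' c Q"
    using export_rename[OF assms(1,4) _ assms(5)] by blast
qed (rule assms)+

lemma export_eq_sym: "export_eq c P Q \<Longrightarrow> export_eq c Q P"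
  by (auto simp: export_eq_def intro: abs_eq_sym)

lemma export_eq_trans:
  assumes "export_eq c P Q" "export_eq c Q R" shows "export_eq c P R"
proof -
  obtain m where m: "m \<notin> insert c (gn P \<union> gn Q \<union> gn R)" by (erule fresh_name) simp
  then have "export m c P =\<^sub>\<pi> export m c Q" "export m c Q =\<^sub>\<pi> export m c R"
    using assms by (auto simp: export_eq_def)
  then have "export m c P =\<^sub>\<pi> export m c R" by (rule abs_eq_trans)
  then show ?thesis using assms m by (intro export_eqI) (auto simp: export_eq_def)
qed

lemma abs_eq_export_eq: "P =\<^sub>\<pi> Q \<Longrightarrow> export_eq c P Q"
  using export_cong abs_eq_processes by (auto simp: export_eq_def)

lemma export_eq_Par:
  assumes "export_eq c P Q" "pi_process L"
  shows "export_eq c (Par L P) (Par L Q)"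
proof -
  obtain m where m: "m \<notin> insert c (gn P \<union> gn Q \<union> gn L)" by (erule fresh_name) simp
  obtain m' where m': "m' \<notin> insert m (insert c (gn P \<union> gn Q \<union> gn L))" by (erule fresh_name) simp
  have "export m' c (Par L P) =\<^sub>\<pi> export m' c (Par L Q)"
    by (rule export_Par_abs_eq[of L m]) (use assms m m' in \<open>auto simp: export_eq_def\<close>)
  then show ?thesis using assms m' by (intro export_eqI) (auto simp: export_eq_def)
qed

lemma export_eq_loc:
  assumes "export_eq c P Q" shows "loc c P =\<^sub>\<pi> loc c Q"
proof -
  have pr: "pi_process P" "pi_process Q" using assms by (auto simp: export_eq_def)
  obtain m where m: "m \<notin> insert c (gn P \<union> gn Q)" by (erule fresh_name) simp
  have "loc c P =\<^sub>\<pi> loc m (export m c P)" using pr m by (intro abs_eq_sym[OF loc_export]) auto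
  also have "\<dots> =\<^sub>\<pi> loc m (export m c Q)" using assms m by (intro abs_eq_loc) (auto simp: export_eq_def)
  also have "\<dots> =\<^sub>\<pi> loc c Q" using pr m by (intro loc_export) auto
  finally show ?thesis .
qed

text \<open>The partner of \<open>l\<close>, signalling on \<open>z\<close> once it has been used. A
  process may be observable only at \<open>c\<close>, where its actions are hidden by
  \<open>export m c\<close>; the probe is therefore run within the scope of \<open>c\<close>. A
  bound output is met by the same input as a free one.\<close>

fun probe :: "label \<Rightarrow> name \<Rightarrow> pterm" where
  "probe (In a b) z = OutSum (Nm a) [(Nm b, send z z)]"
| "probe (Out a b) z = InSum (Nm a) [send z z]"
| "probe (BOut a b) z = InSum (Nm a) [send z z]"

lemma pi_process_probe: "pi_process (probe l z)"
  by (cases l) (auto simp: pi_process_iff send_def)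

lemma step_probe: "probe l z \<midarrow>l'\<rightarrow> X \<Longrightarrow> \<exists>lb. l' = Lab lb \<and> subj lb = subj l"
  by (cases l) auto

lemma barb_probe:
  assumes "taus P P1" "P1 \<midarrow>Lab l\<rightarrow> P2" "z \<notin> names_label l" "pi_process P"
  shows "barb (Par (probe l z) P) z"
proof -
  have canP: "can (Par (send z z) P2) z"
    using step_Par_labI1[of "send z z" "Out z z" Zero P2] by (auto simp: can_def)
  have "\<exists>X. tau (Par (probe l z) P1) X \<and> can X z"
  proof (cases l)
    case (In a b)
    then have "tau (Par (probe l z) P1) (Par (send z z) P2)"
      using assms(2) by (auto simp: tau_def intro!: step.com_l)
    then show ?thesis using canP by blast
  next
    case (Out a b)
    have "probe l z \<midarrow>Lab (In a b)\<rightarrow> send z z" using Out by auto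
    then have "tau (Par (probe l z) P1) (Par (send z z) P2)"
      using assms(2) Out by (auto simp: tau_def intro!: step.com_r)
    then show ?thesis using canP by blast
  next
    case (BOut a b)
    have "probe l z \<midarrow>Lab (In a b)\<rightarrow> send z z" using BOut by auto
    moreover have "b \<notin> gn (probe l z)"
      using BOut assms(3) step_BOut_neq assms(2) by auto
    ultimately have "tau (Par (probe l z) P1) (loc b (Par (send z z) P2))"
      using assms(2) BOut by (auto simp: tau_def intro!: step.close_r)
    moreover have "pi_process P2"
      using step_pi_process[OF assms(2)] taus_pi_process[OF assms(1)] assms(4) by blast
    then have "can (loc b (Par (send z z) P2)) z"
      using can_loc[of "Par (send z z) P2" b z] canP assms(3) BOut by simp
    ultimately show ?thesis by blast
  qed
  then show ?thesis
    using taus_Par2[OF assms(1)] unfolding barb_def by (meson rtranclp.rtrancl_into_rtrancl)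
qed

lemma barb_probe_observable:
  assumes "barb (Par (probe l z) Q) z" "z \<notin> names_label l"
  shows "observable Q"
proof (rule ccontr)
  assume nobs: "\<not> observable Q"
  then have silent: "\<not> Q' \<midarrow>Lab l'\<rightarrow> X" if "taus Q Q'" for Q' l' X
    using that unfolding observable_def by blast
  have reach: "\<exists>Q'. taus Q Q' \<and> Y = Par (probe l z) Q'" if "taus (Par (probe l z) Q) Y" for Y
    using that
  proof (induction rule: rtranclp_induct)
    case (step Y Z)
    then obtain Q' where Q': "taus Q Q'" "Y = Par (probe l z) Q'" by blast
    obtain e where e: "e \<notin> gn (probe l z) \<union> gn Q'" by (erule fresh_name) simp
    have "Par (probe l z) Q' \<midarrow>Tau\<rightarrow> Z" using step(2) Q' by (simp add: tau_def)
    moreover have "e \<notin> gn (probe l z)" "e \<notin> gn Q'" using e by auto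
    ultimately show ?case
    proof (cases rule: step_Par_tauE)
      case (right Q'')
      then have "tau Q' Q''" by (simp add: tau_def)
      then show ?thesis using rtranclp.rtrancl_into_rtrancl[OF Q'(1)] right(2) by blast
    qed (use silent[OF Q'(1)] step_probe in blast)+
  qed auto
  obtain Y where Y: "taus (Par (probe l z) Q) Y" "can Y z" using assms(1) by (auto simp: barb_def)
  obtain Q' where Q': "taus Q Q'" "Y = Par (probe l z) Q'" using reach[OF Y(1)] by blast
  obtain l' X where "Par (probe l z) Q' \<midarrow>Lab l'\<rightarrow> X" "subj l' = z" using Y(2) Q' by (auto simp: can_def)
  then show False
    using silent[OF Q'(1)] step_probe subj_names[of l] assms(2) by (elim step_Par_labE) fastforce+
qed

lemma export_eq_observable:
  assumes "export_eq c P Q" "observable P" shows "observable Q"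
proof -
  have pr: "pi_process P" "pi_process Q" using assms by (auto simp: export_eq_def)
  obtain P1 l P2 where P: "taus P P1" "P1 \<midarrow>Lab l\<rightarrow> P2" using assms(2) by (auto simp: observable_def)
  obtain z where z: "z \<notin> insert c (names (Lab l))" by (erule fresh_name) simp
  have "loc c (Par (probe l z) P) =\<^sub>\<pi> loc c (Par (probe l z) Q)"
    using assms(1) by (intro export_eq_loc export_eq_Par pi_process_probe)
  from abs_eq_barb[OF this, of z] have "barb (Par (probe l z) P) z \<longleftrightarrow> barb (Par (probe l z) Q) z"
    using pr z pi_process_probe barb_loc by simp
  then show ?thesis
    using barb_probe[OF P _ pr(1)] barb_probe_observable z by auto
qed

text \<open>Composition is handled one component at a time. Localizing \<open>c\<close> itself turns
  related processes into equal ones, and any other localization commutes with the export. Divergence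
  and bisimulation are inherited because a process and its export have the same internal
  steps.\<close>

lemma absolute_export_eq: "absolute (export_eq c)"
proof (rule symmetric_absolute)
  show "symp (export_eq c)" by (auto intro: sympI export_eq_sym)
  show "on_processes (export_eq c)" by (auto simp: on_processes_def export_eq_def)
  show "reflexive (export_eq c)" by (auto simp: reflexive_def intro: abs_eq_export_eq abs_eq_refl)
  show "observable P" if "export_eq c P Q" "observable Q" for P Q
    using that export_eq_observable export_eq_sym by blast
  have "export_eq c (Par K P) (Par M Q)" if "export_eq c K M" "export_eq c P Q" for K M P Q
  proof -
    have pr: "pi_process K" "pi_process M" "pi_process Q" using that by (auto simp: export_eq_def)
    have "export_eq c (Par K P) (Par K Q)" using that(2) pr(1) by (rule export_eq_Par)
    moreover have "export_eq c (Par K Q) (Par Q K)" using pr by (intro abs_eq_export_eq abs_eq_Par_comm)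
    moreover have "export_eq c (Par Q K) (Par Q M)" using that(1) pr(3) by (rule export_eq_Par)
    moreover have "export_eq c (Par Q M) (Par M Q)" using pr by (intro abs_eq_export_eq abs_eq_Par_comm)
    ultimately show ?thesis using export_eq_trans by blast
  qed
  moreover have "export_eq c (loc d P) (loc d Q)" if PQ: "export_eq c P Q" for d P Q
  proof (cases "d = c")
    case True
    then show ?thesis using PQ export_eq_loc abs_eq_export_eq by blast
  next
    case False
    have pr: "pi_process P" "pi_process Q" using PQ by (auto simp: export_eq_def)
    obtain m where m: "m \<notin> insert c (insert d (gn P \<union> gn Q))" by (erule fresh_name) simp
    have "export m c (loc d P) =\<^sub>\<pi> loc d (export m c P)"
      using pr m False by (intro export_loc_abs_eq) auto
    also have "\<dots> =\<^sub>\<pi> loc d (export m c Q)" using PQ m by (intro abs_eq_loc) (auto simp: export_eq_def)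
    also have "\<dots> =\<^sub>\<pi> export m c (loc d Q)"
      using pr m False by (intro abs_eq_sym[OF export_loc_abs_eq]) auto
    finally show ?thesis using pr m by (intro export_eqI) (auto intro: pi_process_loc)
  qed
  ultimately show "extensional (export_eq c)" by (simp add: extensional_def)
  show "codivergent_half (export_eq c)"
    unfolding codivergent_half_def
  proof (intro allI impI, elim conjE)
    fix P q assume *: "export_eq c P (q 0)" and q: "\<forall>i. tau (q i) (q (Suc i))"
    have pr: "pi_process P" "pi_process (q i)" for i
    proof -
      show "pi_process P" using * by (simp add: export_eq_def)
      show "pi_process (q i)" by (induction i) (use * q tau_pi_process in \<open>auto simp: export_eq_def\<close>)
    qed
    obtain m where m: "m \<notin> insert c (gn P \<union> gn (q 0))" by (erule fresh_name) simp
    have mq: "m \<notin> gn (q i)" for i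
      by (induction i) (use m q tau_gn in auto)
    have "\<forall>i. tau (export m c (q i)) (export m c (q (Suc i)))" using q pr tau_export by blast
    moreover have "export m c P =\<^sub>\<pi> export m c (q 0)" using * m by (auto simp: export_eq_def)
    ultimately obtain k X where k: "k \<ge> 1" "tau_weak (export m c P) X" "X =\<^sub>\<pi> export m c (q k)"
      using codivergent_abs_eq[unfolded codivergent_half_def, rule_format, of "export m c P" "\<lambda>i. export m c (q i)"]
      by blast
    obtain X1 where X1: "tau (export m c P) X1" "taus X1 X" using k(2) by (auto simp: tau_weak_eq)
    obtain P1 where P1: "tau P P1" "X1 = export m c P1" using X1(1) pr(1) by (rule tau_exportE) (use m in auto)
    obtain P' where P': "taus P1 P'" "X = export m c P'"
      using X1(2)[unfolded P1(2)] tau_pi_process[OF P1(1) pr(1)]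
      by (rule taus_exportE) (use m tau_gn[OF P1(1)] in auto)
    have tw: "tau_weak P P'" using P1 P' by (auto simp: tau_weak_eq)
    then have "pi_process P'" "m \<notin> gn P'"
      using tau_weak_taus[OF tw] taus_pi_process pr(1) taus_gn m by blast+
    then have "export_eq c P' (q k)"
      using k(3) P'(2) pr mq m by (intro export_eqI) auto
    then show "\<exists>k\<ge>1. \<exists>P'. tau_weak P P' \<and> export_eq c P' (q k)" using k(1) tw by blast
  qed
  show "bisimulation_half (export_eq c)"
    unfolding bisimulation_half_def
  proof (intro allI impI, elim conjE)
    fix P Q Q' assume *: "export_eq c P Q" and tau: "tau Q Q'"
    have pr: "pi_process P" "pi_process Q" "pi_process Q'"
      using * tau tau_pi_process by (auto simp: export_eq_def)
    obtain m where m: "m \<notin> insert c (gn P \<union> gn Q)" by (erule fresh_name) simp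
    have mQ': "m \<notin> gn Q'" using tau_gn[OF tau] m by auto
    have eq: "export m c P =\<^sub>\<pi> export m c Q" using * m by (auto simp: export_eq_def)
    have lift: "export_eq c S T" if "export m c S =\<^sub>\<pi> export m c T" "taus P S" "T = Q \<or> T = Q'" for S T
      using that(1)
    proof (rule export_eqI)
      show "pi_process S" using that(2) pr(1) by (rule taus_pi_process)
      show "pi_process T" using that(3) pr by blast
      show "m \<notin> gn S \<union> gn T" using that(3) taus_gn[OF that(2)] m mQ' by blast
      show "m \<noteq> c" using m by blast
    qed
    have reach: "\<exists>S. taus P S \<and> X = export m c S" if "taus (export m c P) X" for X
      using that pr(1) by (rule taus_exportE) (use m in auto)
    from bisimulation_abs_eq eq tau_export[OF pr(2) tau, of m c] consider
        X where "taus (export m c P) X" "X =\<^sub>\<pi> export m c Q" "X =\<^sub>\<pi> export m c Q'"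
      | Y X where "taus (export m c P) Y" "tau Y X" "Y =\<^sub>\<pi> export m c Q" "X =\<^sub>\<pi> export m c Q'"
      unfolding bisimulation_half_def by blast
    then show "(\<exists>P'. taus P P' \<and> export_eq c P' Q \<and> export_eq c P' Q') \<or>
        (\<exists>P'' P'. taus P P'' \<and> tau P'' P' \<and> export_eq c P'' Q \<and> export_eq c P' Q')"
    proof cases
      case 1
      then show ?thesis using reach[OF 1(1)] lift by blast
    next
      case 2
      obtain S where S: "taus P S" "Y = export m c S" using reach[OF 2(1)] by blast
      obtain S' where S': "tau S S'" "X = export m c S'"
        using 2(2)[unfolded S(2)] taus_pi_process[OF S(1) pr(1)]
        by (rule tau_exportE) (use m taus_gn[OF S(1)] in auto)
      have "taus P S'" using S(1) S'(1) by (rule rtranclp.rtrancl_into_rtrancl)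
      then show ?thesis using S S' 2 lift by blast
    qed
  qed
qed

lemma export_abs_eq_cancel:
  assumes "export m c P =\<^sub>\<pi> export m c Q" "pi_process P" "pi_process Q" "m \<notin> gn P \<union> gn Q" "m \<noteq> c"
  shows "P =\<^sub>\<pi> Q"
  by (rule absolute_le[OF absolute_export_eq export_eqI[OF assms]])

section \<open>Observers\<close>

definition sender :: "name \<Rightarrow> name \<Rightarrow> name \<Rightarrow> name \<Rightarrow> pterm" where
  "sender a b d e = OutSum (Nm a) [(Nm b, send d d), (Nm b, send e e)]"

text \<open>The bodies in \<open>Bs\<close> can inspect the received name as \<open>Bd 0\<close>;
  the two decoys contain no index and ignore it.\<close>

definition tester :: "name \<Rightarrow> pterm list \<Rightarrow> name \<Rightarrow> name \<Rightarrow> pterm" where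
  "tester a Bs k l = InSum (Nm a) (Bs @ [send k k, send l l])"

lemma pi_process_sender [simp]: "pi_process (sender a b d e)"
  by (auto simp: pi_process_iff sender_def send_def)

lemma gn_sender [simp]: "gn (sender a b d e) = {a, b, d, e}"
  by (auto simp: sender_def)

lemma step_sender [simp]:
  "sender a b d e \<midarrow>l\<rightarrow> X \<longleftrightarrow> l = Lab (Out a b) \<and> X \<in> {send d d, send e e}"
  by (auto simp: sender_def)

lemma gn_tester [simp]: "gn (tester a Bs k l) = {a, k, l} \<union> (\<Union>B\<in>set Bs. gn B)"
  by (auto simp: tester_def)

lemma pi_process_tester:
  "\<forall>B\<in>set Bs. wft 1 B \<and> fv B = {} \<Longrightarrow> pi_process (tester a Bs k l)"
  by (auto simp: pi_process_iff tester_def send_def)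

lemma step_tester [simp]:
  "tester a Bs k l \<midarrow>lb\<rightarrow> X \<longleftrightarrow>
   (\<exists>B x. lb = Lab (In a x) \<and> B \<in> set Bs \<union> {send k k, send l l} \<and> X = inst B x)"
  by (auto simp: tester_def)

lemma swap_abs_eq_barb:
  assumes "swap d e X =\<^sub>\<pi> X" shows "barb X d \<longleftrightarrow> barb X e"
  using abs_eq_barb[OF assms, of d] barb_swap[of d e X d] by simp

lemma barb_Par1: "barb P x \<Longrightarrow> barb (Par P Q) x"
proof -
  assume "barb P x"
  then obtain P' l P'' where P: "taus P P'" "P' \<midarrow>Lab l\<rightarrow> P''" "subj l = x" by (auto simp: barb_def can_def)
  obtain l' P3 where "P' \<midarrow>Lab l'\<rightarrow> P3" "subj l' = x" "bn_label l' \<inter> gn Q = {}"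
    using step_fresh_bn[OF P(2) finite_gn] P(3) by metis
  then have "can (Par P' Q) x" unfolding can_def using step_Par_labI1 by blast
  then show ?thesis using taus_Par1[OF P(1)] unfolding barb_def by blast
qed

lemma barb_Par2: "barb P x \<Longrightarrow> barb (Par Q P) x"
proof -
  assume "barb P x"
  then obtain P' l P'' where P: "taus P P'" "P' \<midarrow>Lab l\<rightarrow> P''" "subj l = x" by (auto simp: barb_def can_def)
  obtain l' P3 where "P' \<midarrow>Lab l'\<rightarrow> P3" "subj l' = x" "bn_label l' \<inter> gn Q = {}"
    using step_fresh_bn[OF P(2) finite_gn] P(3) by metis
  then have "can (Par Q P') x" unfolding can_def using step_Par_labI2 by blast
  then show ?thesis using taus_Par2[OF P(1)] unfolding barb_def by blast
qed

lemma barb_send [simp]: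
  "barb (send m c) m" "barb (Par P (send m c)) m" "barb (Par (Par P (send m c)) Q) m"
  by (simp_all add: can_barb barb_Par1 barb_Par2)

text \<open>
  The sender answers an input on \<open>a\<close> by \<open>d\<close> or \<open>e\<close>, and the tester answers an output on \<open>a\<close>
  by one of the continuations in \<open>Bs\<close> or by \<open>k\<close> or \<open>l\<close>.  They may also communicate with each other, so
  that all four barbs are reachable as long as neither of them has been used.
\<close>

locale observer =
  fixes a b d e k l :: name and Bs :: "pterm list"
  assumes distinct: "distinct [d, e, k, l]" and fresh: "{a, b} \<inter> {d, e, k, l} = {}"
    and bodies: "\<And>B. B \<in> set Bs \<Longrightarrow> wft 1 B \<and> fv B = {} \<and> gn B \<inter> {d, e, k, l} = {}"
begin

definition "C P = Par (Par P (sender a b d e)) (tester a Bs k l)"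

text \<open>Recognizes the states in which neither observer has been used. It is phrased in terms of
  barbs so as to be invariant under \<open>=\<^sub>\<pi>\<close>.\<close>

definition "full X \<longleftrightarrow> barb X d \<and> barb X e \<and> barb X k \<and> barb X l"

definition "new P \<longleftrightarrow> pi_process P \<and> gn P \<inter> {d, e, k, l} = {}"

lemma pi_process_tester' [simp]: "pi_process (tester a Bs k l)"
  using bodies by (intro pi_process_tester) auto

lemma gn_C: "gn (C P) = gn P \<union> {a, b, d, e, k, l} \<union> (\<Union>B\<in>set Bs. gn B)"
  by (auto simp: C_def)

lemma tau_C:
  assumes "tau (C P) X" "c \<notin> gn (C P)"
  obtains (idle) P' where "tau P P'" "X = C P'"
  | (recv) P' S' where "P \<midarrow>Lab (In a b)\<rightarrow> P'" "S' \<in> {send d d, send e e}"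
      "X = Par (Par P' S') (tester a Bs k l)"
  | (sent) P' x B where "P \<midarrow>Lab (Out a x)\<rightarrow> P'" "B \<in> set Bs \<union> {send k k, send l l}"
      "X = Par (Par P' (sender a b d e)) (inst B x)"
  | (bound) P' B where "P \<midarrow>Lab (BOut a c)\<rightarrow> P'" "B \<in> set Bs \<union> {send k k, send l l}"
      "X = loc c (Par (Par P' (sender a b d e)) (inst B c))"
  | (self) S' B where "S' \<in> {send d d, send e e}" "B \<in> set Bs \<union> {send k k, send l l}"
      "X = Par (Par P S') (inst B b)"
proof -
  have st: "Par (Par P (sender a b d e)) (tester a Bs k l) \<midarrow>Tau\<rightarrow> X"
    using assms(1) by (simp add: tau_def C_def)
  have c: "c \<notin> gn (Par P (sender a b d e))" "c \<notin> gn (tester a Bs k l)" "c \<notin> gn P" "c \<notin> gn (sender a b d e)"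
    using assms(2) by (auto simp: gn_C)
  from st c(1,2) show thesis
  proof (cases rule: step_Par_tauE)
    case (left Y)
    from left(1) c(3,4) show thesis
    proof (cases rule: step_Par_tauE)
      case left1: (left P')
      then show ?thesis using idle left by (simp add: tau_def C_def)
    next
      case (in_out a' b' P' S')
      then show ?thesis using recv left by auto
    qed auto
  next
    case (out_in a' x Y V)
    from out_in(1) show thesis
    proof (cases rule: step_Par_labE)
      case (left P')
      then show ?thesis using sent out_in by auto
    next
      case (right S')
      then show ?thesis using self out_in by auto
    qed
  next
    case (bout_in a' Y V)
    from bout_in(1) show thesis
    proof (cases rule: step_Par_labE)
      case (left P')
      then show ?thesis using bound bout_in by auto
    qed auto
  qed auto
qed

lemma tau_C_input:
  "P \<midarrow>Lab (In a b)\<rightarrow> P' \<Longrightarrow> tau (C P) (Par (Par P' (send d d)) (tester a Bs k l))"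
  unfolding C_def tau_def by (intro step_Par_tauI1 step.com_r) auto

lemma tau_C_output:
  "P \<midarrow>Lab (Out a x)\<rightarrow> P' \<Longrightarrow> B \<in> set Bs \<Longrightarrow> tau (C P) (Par (Par P' (sender a b d e)) (inst B x))"
  unfolding C_def tau_def by (rule step.com_l) (auto intro: step_Par_labI1)

lemma tau_C_bound:
  "P \<midarrow>Lab (BOut a c)\<rightarrow> P' \<Longrightarrow> B \<in> set Bs \<Longrightarrow> c \<notin> gn (C P) \<Longrightarrow>
    tau (C P) (loc c (Par (Par P' (sender a b d e)) (inst B c)))"
  unfolding C_def tau_def by (rule step.close_l) (auto intro: step_Par_labI1)

lemma tau_C_self:
  "S' \<in> {send d d, send e e} \<Longrightarrow> B \<in> {send k k, send l l} \<Longrightarrow> tau (C P) (Par (Par P S') B)"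
  unfolding C_def tau_def by (rule step.com_l) (auto intro!: step_Par_labI2)

lemma full_C: "full (C P)"
proof -
  have "barb (C P) x \<and> barb (C P) y" if "x \<in> {d, e}" "y \<in> {k, l}" for x y
  proof -
    have "tau (C P) (Par (Par P (send x x)) (send y y))" using that by (intro tau_C_self) auto
    moreover have "barb (Par (Par P (send x x)) (send y y)) x" "barb (Par (Par P (send x x)) (send y y)) y"
      by simp_all
    ultimately show ?thesis using barb_taus[OF r_into_rtranclp] by blast
  qed
  then show ?thesis by (auto simp: full_def)
qed

lemma not_barb: "x \<notin> gn X \<Longrightarrow> \<not> barb X x"
  using barb_gn by blast

lemma new_step: "new P \<Longrightarrow> P \<midarrow>lb\<rightarrow> P' \<Longrightarrow> names lb \<inter> {d, e, k, l} = {} \<Longrightarrow> new P'"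
  using step_gn step_pi_process unfolding new_def by blast

lemma new_taus: "new P \<Longrightarrow> taus P P' \<Longrightarrow> new P'"
  using taus_gn taus_pi_process unfolding new_def by blast

lemma gn_inst_body:
  "B \<in> set Bs \<Longrightarrow> x \<notin> {d, e, k, l} \<Longrightarrow> gn (inst B x) \<inter> {d, e, k, l} = {}"
  using gn_inst_subset[of B x] bodies[of B] by auto

lemma pi_process_inst_body: "B \<in> set Bs \<union> {send k k, send l l} \<Longrightarrow> pi_process (inst B x)"
  using wft_inst[of B x] bodies[of B] pi_process_send by (auto simp: pi_process_iff)

lemma input_new: "new P \<Longrightarrow> P \<midarrow>Lab (In a b)\<rightarrow> P' \<Longrightarrow> new P'"
  using new_step[of P "Lab (In a b)" P'] fresh by auto

lemma output_new:
  assumes "new P" "P \<midarrow>Lab (Out a x)\<rightarrow> P'" shows "new P' \<and> x \<notin> {d, e, k, l}"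
proof -
  have "x \<in> gn P" using step_Out_gn assms by blast
  then have x: "x \<notin> {d, e, k, l}" using assms(1) by (auto simp: new_def)
  moreover have "new P'" using new_step[OF assms] fresh x by auto
  ultimately show ?thesis by blast
qed

lemma bound_new:
  assumes "new P" "P \<midarrow>Lab (BOut a c)\<rightarrow> P'" "c \<notin> gn (C P)" shows "new P' \<and> c \<notin> {d, e, k, l}"
  using new_step[OF assms(1,2)] fresh assms(3) by (auto simp: gn_C)

text \<open>Using the sender discards \<open>d\<close> or \<open>e\<close>, and using the tester
  discards \<open>k\<close> or \<open>l\<close>, even as a global name: neither the observed process
  nor the test bodies can supply the lost one.\<close>

lemma tau_C_full:
  assumes "tau (C P) X" "new P" "full X"
  obtains P' where "tau P P'" "X = C P'"
proof -
  obtain c where c: "c \<notin> gn (C P)" by (erule fresh_name) simp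
  have bodies': "\<And>B. B \<in> set Bs \<Longrightarrow> gn B \<inter> {d, e, k, l} = {}" using bodies by blast
  from assms(1) c show thesis
  proof (cases rule: tau_C)
    case (recv P' S')
    have "d \<notin> gn X \<or> e \<notin> gn X"
      using recv input_new[OF assms(2) recv(1)] distinct fresh bodies' by (fastforce simp: new_def)
    then show ?thesis using assms(3) not_barb by (auto simp: full_def)
  next
    case (sent P' x B)
    have "k \<notin> gn X \<or> l \<notin> gn X"
      using sent output_new[OF assms(2) sent(1)] distinct fresh gn_inst_body[of B x]
      by (fastforce simp: new_def)
    then show ?thesis using assms(3) not_barb by (auto simp: full_def)
  next
    case (bound P' B)
    have "k \<notin> gn X \<or> l \<notin> gn X"
      using bound bound_new[OF assms(2) bound(1) c] distinct fresh gn_inst_body[of B c]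
      by (fastforce simp: new_def)
    then show ?thesis using assms(3) not_barb by (auto simp: full_def)
  next
    case (self S' B)
    have "k \<notin> gn X \<or> l \<notin> gn X"
      using self assms(2) distinct fresh gn_inst_body[of B b] by (fastforce simp: new_def)
    then show ?thesis using assms(3) not_barb by (auto simp: full_def)
  qed (use that in blast)
qed

lemma taus_C_full:
  assumes "taus (C P) X" "new P" "full X"
  obtains P' where "taus P P'" "X = C P'"
proof -
  have "(\<exists>P'. taus P P' \<and> X = C P') \<or> \<not> full X" using assms(1)
  proof (induction rule: rtranclp_induct)
    case (step Y Z)
    show ?case
    proof (cases "full Z")
      case True
      \<comment> \<open>Barbs are inherited backwards, so every state before a full one is full, and
        \<open>tau_C_full\<close> applies step by step.\<close>
      then have "full Y" using barb_taus[OF r_into_rtranclp[of tau Y Z]] step(2) by (auto simp: full_def)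
      with step(3) obtain P' where P': "taus P P'" "Y = C P'" by blast
      from step(2)[unfolded P'(2)] new_taus[OF assms(2) P'(1)] True
      obtain P'' where "tau P' P''" "Z = C P''" by (rule tau_C_full)
      then show ?thesis using rtranclp.rtrancl_into_rtrancl[OF P'(1)] by blast
    qed simp
  qed auto
  then show thesis using assms(3) that by blast
qed

lemma full_abs_eq: "X =\<^sub>\<pi> Y \<Longrightarrow> full X \<longleftrightarrow> full Y"
  using abs_eq_barb[of X Y] unfolding full_def by metis

text \<open>Standing still would make \<open>Y\<close> equal to \<open>C Q\<close>, which is full.
  The state before the answering step does equal \<open>C Q\<close>, hence is full and still of the
  form \<open>C P'\<close>.\<close>

lemma C_match:
  assumes eq: "C P =\<^sub>\<pi> C Q" and "new P" and tau: "tau (C Q) Y" and "\<not> full Y"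
  obtains P' X where "taus P P'" "C P' =\<^sub>\<pi> C Q" "tau (C P') X" "X =\<^sub>\<pi> Y"
proof -
  from bisimulation_abs_eq eq tau consider
      X where "X =\<^sub>\<pi> C Q" "X =\<^sub>\<pi> Y"
    | X' X where "taus (C P) X'" "tau X' X" "X' =\<^sub>\<pi> C Q" "X =\<^sub>\<pi> Y"
    unfolding bisimulation_half_def by blast
  then show thesis
  proof cases
    case 1
    then show ?thesis using full_abs_eq full_C assms(4) by metis
  next
    case 2
    have "full X'" using full_abs_eq[OF 2(3)] full_C by simp
    with 2(1) assms(2) obtain P' where "taus P P'" "X' = C P'" by (rule taus_C_full)
    then show ?thesis using 2 that by blast
  qed
qed

text \<open>The transposition permutes the two summands, so the terms differ and only their
  transitions agree.\<close>

lemma swap_sender: "swap d e (sender a b d e) =\<^sub>\<pi> sender a b d e"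
proof (intro pi_bisimilar_abs_eq same_transitions_pi_bisimilar)
  have "swap d e (sender a b d e) = OutSum (Nm a) [(Nm b, send e e), (Nm b, send d d)]"
    using fresh distinct by (auto simp: sender_def transpose_def)
  then show "swap d e (sender a b d e) \<midarrow>lb\<rightarrow> X \<longleftrightarrow> sender a b d e \<midarrow>lb\<rightarrow> X" for lb X
    by auto
qed auto

lemma swap_tester: "swap k l (tester a Bs k l) =\<^sub>\<pi> tester a Bs k l"
proof (intro pi_bisimilar_abs_eq same_transitions_pi_bisimilar)
  have "map (swap k l) Bs = Bs" using bodies by (intro map_idI swap_fresh) auto
  then have "swap k l (tester a Bs k l) = InSum (Nm a) (Bs @ [send l l, send k k])"
    using fresh distinct by (auto simp: tester_def transpose_def)
  then show "swap k l (tester a Bs k l) \<midarrow>lb\<rightarrow> X \<longleftrightarrow> tester a Bs k l \<midarrow>lb\<rightarrow> X" for lb X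
    by auto
qed auto

lemma barb_sender:
  assumes "pi_process P" "pi_process V" "gn P \<inter> {d, e} = {}" "gn V \<inter> {d, e} = {}"
  shows "barb (Par (Par P (sender a b d e)) V) d \<longleftrightarrow> barb (Par (Par P (sender a b d e)) V) e"
proof (rule swap_abs_eq_barb)
  have "swap d e P = P" "swap d e V = V" using assms by (auto intro: swap_fresh)
  then show "swap d e (Par (Par P (sender a b d e)) V) =\<^sub>\<pi> Par (Par P (sender a b d e)) V"
    using assms by (auto intro: abs_eq_par abs_eq_refl swap_sender)
qed

lemma barb_tester:
  assumes "pi_process P" "gn P \<inter> {k, l} = {}"
  shows "barb (Par P (tester a Bs k l)) k \<longleftrightarrow> barb (Par P (tester a Bs k l)) l"
proof (rule swap_abs_eq_barb)
  have "swap k l P = P" using assms by (auto intro: swap_fresh)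
  then show "swap k l (Par P (tester a Bs k l)) =\<^sub>\<pi> Par P (tester a Bs k l)"
    using assms by (auto intro: abs_eq_par abs_eq_refl swap_tester)
qed

lemma barb_output:
  assumes "new P" "P \<midarrow>Lab (Out a x)\<rightarrow> P'" "B \<in> set Bs \<union> {send k k, send l l}"
  shows "barb (Par (Par P' (sender a b d e)) (inst B x)) d \<longleftrightarrow> barb (Par (Par P' (sender a b d e)) (inst B x)) e"
  using output_new[OF assms(1,2)] gn_inst_body[of B x] pi_process_inst_body[of B x] assms(3) distinct
  by (intro barb_sender) (auto simp: new_def)

lemma barb_bound:
  assumes "new P" "P \<midarrow>Lab (BOut a c)\<rightarrow> P'" "c \<notin> gn (C P)" "B \<in> set Bs \<union> {send k k, send l l}"
  shows "barb (loc c (Par (Par P' (sender a b d e)) (inst B c))) d \<longleftrightarrow>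
    barb (loc c (Par (Par P' (sender a b d e)) (inst B c))) e"
proof -
  have new: "new P'" "c \<notin> {d, e, k, l}" using bound_new[OF assms(1-3)] by auto
  then have "barb (Par (Par P' (sender a b d e)) (inst B c)) d \<longleftrightarrow> barb (Par (Par P' (sender a b d e)) (inst B c)) e"
    using gn_inst_body[of B c] pi_process_inst_body[of B c] assms(4) distinct
    by (intro barb_sender) (auto simp: new_def)
  then show ?thesis
    using new pi_process_inst_body[OF assms(4)] by (auto simp: barb_loc new_def)
qed

text \<open>The counterpart of \<open>barb_sender\<close>: the chosen decoy is present, and the
  other one is not even a global name any more.\<close>

lemma barb_used_sender:
  assumes "S' \<in> {send d d, send e e}" "gn T \<inter> {d, e} = {}" "gn V \<inter> {d, e} = {}"
  shows "barb (Par (Par T S') V) d \<noteq> barb (Par (Par T S') V) e"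
proof (cases "S' = send d d")
  case True
  have "e \<notin> gn (Par (Par T S') V)" using assms True distinct by auto
  then show ?thesis using True not_barb by auto
next
  case False
  have "d \<notin> gn (Par (Par T S') V)" using assms False distinct by auto
  then show ?thesis using False assms(1) not_barb by auto
qed

lemma C_cancel_half:
  assumes eq: "C P =\<^sub>\<pi> C Q" and new: "new P" "new Q"
  obtains P' where "taus P P'" "P' =\<^sub>\<pi> Q"
proof -
  define Y where "Y = Par (Par Q (send d d)) (send k k)"
  have "e \<notin> gn Y" "l \<notin> gn Y" unfolding Y_def using new(2) distinct by (auto simp: new_def)
  then have Y: "barb Y d" "barb Y k" "\<not> barb Y e" "\<not> barb Y l"
    by (simp_all add: not_barb) (simp_all add: Y_def)
  have "tau (C Q) Y" unfolding Y_def by (intro tau_C_self) auto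
  moreover have "\<not> full Y" using Y by (simp add: full_def)
  ultimately obtain P' X where P': "taus P P'" "C P' =\<^sub>\<pi> C Q" "tau (C P') X" "X =\<^sub>\<pi> Y"
    using C_match[OF eq new(1)] by blast
  have new': "new P'" using new_taus[OF new(1) P'(1)] .
  have X: "barb X d" "barb X k" "\<not> barb X e" "\<not> barb X l"
    using Y abs_eq_barb[OF P'(4)] by auto
  obtain c where c: "c \<notin> gn (C P')" by (erule fresh_name) simp
  from P'(3) c show thesis
  proof (cases rule: tau_C)
    case (idle P'')
    then show ?thesis using X full_C by (simp add: full_def)
  next
    case (recv P'' S')
    have "barb X k \<longleftrightarrow> barb X l"
      unfolding recv(3) using recv input_new[OF new' recv(1)] distinct
      by (intro barb_tester) (auto simp: new_def)
    then show ?thesis using X by simp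
  next
    case (sent P'' x B)
    then show ?thesis using X barb_output[OF new' sent(1,2)] by simp
  next
    case (bound P'' B)
    then show ?thesis using X barb_bound[OF new' bound(1) c bound(2)] by simp
  next
    case (self S' B)
    have "d \<in> gn X" "k \<in> gn X" using X barb_gn by auto
    then have "S' = send d d" "B = send k k"
      using self new' distinct fresh gn_inst_body[of B b] by (auto simp: new_def)
    then have "Par (Par P' (send d d)) (send k k) =\<^sub>\<pi> Par (Par Q (send d d)) (send k k)"
      using P'(4) self(3) by (simp add: Y_def)
    then have "Par P' (send d d) =\<^sub>\<pi> Par Q (send d d)"
      by (rule abs_eq_cancel_send) (use new' new distinct in \<open>auto simp: new_def\<close>)
    then have "P' =\<^sub>\<pi> Q"
      by (rule abs_eq_cancel_send) (use new' new distinct in \<open>auto simp: new_def\<close>)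
    then show ?thesis using P'(1) that by blast
  qed
qed

lemma C_cancel:
  assumes "C P =\<^sub>\<pi> C Q" "new P" "new Q"
  shows "P =\<^sub>\<pi> Q"
proof -
  obtain P' where "taus P P'" "P' =\<^sub>\<pi> Q" using assms by (rule C_cancel_half)
  moreover obtain Q' where "taus Q Q'" "Q' =\<^sub>\<pi> P"
    using abs_eq_sym[OF assms(1)] assms(3,2) by (rule C_cancel_half)
  ultimately show ?thesis by (rule abs_eq_two_way)
qed

lemma C_cong: "P =\<^sub>\<pi> Q \<Longrightarrow> C P =\<^sub>\<pi> C Q"
  unfolding C_def by (intro abs_eq_par abs_eq_refl) auto

text \<open>Strengthens \<open>C_match\<close> by cancelling the context, which supplies the
  equality with \<open>Q\<close> that a label clause demands just before the visible step.\<close>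

lemma C_answer:
  assumes eq: "P =\<^sub>\<pi> Q" and new: "new P" "new Q" and tau: "tau (C Q) Y" and "\<not> full Y"
  obtains P' X where "taus P P'" "P' =\<^sub>\<pi> Q" "tau (C P') X" "X =\<^sub>\<pi> Y"
proof -
  obtain P' X where P': "taus P P'" "C P' =\<^sub>\<pi> C Q" "tau (C P') X" "X =\<^sub>\<pi> Y"
    using C_match[OF C_cong[OF eq] new(1) tau assms(5)] by blast
  moreover have "P' =\<^sub>\<pi> Q" using P'(2) new_taus[OF new(1) P'(1)] new(2) by (rule C_cancel)
  ultimately show thesis using that by blast
qed

text \<open>\<open>h\<close> is the success barb of the test. The absence of \<open>k\<close> shows
  that some observer has been used, and the agreement of \<open>d\<close> and \<open>e\<close> that
  it was not the sender. As \<open>h\<close> is foreign to \<open>P\<close> and to the decoys, a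
  body from \<open>Bs\<close> must be running. What is left is a free output on \<open>a\<close>, or
  a bound one whose name can be fixed in advance as \<open>c\<close>.\<close>

lemma C_answer_output:
  assumes eq: "P =\<^sub>\<pi> Q" and new: "new P" "new Q" and tau: "tau (C Q) Y"
    and Y: "barb Y h" "\<not> barb Y k" "barb Y d \<longleftrightarrow> barb Y e"
    and h: "h \<notin> gn P" "h \<notin> {a, b, d, e, k, l}" and c: "c \<notin> gn (C P)" "c \<noteq> h"
  obtains (free) P'' P' x B where "taus P P''" "P'' =\<^sub>\<pi> Q" "P'' \<midarrow>Lab (Out a x)\<rightarrow> P'" "B \<in> set Bs"
      "Par (Par P' (sender a b d e)) (inst B x) =\<^sub>\<pi> Y" "new P'" "x \<in> gn P" "h \<notin> gn P'"
  | (opened) P'' P' B where "taus P P''" "P'' =\<^sub>\<pi> Q" "P'' \<midarrow>Lab (BOut a c)\<rightarrow> P'" "B \<in> set Bs"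
      "loc c (Par (Par P' (sender a b d e)) (inst B c)) =\<^sub>\<pi> Y" "new P'" "gn P' \<subseteq> insert a (insert c (gn P))"
proof -
  have "\<not> full Y" using Y by (simp add: full_def)
  then obtain P'' X where P'': "taus P P''" "P'' =\<^sub>\<pi> Q" "tau (C P'') X" "X =\<^sub>\<pi> Y"
    using C_answer[OF eq new tau] by blast
  have new': "new P''" using new_taus[OF new(1) P''(1)] .
  have X: "barb X h" "\<not> barb X k" "barb X d \<longleftrightarrow> barb X e"
    using Y abs_eq_barb[OF P''(4)] by auto
  have P''P: "gn P'' \<subseteq> gn P" using taus_gn[OF P''(1)] .
  have c': "c \<notin> gn (C P'')" using c P''P by (auto simp: gn_C)
  have hX: "h \<in> gn X" using X barb_gn by auto
  have bodies': "gn B \<inter> {d, e} = {}" if "B \<in> set Bs" for B using bodies[OF that] by auto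
  from P''(3) c' show thesis
  proof (cases rule: tau_C)
    case (idle T)
    then show ?thesis using X full_C by (simp add: full_def)
  next
    case (recv P' S')
    then show ?thesis
      using barb_used_sender[OF recv(2), of P' "tester a Bs k l"] X(3) input_new[OF new' recv(1)]
        distinct fresh bodies' by (auto simp: new_def)
  next
    case (self S' V)
    then show ?thesis
      using barb_used_sender[OF self(1), of P'' "inst V b"] X(3) new' distinct fresh gn_inst_body[of V b]
      by (auto simp: new_def)
  next
    case (sent P' x V)
    have x: "x \<in> gn P" using step_Out_gn[OF sent(1)] P''P by auto
    have "gn P' \<subseteq> insert a (insert x (gn P))" using step_gn[OF sent(1)] P''P by auto
    then have hP': "h \<notin> gn P'" using h x by auto
    have "V \<in> set Bs" using sent(2,3) hX hP' h by auto
    then show ?thesis using free P'' sent output_new[OF new' sent(1)] x hP' by blast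
  next
    case (bound P' V)
    have gnP': "gn P' \<subseteq> insert a (insert c (gn P))" using step_gn[OF bound(1)] P''P by auto
    then have "V \<in> set Bs" using bound(2,3) hX h c by auto
    then show ?thesis using opened P'' bound bound_new[OF new' bound(1) c'] gnP' by blast
  qed
qed

end

section \<open>Answers to labelled transitions\<close>

lemma observer_exists:
  assumes "finite (F :: name set)"
  obtains d e k l where "distinct [d, e, k, l]" "{d, e, k, l} \<inter> F = {}"
proof -
  obtain d where d: "d \<notin> F" by (erule fresh_name) (rule assms)
  obtain e where e: "e \<notin> insert d F" by (erule fresh_name) (simp add: assms)
  obtain k where k: "k \<notin> {d, e} \<union> F" by (erule fresh_name) (simp add: assms)
  obtain l where l: "l \<notin> {d, e, k} \<union> F" by (erule fresh_name) (simp add: assms)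
  show thesis by (rule that[of d e k l]) (use d e k l in auto)
qed

text \<open>Adding a sender with fresh decoys to both sides completes the context \<open>C\<close>,
  which can be cancelled as a whole.\<close>

lemma abs_eq_cancel_tester:
  assumes eq: "Par P (tester a [] k l) =\<^sub>\<pi> Par Q (tester a [] k l)"
    and fr: "k \<noteq> l" "k \<noteq> a" "l \<noteq> a" "{k, l} \<inter> (gn P \<union> gn Q) = {}"
  shows "P =\<^sub>\<pi> Q"
proof -
  have pr: "pi_process P" "pi_process Q" using abs_eq_processes[OF eq] by auto
  obtain d e where de: "d \<noteq> e" "{d, e} \<inter> ({a, k, l} \<union> gn P \<union> gn Q) = {}"
  proof -
    obtain d e k' l' where "distinct [d, e, k', l']" "{d, e, k', l'} \<inter> ({a, k, l} \<union> gn P \<union> gn Q) = {}"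
      using observer_exists[of "{a, k, l} \<union> gn P \<union> gn Q"]
        by (metis finite.simps finite_UnI finite_gn)
    then show thesis by (intro that[of d e]) auto
  qed
  \<comment> \<open>The sender may offer any name that is not a decoy; \<open>a\<close> is at
    hand.\<close>
  interpret observer a a d e k l "[]" using fr de by unfold_locales auto
  have comm: "C T =\<^sub>\<pi> Par (Par T (tester a [] k l)) (sender a a d e)" if "pi_process T" for T
    unfolding C_def using that by (intro abs_eq_Par_right_comm) auto
  have "C P =\<^sub>\<pi> Par (Par P (tester a [] k l)) (sender a a d e)" using pr by (intro comm)
  also have "\<dots> =\<^sub>\<pi> Par (Par Q (tester a [] k l)) (sender a a d e)"
    by (intro abs_eq_par abs_eq_refl eq) auto
  also have "\<dots> =\<^sub>\<pi> C Q" using pr by (intro abs_eq_sym[OF comm])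
  finally show ?thesis by (rule C_cancel) (use pr fr de in \<open>auto simp: new_def\<close>)
qed

lemma abs_eq_cancel_sender:
  assumes eq: "Par P (sender a b d e) =\<^sub>\<pi> Par Q (sender a b d e)"
    and fr: "d \<noteq> e" "{d, e} \<inter> {a, b} = {}" "{d, e} \<inter> (gn P \<union> gn Q) = {}"
  shows "P =\<^sub>\<pi> Q"
proof -
  have pr: "pi_process P" "pi_process Q" using abs_eq_processes[OF eq] by auto
  obtain k l where kl: "k \<noteq> l" "{k, l} \<inter> ({a, b, d, e} \<union> gn P \<union> gn Q) = {}"
  proof -
    obtain k l k' l' where "distinct [k, l, k', l']" "{k, l, k', l'} \<inter> ({a, b, d, e} \<union> gn P \<union> gn Q) = {}"
      using observer_exists[of "{a, b, d, e} \<union> gn P \<union> gn Q"]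
        by (metis finite.simps finite_UnI finite_gn)
    then show thesis by (intro that[of k l]) auto
  qed
  interpret observer a b d e k l "[]" using fr kl by unfold_locales auto
  have "C P =\<^sub>\<pi> C Q" unfolding C_def by (intro abs_eq_par abs_eq_refl eq) auto
  then show ?thesis by (rule C_cancel) (use pr fr kl in \<open>auto simp: new_def\<close>)
qed

text \<open>The sender offers exactly \<open>b\<close>. The barb \<open>d\<close> without
  \<open>e\<close> shows that it has been used, and the agreement of \<open>k\<close> and
  \<open>l\<close> that the tester has not; so its partner was the observed process, which has
  received \<open>b\<close>.\<close>

lemma abs_eq_input:
  assumes eq: "P =\<^sub>\<pi> Q" and step: "Q \<midarrow>Lab (In a b)\<rightarrow> Q'"
  shows "label_answer (=\<^sub>\<pi>) P Q (In a b) Q'"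
proof -
  have pr: "pi_process P" "pi_process Q" "pi_process Q'"
    using abs_eq_processes[OF eq] step_pi_process[OF step] by auto
  obtain d e k l where fr: "distinct [d, e, k, l]" "{d, e, k, l} \<inter> ({a, b} \<union> gn P \<union> gn Q) = {}"
    using observer_exists[of "{a, b} \<union> gn P \<union> gn Q"]
    by (metis finite.simps finite_UnI finite_gn)
  interpret observer a b d e k l "[]" using fr by unfold_locales auto
  have new: "new P" "new Q" using fr pr by (auto simp: new_def)
  have newQ': "new Q'" using input_new[OF new(2) step] .
  define Y where "Y = Par (Par Q' (send d d)) (tester a [] k l)"
  have Y: "barb Y d" "\<not> barb Y e" "barb Y k \<longleftrightarrow> barb Y l"
  proof -
    show "barb Y d" unfolding Y_def by simp
    show "\<not> barb Y e" unfolding Y_def using newQ' distinct fresh by (intro not_barb) (auto simp: new_def)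
    show "barb Y k \<longleftrightarrow> barb Y l"
      unfolding Y_def using newQ' distinct by (intro barb_tester) (auto simp: new_def)
  qed
  have "tau (C Q) Y" unfolding Y_def using step by (rule tau_C_input)
  moreover have "\<not> full Y" using Y by (simp add: full_def)
  ultimately obtain P'' X where P'': "taus P P''" "P'' =\<^sub>\<pi> Q" "tau (C P'') X" "X =\<^sub>\<pi> Y"
    using C_answer[OF eq new] by blast
  have new': "new P''" using new_taus[OF new(1) P''(1)] .
  have X: "barb X d" "\<not> barb X e" "barb X k \<longleftrightarrow> barb X l"
    using Y abs_eq_barb[OF P''(4)] by auto
  obtain c where c: "c \<notin> gn (C P'')" by (erule fresh_name) simp
  from P''(3) c show ?thesis
  proof (cases rule: tau_C)
    case (idle T)
    then show ?thesis using X full_C by (simp add: full_def)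
  next
    case (recv P' S')
    have newP': "new P'" using input_new[OF new' recv(1)] .
    have "d \<in> gn X" using X barb_gn by auto
    then have "S' = send d d" using recv newP' distinct fresh by (auto simp: new_def)
    then have "Par (Par P' (send d d)) (tester a [] k l) =\<^sub>\<pi> Par (Par Q' (send d d)) (tester a [] k l)"
      using P''(4) recv(3) by (simp add: Y_def)
    then have "Par P' (send d d) =\<^sub>\<pi> Par Q' (send d d)"
      by (rule abs_eq_cancel_tester) (use distinct fresh newP' newQ' in \<open>auto simp: new_def\<close>)
    then have "P' =\<^sub>\<pi> Q'"
      by (rule abs_eq_cancel_send) (use newP' newQ' in \<open>auto simp: new_def\<close>)
    then show ?thesis using P'' recv(1) unfolding label_answer_def by blast
  next
    case (sent T x B)
    then show ?thesis using X barb_output[OF new' sent(1,2)] by simp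
  next
    case (bound T B)
    then show ?thesis using X barb_bound[OF new' bound(1) c bound(2)] by simp
  next
    case (self S' B)
    \<comment> \<open>A self-communication leaves one decoy of the tester without its twin.\<close>
    obtain x y where xy: "B = send x x" "{x, y} = {k, l}" "x \<noteq> y" using self(2) distinct by auto
    have "barb X x" unfolding self(3) xy(1) by simp
    moreover have "\<not> barb X y"
      unfolding self(3) xy(1) using self(1) new' xy distinct fresh
      by (intro not_barb) (auto simp: new_def doubleton_eq_iff)
    ultimately show ?thesis using X(3) xy(2) by (auto simp: doubleton_eq_iff)
  qed
qed

lemma inst_Match [simp]:
  "inst (Match p q T) c = Match (if p = Bd 0 then Nm c else p) (if q = Bd 0 then Nm c else q) (inst T c)"
  by (simp add: inst_def)

lemma inst_Mismatch [simp]: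
  "inst (Mismatch p q T) c = Mismatch (if p = Bd 0 then Nm c else p) (if q = Bd 0 then Nm c else q) (inst T c)"
  by (simp add: inst_def)

lemma abs_eq_Match_send:
  "Match (Nm x) (Nm b) (send h h) =\<^sub>\<pi> (if x = b then send h h else Zero)"
proof (intro pi_bisimilar_abs_eq same_transitions_pi_bisimilar)
  show "pi_process (Match (Nm x) (Nm b) (send h h))" using pi_process_send by (auto simp: pi_process_iff)
qed (auto simp: step_Match)

text \<open>The test lets \<open>h\<close> appear only if the received name is \<open>b\<close>. A
  bound output fails it too, because its name is chosen different from \<open>b\<close>.\<close>

lemma abs_eq_free_output:
  assumes eq: "P =\<^sub>\<pi> Q" and step: "Q \<midarrow>Lab (Out a b)\<rightarrow> Q'"
  shows "label_answer (=\<^sub>\<pi>) P Q (Out a b) Q'"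
proof -
  have pr: "pi_process P" "pi_process Q" "pi_process Q'"
    using abs_eq_processes[OF eq] step_pi_process[OF step] by auto
  obtain h where h: "h \<notin> {a, b} \<union> gn P \<union> gn Q" by (erule fresh_name) simp
  obtain d e k l where fr: "distinct [d, e, k, l]" "{d, e, k, l} \<inter> ({a, b, h} \<union> gn P \<union> gn Q) = {}"
    using observer_exists[of "{a, b, h} \<union> gn P \<union> gn Q"]
    by (metis finite.simps finite_UnI finite_gn)
  define B where "B = Match (Bd 0) (Nm b) (send h h)"
  have instB: "inst B x = Match (Nm x) (Nm b) (send h h)" for x by (simp add: B_def)
  have gnB: "gn B = {b, h}" by (auto simp: B_def)
  interpret observer a b d e k l "[B]"
    using fr gnB by unfold_locales (auto simp: B_def send_def)
  have new: "new P" "new Q" using fr pr by (auto simp: new_def)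
  have newQ': "new Q'" using output_new[OF new(2) step] by blast
  have inst_eq: "Par (Par T (sender a b d e)) (inst B x) =\<^sub>\<pi>
      Par (Par T (sender a b d e)) (if x = b then send h h else Zero)" if "pi_process T" for T x
    unfolding instB using that by (intro abs_eq_par abs_eq_refl abs_eq_Match_send) auto
  define Y where "Y = Par (Par Q' (sender a b d e)) (inst B b)"
  have Y_eq: "Y =\<^sub>\<pi> Par (Par Q' (sender a b d e)) (send h h)"
    unfolding Y_def using inst_eq[of Q' b] pr by simp
  have Y: "barb Y h" "\<not> barb Y k" "barb Y d \<longleftrightarrow> barb Y e"
  proof -
    show "barb Y h" using abs_eq_barb[OF Y_eq] by simp
    show "\<not> barb Y k"
      unfolding Y_def instB using newQ' distinct fresh fr by (intro not_barb) (auto simp: new_def)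
    show "barb Y d \<longleftrightarrow> barb Y e"
      unfolding Y_def using step by (intro barb_output[OF new(2)]) auto
  qed
  have tau: "tau (C Q) Y" unfolding Y_def using step by (intro tau_C_output) auto
  have hP: "h \<notin> gn P" "h \<notin> {a, b, d, e, k, l}" using h fr by auto
  obtain c where "c \<notin> insert h (gn (C P))" by (erule fresh_name) simp
  then have c: "c \<notin> gn (C P)" "c \<noteq> h" by auto
  from eq new tau Y hP c show ?thesis
  proof (cases rule: C_answer_output)
    case (free P'' P' x V)
    have V: "V = B" "pi_process P'" using free(4,6) by (auto simp: new_def)
    have X_eq: "Y =\<^sub>\<pi> Par (Par P' (sender a b d e)) (if x = b then send h h else Zero)"
      using abs_eq_sym[OF free(5)[unfolded V(1)]] inst_eq[OF V(2)] by (rule abs_eq_trans)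
    have "x = b"
    proof (rule ccontr)
      assume "x \<noteq> b"
      then have "\<not> barb Y h" using abs_eq_barb[OF X_eq] free(8) hP by (auto intro!: not_barb)
      then show False using Y by simp
    qed
    then have "Par (Par P' (sender a b d e)) (send h h) =\<^sub>\<pi> Par (Par Q' (sender a b d e)) (send h h)"
      using abs_eq_trans[OF abs_eq_sym[OF X_eq] Y_eq] by simp
    then have "Par P' (sender a b d e) =\<^sub>\<pi> Par Q' (sender a b d e)"
      by (rule abs_eq_cancel_send) (use free(8) hP h step_gn[OF step] in auto)
    then have "P' =\<^sub>\<pi> Q'"
      by (rule abs_eq_cancel_sender) (use free(6) newQ' distinct fresh in \<open>auto simp: new_def\<close>)
    then show ?thesis using free(1-3) \<open>x = b\<close> unfolding label_answer_def by blast
  next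
    case (opened P'' P' V)
    have cb: "c \<noteq> b" using c by (auto simp: gn_C)
    have V: "V = B" "pi_process P'" using opened(4,6) by (auto simp: new_def)
    have "loc c (Par (Par P' (sender a b d e)) (inst B c)) =\<^sub>\<pi> loc c (Par (Par P' (sender a b d e)) Zero)"
      using inst_eq[OF V(2), of c] cb by (intro abs_eq_loc) simp
    from abs_eq_barb[OF abs_eq_trans[OF abs_eq_sym[OF this] opened(5)[unfolded V(1)]], of h]
    have "h \<in> gn (loc c (Par (Par P' (sender a b d e)) Zero))" using Y(1) barb_gn by blast
    then show ?thesis using opened(7) hP by auto
  qed
qed

text \<open>A chain of mismatches of \<open>x\<close> with all names of a list. Applied to the
  global names of a process, it lets through only names unknown to that process.\<close>

fun guard :: "nm \<Rightarrow> name list \<Rightarrow> pterm \<Rightarrow> pterm" where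
  "guard x [] T = T"
| "guard x (n # ns) T = Mismatch x (Nm n) (guard x ns T)"

lemma inst_guard: "inst (guard (Bd 0) ns T) c = guard (Nm c) ns (inst T c)"
  by (induction ns) auto

lemma gn_guard_Bd: "gn (guard (Bd i) ns T) = set ns \<union> gn T"
  by (induction ns) auto

lemma wft_guard: "wft k (guard x ns T) \<longleftrightarrow> wft k T \<and> (ns = [] \<or> scoped k x)"
  by (induction ns) auto

lemma fv_guard_Bd: "fv (guard (Bd i) ns T) = fv T"
  by (induction ns) auto

lemma fv_guard_Nm: "fv (guard (Nm x) ns T) = fv T"
  by (induction ns) auto

text \<open>The rule for mismatch also asks that the bound name of the action avoid the compared
  names; for actions without a bound name a passable guard is transparent.\<close>

lemma step_guard:
  assumes "\<And>l X. T \<midarrow>l\<rightarrow> X \<Longrightarrow> bn l = {}"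
  shows "guard (Nm x) ns T \<midarrow>l\<rightarrow> X \<longleftrightarrow> x \<notin> set ns \<and> T \<midarrow>l\<rightarrow> X"
  by (induction ns) (use assms in \<open>auto simp: step_Mismatch\<close>)

lemma abs_eq_guard:
  assumes "pi_process T" "\<And>l X. T \<midarrow>l\<rightarrow> X \<Longrightarrow> bn l = {}"
  shows "guard (Nm x) ns T =\<^sub>\<pi> (if x \<in> set ns then Zero else T)"
proof (intro pi_bisimilar_abs_eq same_transitions_pi_bisimilar)
  show "pi_process (guard (Nm x) ns T)"
    using assms(1) by (simp add: pi_process_iff wft_guard fv_guard_Nm)
qed (use assms step_guard[OF assms(2)] in auto)

lemma bn_sends: "Par (send h h) (send m x) \<midarrow>l\<rightarrow> X \<Longrightarrow> bn l = {}"
  by (cases l) (auto elim: step_Par_labE)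

text \<open>The forwarding output is moved next to \<open>T\<close>, and the scope of
  \<open>c\<close> is then narrowed to these two, which form the export of \<open>c\<close>.\<close>

lemma forwarded_abs_eq:
  assumes "pi_process T" "c \<notin> {a, d, e, h}"
  shows "loc c (Par (Par T (sender a a d e)) (Par (send h h) (send m c))) =\<^sub>\<pi>
    Par (Par (export m c T) (sender a a d e)) (send h h)"
proof -
  let ?S = "sender a a d e"
  have "Par (Par T ?S) (Par (send h h) (send m c)) =\<^sub>\<pi> Par (Par T ?S) (Par (send m c) (send h h))"
    using assms by (intro abs_eq_par abs_eq_refl abs_eq_Par_comm) auto
  also have "\<dots> =\<^sub>\<pi> Par (Par (Par T ?S) (send m c)) (send h h)"
    using assms by (intro abs_eq_sym[OF abs_eq_Par_assoc]) auto
  also have "\<dots> =\<^sub>\<pi> Par (Par (Par T (send m c)) ?S) (send h h)"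
    using assms by (intro abs_eq_par abs_eq_refl abs_eq_Par_right_comm) auto
  finally have "loc c (Par (Par T ?S) (Par (send h h) (send m c))) =\<^sub>\<pi>
      loc c (Par (Par (Par T (send m c)) ?S) (send h h))" by (rule abs_eq_loc)
  also have "\<dots> =\<^sub>\<pi> Par (loc c (Par (Par T (send m c)) ?S)) (send h h)"
    using assms by (intro abs_eq_loc_Par2) auto
  also have "\<dots> =\<^sub>\<pi> Par (Par (export m c T) ?S) (send h h)"
    unfolding export_def using assms by (intro abs_eq_par abs_eq_refl abs_eq_loc_Par2) auto
  finally show ?thesis .
qed

text \<open>As input is early, reception alone does not tell a bound output from a free one. But the
  object of a free output is global in \<open>P\<close>, so a guard against all of
  \<open>gn P\<close> admits only an extruded name. Behind the guard, \<open>h\<close> reports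
  success and the output on \<open>m\<close> keeps the name obtainable.\<close>

lemma abs_eq_bound_output:
  assumes eq: "P =\<^sub>\<pi> Q" and step: "Q \<midarrow>Lab (BOut a c)\<rightarrow> Q'" and cPQ: "c \<notin> gn P" "c \<notin> gn Q"
  shows "label_answer (=\<^sub>\<pi>) P Q (BOut a c) Q'"
proof -
  have pr: "pi_process P" "pi_process Q" "pi_process Q'"
    using abs_eq_processes[OF eq] step_pi_process[OF step] by auto
  have ac: "a \<noteq> c" using step by (rule step_BOut_neq)
  obtain h where h: "h \<notin> {a, c} \<union> gn P \<union> gn Q" by (erule fresh_name) simp
  obtain m where m: "m \<notin> {a, c, h} \<union> gn P \<union> gn Q" by (erule fresh_name) simp
  obtain d e k l where fr: "distinct [d, e, k, l]" "{d, e, k, l} \<inter> ({a, c, h, m} \<union> gn P \<union> gn Q) = {}"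
    using observer_exists[of "{a, c, h, m} \<union> gn P \<union> gn Q"]
    by (metis finite.simps finite_UnI finite_gn)
  obtain ns where ns: "set ns = gn P" using finite_list[OF finite_gn] by blast
  \<comment> \<open>\<open>Bd 0\<close> stands for the received name \<open>x\<close>, both in the
    guard and as the object of the output, which becomes \<open>send m x\<close>.\<close>
  define B where "B = guard (Bd 0) ns (Par (send h h) (OutSum (Nm m) [(Bd 0, Zero)]))"
  have instB: "inst B x = guard (Nm x) ns (Par (send h h) (send m x))" for x
    by (simp add: B_def inst_guard) (simp add: inst_def send_def)
  have gnB: "gn B = insert h (insert m (gn P))" by (auto simp: B_def gn_guard_Bd ns)
  interpret observer a a d e k l "[B]"
    using fr gnB by unfold_locales (auto simp: B_def wft_guard fv_guard_Bd send_def)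
  let ?S = "sender a a d e"
  have new: "new P" "new Q" using fr pr by (auto simp: new_def)
  have cQ: "c \<notin> gn (C Q)" using cPQ ac fr h m gnB by (auto simp: gn_C)
  have newQ': "new Q'" using bound_new[OF new(2) step cQ] by blast
  have inst_eq: "Par (Par T ?S) (inst B x) =\<^sub>\<pi>
      Par (Par T ?S) (if x \<in> gn P then Zero else Par (send h h) (send m x))" if "pi_process T" for T x
    unfolding instB ns[symmetric] using that bn_sends by (intro abs_eq_par abs_eq_refl abs_eq_guard) auto
  define Y where "Y = loc c (Par (Par Q' ?S) (inst B c))"
  have Y_eq: "Y =\<^sub>\<pi> Par (Par (export m c Q') ?S) (send h h)"
  proof -
    have "Y =\<^sub>\<pi> loc c (Par (Par Q' ?S) (Par (send h h) (send m c)))"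
      unfolding Y_def using inst_eq[OF pr(3), of c] cPQ by (intro abs_eq_loc) simp
    also have "\<dots> =\<^sub>\<pi> Par (Par (export m c Q') ?S) (send h h)"
      using pr(3) ac fr h by (intro forwarded_abs_eq) auto
    finally show ?thesis .
  qed
  have Y: "barb Y h" "\<not> barb Y k" "barb Y d \<longleftrightarrow> barb Y e"
  proof -
    show "barb Y h" using abs_eq_barb[OF Y_eq] by simp
    have "k \<notin> gn (Par (Par (export m c Q') ?S) (send h h))"
      using newQ' distinct fresh fr by (auto simp: new_def)
    then show "\<not> barb Y k" using abs_eq_barb[OF Y_eq] not_barb by blast
    show "barb Y d \<longleftrightarrow> barb Y e"
      unfolding Y_def using step cQ by (intro barb_bound[OF new(2)]) auto
  qed
  have tau: "tau (C Q) Y" unfolding Y_def using step cQ by (intro tau_C_bound) auto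
  have hP: "h \<notin> gn P" "h \<notin> {a, a, d, e, k, l}" using h fr by auto
  have c: "c \<notin> gn (C P)" "c \<noteq> h" using cPQ ac fr h m gnB by (auto simp: gn_C)
  from eq new tau Y hP c show ?thesis
  proof (cases rule: C_answer_output)
    case (free P'' P' x V)
    have V: "V = B" "pi_process P'" using free(4,6) by (auto simp: new_def)
    \<comment> \<open>The object \<open>x\<close> of a free output lies in \<open>gn P\<close>, so
      the guard blocks and nothing is left that could show \<open>h\<close>.\<close>
    have "Y =\<^sub>\<pi> Par (Par P' ?S) Zero"
      using abs_eq_trans[OF abs_eq_sym[OF free(5)[unfolded V(1)]] inst_eq[OF V(2)]] free(7) by simp
    from abs_eq_barb[OF this, of h] have "\<not> barb Y h" using free(8) hP by (auto intro!: not_barb)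
    then show ?thesis using Y by simp
  next
    case (opened P'' P' V)
    have prP': "pi_process P'" using opened(6) by (simp add: new_def)
    have gnQ': "gn Q' \<subseteq> insert a (insert c (gn Q))" using step_gn[OF step] by auto
    \<comment> \<open>With the scope of \<open>c\<close> narrowed to the export, the success barb
      and the sender stand outside it and can be cancelled before the export itself.\<close>
    have "Par (Par (export m c P') ?S) (send h h) =\<^sub>\<pi> loc c (Par (Par P' ?S) (Par (send h h) (send m c)))"
      using prP' ac fr h by (intro abs_eq_sym[OF forwarded_abs_eq]) auto
    also have "\<dots> =\<^sub>\<pi> loc c (Par (Par P' ?S) (inst B c))"
      using abs_eq_sym[OF inst_eq[OF prP', of c]] cPQ by (intro abs_eq_loc) simp
    also have "\<dots> =\<^sub>\<pi> Y" using opened(4,5) by simp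
    also have "\<dots> =\<^sub>\<pi> Par (Par (export m c Q') ?S) (send h h)" by (rule Y_eq)
    finally have "Par (export m c P') ?S =\<^sub>\<pi> Par (export m c Q') ?S"
      by (rule abs_eq_cancel_send) (use opened(7) gnQ' h m fr in auto)
    then have "export m c P' =\<^sub>\<pi> export m c Q'"
      by (rule abs_eq_cancel_sender) (use opened(6) newQ' distinct fresh fr in \<open>auto simp: new_def\<close>)
    then have "P' =\<^sub>\<pi> Q'"
      by (rule export_abs_eq_cancel) (use prP' pr opened(7) gnQ' m in auto)
    then show ?thesis using opened(1-3) unfolding label_answer_def by blast
  qed
qed

lemma pi_bisimulation_abs_eq: "pi_bisimulation (=\<^sub>\<pi>)"
proof (rule symmetric_pi_bisimulation)
  show "symp (=\<^sub>\<pi>)" by (auto intro: sympI abs_eq_sym)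
  show "on_processes (=\<^sub>\<pi>)" using abs_eq_processes by (auto simp: on_processes_def)
  show "label_half (=\<^sub>\<pi>)"
    unfolding label_half_alt
  proof (intro allI impI)
    fix P Q l Q' assume "P =\<^sub>\<pi> Q" "Q \<midarrow>Lab l\<rightarrow> Q'" "bn_label l \<inter> (gn P \<union> gn Q) = {}"
    then show "label_answer (=\<^sub>\<pi>) P Q l Q'"
      by (cases l) (auto intro: abs_eq_input abs_eq_free_output abs_eq_bound_output)
  qed
qed (rule codivergent_abs_eq bisimulation_abs_eq)+

theorem theorem3p4:
  fixes P Q :: pterm
  assumes "pi_process P" and "pi_process Q"
  shows "P \<simeq>\<^sub>\<pi> Q \<longleftrightarrow> P =\<^sub>\<pi> Q"
  using pi_bisimilar_abs_eq pi_bisimulation_abs_eq by (auto simp: pi_bisimilar_def)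

end
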